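(* Fix $A<\infty$ ($A\ge0$), $\lambda_0>0$, an integer $L\ge0$, and nonnegative taps $\mathbf h=(h_0,\dots,h_L)$ with $\sum_{\ell=0}^L h_\ell=1$. For any $F\in\mathcal P_A(P_{\rm avg})$, consider the hidden state $Q_t=(X_{t-L},\dots,X_t)\in\mathsf Q=[0,A]^{L+1}$. Let $\Pi_t^\mu$ and $\Pi_t^\nu$ be two predictive filters at time $t$, driven by the same observation sequence $Y_1,\dots,Y_{t-1}$ but initialized from arbitrary probability laws $\mu$ and $\nu$ on $\mathsf Q$. Let $\mathbb E$ denote expectation under any observation law generated by the same hidden Markov model with input marginal $F$ and an arbitrary hidden-state initial law supported on $\mathsf Q$. Then there exist constants $C<\infty$ and $0<\beta<1$, depending only on $(\lambda_0,A,\mathbf h,L)$ and not on $F$, such that $$\mathbb E\bigl[\lVert\Pi_t^\mu-\Pi_t^\nu\rVert_{\rm TV}\bigr]\le C\beta^t\lVert\mu-\nu\rVert_{\rm TV}.$$ Moreover, the associated one-step predictive log-probabilities satisfy $$\mathbb E\Bigl[\bigl|\log p_{\Pi_t^\mu}(Y_t)-\log p_{\Pi_t^\nu}(Y_t)\bigr|\Bigr]\le C\beta^t\lVert\mu-\nu\rVert_{\rm TV}.$$ Consequently, $$\sup_{F\in\mathcal P_A(P_{\rm avg})}\mathbb E_F\Bigl[\bigl|\log P_F(Y_0\mid Y_{-m}^{-1})-\log P_F(Y_0\mid Y_{-\infty}^{-1})\bigr|\Bigr]\le C\beta^m .$$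
   Context: $\mathcal P_A(P_{\rm avg})$ is the set of Borel probability measures $F$ on $[0,A]$ with $\int x\,dF(x)\le P_{\rm avg}$ (where $P_{\rm avg}\ge0$). Hidden Markov model with input marginal $F$: the inputs entering after time $0$ are i.i.d. with law $F$, so that $Q_{t}=(X_{t-L},\dots,X_t)$ is obtained from $Q_{t-1}$ by dropping the oldest entry and appending a fresh symbol $X_t\sim F$ independent of the past; given the hidden states, the observations $Y_t\in\mathbb N_0$ are conditionally independent with $Y_t\sim\operatorname{Poisson}(\lambda(Q_t))$, where for $q=(q_{-L},\dots,q_0)\in\mathsf Q$, $\lambda(q)=\lambda_0+\sum_{\ell=0}^L h_\ell q_{-\ell}$. For a probability law $\mu$ on $\mathsf Q$, $\mathsf P_F^\mu$ is the law of this model when $Q_0\sim\mu$, and the predictive filter is $\Pi_t^\mu(E)=\mathsf P_F^\mu(Q_t\in E\mid Y_1,\dots,Y_{t-1})$ for Borel $E\subseteq\mathsf Q$ (viewed as the explicit Bayes-formula function of the observed values $Y_1,\dots,Y_{t-1}$, well defined for every observation string because all Poisson likelihoods are strictly positive). For a probability measure $\pi$ on $\mathsf Q$, $p_\pi(y)=\int_{\mathsf Q}e^{-\lambda(q)}\frac{\lambda(q)^y}{y!}\,d\pi(q)$, $y\in\mathbb N_0$. In the last display, $\mathbb E_F$ and $P_F$ refer to the stationary two-sided process with $(X_k)_{k\in\mathbb Z}$ i.i.d. of law $F$ and $Y_k\mid X_{k-L}^k\sim\operatorname{Poisson}(\lambda_0+\sum_{\ell=0}^L h_\ell X_{k-\ell})$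 conditionally independent; $P_F(Y_0\mid\cdot)$ is the conditional probability mass function evaluated at $Y_0$, $Y_i^j=(Y_i,\dots,Y_j)$, and $m\ge1$. For a finite signed measure $\eta$ with Jordan decomposition $\eta^+-\eta^-$, $\lVert\eta\rVert_{\rm TV}$ is the total variation $\eta^+(\mathcal S)+\eta^-(\mathcal S)$ (so for probability measures it equals $2\sup_E|\mu(E)-\nu(E)|$). Logarithms are natural. *)

theory Defs
  imports "HOL-Probability.Probability"
begin

section \<open>Total variation of a finite signed measure\<close>

text \<open>
  A signed measure on the measurable space \<open>S\<close> is represented by its set function \<open>\<eta>\<close>; the
  set \<open>D\<close> below makes \<open>P\<close> and \<open>N\<close> mutually singular.
\<close>

definition jordan_decomposition ::
    "'a measure \<Rightarrow> ('a set \<Rightarrow> real) \<Rightarrow> 'a measure \<Rightarrow> 'a measure \<Rightarrow> bool" where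
  "jordan_decomposition S \<eta> P N \<longleftrightarrow>
     finite_measure P \<and> finite_measure N \<and> sets P = sets S \<and> sets N = sets S \<and>
     (\<forall>E\<in>sets S. \<eta> E = measure P E - measure N E) \<and>
     (\<exists>D\<in>sets S. measure P (space S - D) = 0 \<and> measure N D = 0)"

definition total_variation :: "'a measure \<Rightarrow> ('a set \<Rightarrow> real) \<Rightarrow> real" where
  "total_variation S \<eta> =
     (THE r. \<exists>P N. jordan_decomposition S \<eta> P N \<and> r = measure P (space S) + measure N (space S))"

definition tv_dist :: "'a measure \<Rightarrow> 'a measure \<Rightarrow> real" where
  "tv_dist \<mu> \<nu> = total_variation \<mu> (\<lambda>E. measure \<mu> E - measure \<nu> E)"

text \<open>The definite description is justified by the next two lemmas.\<close>

lemma total_variation_eqI: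
  assumes "jordan_decomposition S \<eta> P N"
  shows "total_variation S \<eta> = measure P (space S) + measure N (space S)"
proof -
  have le: "measure P (space S) \<le> measure P' (space S) \<and> measure N (space S) \<le> measure N' (space S)"
    if j: "jordan_decomposition S \<eta> P N" and j': "jordan_decomposition S \<eta> P' N'" for P N P' N'
  proof -
    from j have fin: "finite_measure P" "finite_measure N"
      and s: "sets P = sets S" "sets N = sets S"
      and eta: "\<And>E. E \<in> sets S \<Longrightarrow> \<eta> E = measure P E - measure N E"
      by (auto simp: jordan_decomposition_def)
    from j obtain D where D: "D \<in> sets S" "measure P (space S - D) = 0" "measure N D = 0"
      by (auto simp: jordan_decomposition_def)
    from j' have fin': "finite_measure P'" "finite_measure N'"
      and s': "sets P' = sets S" "sets N' = sets S"
      and eta': "\<And>E. E \<in> sets S \<Longrightarrow> \<eta> E = measure P' E - measure N' E"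
      by (auto simp: jordan_decomposition_def)
    interpret P: finite_measure P by fact
    interpret N: finite_measure N by fact
    interpret P': finite_measure P' by fact
    interpret N': finite_measure N' by fact
    have sp: "space P = space S" "space N = space S" "space P' = space S" "space N' = space S"
      using s s' by (auto dest: sets_eq_imp_space_eq)
    have D': "space S - D \<in> sets S" using D by auto
    have "measure P (space S) = measure P D"
      using P.finite_measure_compl[of D] D s by (simp add: sp)
    also have "\<dots> = measure P' D - measure N' D"
      using eta[OF D(1)] eta'[OF D(1)] D by simp
    also have "\<dots> \<le> measure P' (space S)"
      using P'.bounded_measure[of D] by (simp add: sp diff_le_eq add_increasing2)
    finally have 1: "measure P (space S) \<le> measure P' (space S)" .
    have "measure N (space S) = measure N (space S - D)"
      using N.finite_measure_compl[of D] D s by (simp add: sp)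
    also have "\<dots> = measure N' (space S - D) - measure P' (space S - D)"
      using eta[OF D'] eta'[OF D'] D by simp
    also have "\<dots> \<le> measure N' (space S)"
      using N'.bounded_measure[of "space S - D"] by (simp add: sp diff_le_eq add_increasing2)
    finally show ?thesis using 1 by simp
  qed
  show ?thesis
    unfolding total_variation_def
  proof (rule the_equality)
    show "\<exists>P' N'. jordan_decomposition S \<eta> P' N' \<and>
        measure P (space S) + measure N (space S) = measure P' (space S) + measure N' (space S)"
      using assms by blast
  next
    fix r assume "\<exists>P' N'. jordan_decomposition S \<eta> P' N' \<and>
        r = measure P' (space S) + measure N' (space S)"
    then obtain P' N' where j': "jordan_decomposition S \<eta> P' N'"
        "r = measure P' (space S) + measure N' (space S)" by blast
    show "r = measure P (space S) + measure N (space S)"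
      using le[OF assms j'(1)] le[OF j'(1) assms] j'(2) by linarith
  qed
qed

lemma jordan_decomposition_exists:
  assumes "finite_measure \<mu>" "finite_measure \<nu>" and sets: "sets \<nu> = sets \<mu>"
  shows "\<exists>P N. jordan_decomposition \<mu> (\<lambda>E. measure \<mu> E - measure \<nu> E) P N"
proof -
  interpret M: finite_measure \<mu> by fact
  interpret N: finite_measure \<nu> by fact
  have sp: "space \<nu> = space \<mu>" using sets by (rule sets_eq_imp_space_eq)
  from finite_unsigned_Hahn_decomposition[OF assms] obtain Y where Y: "Y \<in> sets \<mu>"
    and Hahn: "(\<forall>X\<in>sets \<mu>. X \<subseteq> Y \<longrightarrow> \<nu> X \<le> \<mu> X) \<and> (\<forall>X\<in>sets \<mu>. X \<inter> Y = {} \<longrightarrow> \<mu> X \<le> \<nu> X)"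
    by (rule bexE)
  have pos: "\<nu> X \<le> \<mu> X" if "X \<in> sets \<mu>" "X \<subseteq> Y" for X using Hahn that by simp
  have neg: "\<mu> X \<le> \<nu> X" if "X \<in> sets \<mu>" "X \<inter> Y = {}" for X using Hahn that by simp
  define Z where "Z = space \<mu> - Y"
  have Z: "Z \<in> sets \<mu>" using Y by (auto simp: Z_def)
  define r where "r m B = density m (indicator B :: 'a \<Rightarrow> ennreal)" for m :: "'a measure" and B
  have sr: "sets (r m B) = sets m" for m B by (simp add: r_def)
  have r: "emeasure (r m B) E = emeasure m (B \<inter> E)" if "B \<in> sets m" "E \<in> sets m" for m B E
    unfolding r_def using that by (subst emeasure_restricted) auto
  have fr: "finite_measure (r m B)" if "B \<in> sets m" "finite_measure m" for m B
    using r[OF that(1) sets.top] finite_measure.emeasure_finite[OF that(2)]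
    by (intro finite_measureI) (simp add: r_def)
  define P where "P = diff_measure (r \<mu> Y) (r \<nu> Y)"
  define Q where "Q = diff_measure (r \<nu> Z) (r \<mu> Z)"
  have Y': "Y \<in> sets \<nu>" and Z': "Z \<in> sets \<nu>" using Y Z sets by simp_all
  have sPQ: "sets P = sets \<mu>" "sets Q = sets \<mu>"
    by (simp_all add: P_def Q_def sr sets)
  have P: "emeasure P E = emeasure \<mu> (Y \<inter> E) - emeasure \<nu> (Y \<inter> E)" if E: "E \<in> sets \<mu>" for E
  proof -
    have "emeasure P E = emeasure (r \<mu> Y) E - emeasure (r \<nu> Y) E"
      unfolding P_def
    proof (rule emeasure_diff_measure)
      show "emeasure (r \<nu> Y) B \<le> emeasure (r \<mu> Y) B" if "B \<in> sets (r \<mu> Y)" for B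
        using that pos[of "Y \<inter> B"] Y Y' sets by (simp add: sr r sets.Int)
    qed (use fr[OF Y] fr[OF Y'] assms(1,2) E in \<open>simp_all add: sr sets\<close>)
    then show ?thesis using E Y Y' sets by (simp add: r)
  qed
  have Q: "emeasure Q E = emeasure \<nu> (Z \<inter> E) - emeasure \<mu> (Z \<inter> E)" if E: "E \<in> sets \<mu>" for E
  proof -
    have "emeasure Q E = emeasure (r \<nu> Z) E - emeasure (r \<mu> Z) E"
      unfolding Q_def
    proof (rule emeasure_diff_measure)
      have "Z \<inter> B \<inter> Y = {}" for B by (auto simp: Z_def)
      then show "emeasure (r \<mu> Z) B \<le> emeasure (r \<nu> Z) B" if "B \<in> sets (r \<nu> Z)" for B
        using that neg[of "Z \<inter> B"] Z Z' sets by (simp add: sr r sets.Int)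
    qed (use fr[OF Z] fr[OF Z'] assms(1,2) E in \<open>simp_all add: sr sets\<close>)
    then show ?thesis using E Z Z' sets by (simp add: r)
  qed
  have mP: "measure P E = measure \<mu> (Y \<inter> E) - measure \<nu> (Y \<inter> E)" if "E \<in> sets \<mu>" for E
  proof -
    have "emeasure P E = ennreal (measure \<mu> (Y \<inter> E) - measure \<nu> (Y \<inter> E))"
      using P[OF that] by (simp add: M.emeasure_eq_measure N.emeasure_eq_measure ennreal_minus)
    moreover have "measure \<nu> (Y \<inter> E) \<le> measure \<mu> (Y \<inter> E)"
      using pos[of "Y \<inter> E"] that Y by (simp add: M.emeasure_eq_measure N.emeasure_eq_measure sets.Int)
    ultimately show ?thesis by (intro measure_eq_emeasure_eq_ennreal) auto
  qed
  have mQ: "measure Q E = measure \<nu> (Z \<inter> E) - measure \<mu> (Z \<inter> E)" if "E \<in> sets \<mu>" for E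
  proof -
    have "emeasure Q E = ennreal (measure \<nu> (Z \<inter> E) - measure \<mu> (Z \<inter> E))"
      using Q[OF that] by (simp add: M.emeasure_eq_measure N.emeasure_eq_measure ennreal_minus)
    moreover have "Z \<inter> E \<inter> Y = {}" by (auto simp: Z_def)
    then have "measure \<mu> (Z \<inter> E) \<le> measure \<nu> (Z \<inter> E)"
      using neg[of "Z \<inter> E"] that Z by (simp add: M.emeasure_eq_measure N.emeasure_eq_measure sets.Int)
    ultimately show ?thesis by (intro measure_eq_emeasure_eq_ennreal) auto
  qed
  have split: "measure m E = measure m (Y \<inter> E) + measure m (Z \<inter> E)"
    if "E \<in> sets \<mu>" "finite_measure m" "sets m = sets \<mu>" for m E
  proof -
    have "E = (Y \<inter> E) \<union> (Z \<inter> E)" using sets.sets_into_space[OF that(1)] by (auto simp: Z_def)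
    moreover have "measure m ((Y \<inter> E) \<union> (Z \<inter> E)) = measure m (Y \<inter> E) + measure m (Z \<inter> E)"
      using that Y Z by (intro finite_measure.finite_measure_Union) (auto simp: Z_def)
    ultimately show ?thesis by simp
  qed
  have YZ: "Y \<inter> Z = {}" "Z \<inter> Y = {}" by (auto simp: Z_def)
  have spPQ: "space P = space \<mu>" "space Q = space \<mu>" using sPQ by (auto dest: sets_eq_imp_space_eq)
  have "jordan_decomposition \<mu> (\<lambda>E. measure \<mu> E - measure \<nu> E) P Q"
    unfolding jordan_decomposition_def
  proof (intro conjI ballI bexI[of _ Y])
    show "finite_measure P"
      by (intro finite_measureI) (simp add: spPQ P)
    show "finite_measure Q"
      by (intro finite_measureI) (simp add: spPQ Q)
    show "measure \<mu> E - measure \<nu> E = measure P E - measure Q E" if "E \<in> sets \<mu>" for E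
      using split[OF that assms(1) refl] split[OF that assms(2) sets] by (simp add: mP mQ that)
    show "measure P (space \<mu> - Y) = 0" "measure Q Y = 0"
      using Y Z YZ by (simp_all add: mP mQ Z_def[symmetric])
  qed (use sPQ Y in auto)
  then show ?thesis by blast
qed

section \<open>The hidden Markov model\<close>

definition input_laws :: "real \<Rightarrow> real \<Rightarrow> real measure set" where
  "input_laws A Pavg =
     {F \<in> space (prob_algebra (restrict_space borel {0..A})). (\<integral>x. x \<partial>F) \<le> Pavg}"

text \<open>
  A hidden state \<open>q\<close> is stored with reversed index: \<open>q l\<close> is the coordinate \<open>q\<^sub>-\<^sub>l\<close>, that is,
  the symbol that entered \<open>l\<close> steps ago (\<open>0 \<le> l \<le> L\<close>).
\<close>

definition state_space :: "real \<Rightarrow> nat \<Rightarrow> (nat \<Rightarrow> real) measure" where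
  "state_space A L = (\<Pi>\<^sub>M l\<in>{..L}. restrict_space borel {0..A})"

definition state_laws :: "real \<Rightarrow> nat \<Rightarrow> (nat \<Rightarrow> real) measure set" where
  "state_laws A L = space (prob_algebra (state_space A L))"

definition rate :: "real \<Rightarrow> (nat \<Rightarrow> real) \<Rightarrow> nat \<Rightarrow> (nat \<Rightarrow> real) \<Rightarrow> real" where
  "rate lam0 h L q = lam0 + (\<Sum>l\<le>L. h l * q l)"

definition push :: "nat \<Rightarrow> real \<Rightarrow> (nat \<Rightarrow> real) \<Rightarrow> nat \<Rightarrow> real" where
  "push L v q = (\<lambda>l\<in>{..L}. case l of 0 \<Rightarrow> v | Suc k \<Rightarrow> q k)"

text \<open>A hidden path is a pair \<open>(q\<^sub>0, x)\<close> of an initial state and the inputs \<open>x t\<close>, \<open>t \<ge> 1\<close>.\<close>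

definition hidden_law ::
    "real measure \<Rightarrow> (nat \<Rightarrow> real) measure \<Rightarrow> ((nat \<Rightarrow> real) \<times> (nat \<Rightarrow> real)) measure" where
  "hidden_law F \<mu> = \<mu> \<Otimes>\<^sub>M (\<Pi>\<^sub>M t\<in>{1..}. F)"

fun state :: "nat \<Rightarrow> (nat \<Rightarrow> real) \<times> (nat \<Rightarrow> real) \<Rightarrow> nat \<Rightarrow> nat \<Rightarrow> real" where
  "state L (q0, x) 0 = q0"
| "state L (q0, x) (Suc t) = push L (x (Suc t)) (state L (q0, x) t)"

text \<open>
  Joint law of \<open>\<omega> \<sim> M\<close> and observations \<open>(y t)\<close>, \<open>t \<in> T\<close>, which given \<open>\<omega>\<close> are independent
  Poisson variables with parameters \<open>r \<omega> t\<close>.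
\<close>

definition poisson_observed ::
    "'i set \<Rightarrow> 'a measure \<Rightarrow> ('a \<Rightarrow> 'i \<Rightarrow> real) \<Rightarrow> ('a \<times> ('i \<Rightarrow> nat)) measure" where
  "poisson_observed T M r =
     M \<bind> (\<lambda>\<omega>. distr (\<Pi>\<^sub>M t\<in>T. measure_pmf (poisson_pmf (r \<omega> t)))
                 (M \<Otimes>\<^sub>M (\<Pi>\<^sub>M t\<in>T. count_space UNIV)) (Pair \<omega>))"

definition hmm_law ::
    "real \<Rightarrow> (nat \<Rightarrow> real) \<Rightarrow> nat \<Rightarrow> real measure \<Rightarrow> (nat \<Rightarrow> real) measure
      \<Rightarrow> (((nat \<Rightarrow> real) \<times> (nat \<Rightarrow> real)) \<times> (nat \<Rightarrow> nat)) measure" where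
  "hmm_law lam0 h L F \<mu> =
     poisson_observed {1..} (hidden_law F \<mu>) (\<lambda>\<omega> t. rate lam0 h L (state L \<omega> t))"

section \<open>Predictive filters\<close>

definition path_likelihood ::
    "real \<Rightarrow> (nat \<Rightarrow> real) \<Rightarrow> nat \<Rightarrow> nat \<Rightarrow> (nat \<Rightarrow> nat) \<Rightarrow> (nat \<Rightarrow> real) \<times> (nat \<Rightarrow> real) \<Rightarrow> real" where
  "path_likelihood lam0 h L t y \<omega> =
     (\<Prod>s\<in>{1..<t}. pmf (poisson_pmf (rate lam0 h L (state L \<omega> s))) (y s))"

text \<open>
  Bayes' formula for the law of the state at time \<open>t\<close> given the values \<open>y 1, \<dots>, y (t - 1)\<close>:
  reweight the law of the hidden path by the normalised likelihood and project.
\<close>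

definition pred_filter ::
    "real \<Rightarrow> (nat \<Rightarrow> real) \<Rightarrow> nat \<Rightarrow> real measure \<Rightarrow> (nat \<Rightarrow> real) measure
      \<Rightarrow> nat \<Rightarrow> (nat \<Rightarrow> nat) \<Rightarrow> (nat \<Rightarrow> real) measure" where
  "pred_filter lam0 h L F \<mu> t y =
     (let P = hidden_law F \<mu>; w = path_likelihood lam0 h L t y
      in distr (density P (\<lambda>\<omega>. ennreal (w \<omega> / (\<integral>\<omega>'. w \<omega>' \<partial>P)))) \<mu> (\<lambda>\<omega>. state L \<omega> t))"

definition predictive_pmf :: "real \<Rightarrow> (nat \<Rightarrow> real) \<Rightarrow> nat \<Rightarrow> (nat \<Rightarrow> real) measure \<Rightarrow> nat \<Rightarrow> real" where
  "predictive_pmf lam0 h L \<pi> y =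
     (\<integral>q. exp (- rate lam0 h L q) * (rate lam0 h L q ^ y / fact y) \<partial>\<pi>)"

section \<open>The stationary two-sided process\<close>

definition stationary_law ::
    "real \<Rightarrow> (nat \<Rightarrow> real) \<Rightarrow> nat \<Rightarrow> real measure \<Rightarrow> ((int \<Rightarrow> real) \<times> (int \<Rightarrow> nat)) measure" where
  "stationary_law lam0 h L F =
     poisson_observed UNIV (\<Pi>\<^sub>M k\<in>UNIV. F) (\<lambda>x k. rate lam0 h L (\<lambda>l. x (k - int l)))"

text \<open>
  \<open>P\<^sub>F (Y\<^sub>0 | Y\<^sub>j, j \<in> J)\<close> as a random variable: a version of the conditional probability mass
  function of \<open>Y\<^sub>0\<close> given the sigma-algebra generated by \<open>Y\<^sub>j\<close>, \<open>j \<in> J\<close>, evaluated at \<open>Y\<^sub>0\<close>.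
\<close>

definition cond_pmf_obs ::
    "real \<Rightarrow> (nat \<Rightarrow> real) \<Rightarrow> nat \<Rightarrow> real measure \<Rightarrow> int set
      \<Rightarrow> (int \<Rightarrow> real) \<times> (int \<Rightarrow> nat) \<Rightarrow> real" where
  "cond_pmf_obs lam0 h L F J \<omega> =
     (let M = stationary_law lam0 h L F;
          G = vimage_algebra (space M) (\<lambda>\<omega>'. restrict (snd \<omega>') J) (\<Pi>\<^sub>M j\<in>J. count_space UNIV)
      in real_cond_exp M G (indicator {\<omega>' \<in> space M. snd \<omega>' 0 = snd \<omega> 0}) \<omega>)"

end

(*
  Given the hidden path, the observations are independent Poisson variables whose parameters lie
  in [lam0, lam0 + A], so two states give likelihoods of an observation y that differ at most by
  the factor r(y) = exp A * ((lam0 + A) / lam0)^y. As L + 1 steps flush the shift register, a block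
  of L + 1 observations acts on the state as a kernel whose values at any two states are comparable
  up to the product of r over its first L observations. By Bayes' formula the filter integrates f
  as mu(u) / mu(w), where w q is the likelihood of the observations from q and u q its f-weighted
  version; Doeblin's argument, run backwards in time on the ratio u / w, shows that each block whose
  first L observations vanish shrinks the oscillation of u / w by a fixed factor. The first block
  bounds the influence of the initial law (and of normalisation) by a product of r, which has a
  finite mean; the remaining blocks are conditionally independent, and each of them vanishes with
  probability bounded below. This gives the geometric rate, uniformly in F.

  For the stationary process, the finite-past predictive probabilities are ratios of the same kind,
  and a longer past only changes the initial weights. Their differences are bounded pathwise by the
  contraction factor of the common recent past, whose mean is summable, so they converge almost
  surely; the limit is a version of the conditional probability given the infinite past because it
  has the right integrals over cylinders.
*)
theory Submission
  imports Defs
begin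

section \<open>Total variation\<close>

text \<open>Two obstacles shape the argument. The likelihood ratio grows geometrically in the
  observation, so no mixing constant serves all blocks: contraction is claimed on a favourable event
  only, and the price elsewhere is paid in the mean. Moreover \<open>F\<close> is arbitrary,
  possibly a point mass, and one-step transition laws from different states may be mutually
  singular. Two initial states are therefore driven by the same fresh symbols: after
  \<open>L + 1\<close> pushes they coincide, and until then only their rates differ. Averaging over
  the common symbols uses nothing of \<open>F\<close> but its support, which makes the constants
  uniform. Normalisation makes the filter recursion nonlinear, whereas numerator \<open>u\<close>
  and normaliser \<open>w\<close> evolve linearly. A sandwich
  \<open>m * w \<le> u \<le> (m + B) * w\<close> survives every positive linear operation, including
  integration against an initial law, so \<open>B\<close> is the quantity to shrink. The factor
  \<open>tv_dist \<mu> \<nu>\<close> arises because \<open>u - m * w\<close> and \<open>w\<close>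
  are then bounded functions integrated against \<open>\<mu>\<close> and
  \<open>\<nu>\<close>.\<close>

lemma jordan_nn_integral:
  assumes fin: "finite_measure \<mu>" "finite_measure \<nu>" and sets: "sets \<nu> = sets \<mu>"
    and J: "jordan_decomposition \<mu> (\<lambda>E. measure \<mu> E - measure \<nu> E) P N"
    and f: "f \<in> borel_measurable \<mu>"
  shows "(\<integral>\<^sup>+x. f x \<partial>\<mu>) + (\<integral>\<^sup>+x. f x \<partial>N) = (\<integral>\<^sup>+x. f x \<partial>\<nu>) + (\<integral>\<^sup>+x. f x \<partial>P)"
proof -
  from J have fPN: "finite_measure P" "finite_measure N" and sPN: "sets P = sets \<mu>" "sets N = sets \<mu>"
    and eta: "\<And>E. E \<in> sets \<mu> \<Longrightarrow> measure \<mu> E - measure \<nu> E = measure P E - measure N E"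
    by (auto simp: jordan_decomposition_def)
  have *: "f \<in> borel_measurable \<nu>" "f \<in> borel_measurable P" "f \<in> borel_measurable N"
    if "f \<in> borel_measurable \<mu>" for f :: "'a \<Rightarrow> ennreal"
    using that sets sPN by (simp_all cong: measurable_cong_sets)
  from f show ?thesis
  proof (induction rule: borel_measurable_induct)
    case (cong f g)
    have "space \<nu> = space \<mu>" "space P = space \<mu>" "space N = space \<mu>"
      using sets sPN by (auto dest: sets_eq_imp_space_eq)
    then have "integral\<^sup>N M f = integral\<^sup>N M g" if "M \<in> {\<mu>, \<nu>, P, N}" for M
      using cong that by (intro nn_integral_cong) auto
    with cong show ?case by simp
  next
    case (set E)
    \<comment> \<open>The negative terms are moved across, since the identity of signed measures
      cannot be stated with subtraction in \<open>ennreal\<close>.\<close>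
    have "emeasure \<mu> E + emeasure N E = emeasure \<nu> E + emeasure P E"
      using eta[OF set]
      by (simp add: fin fPN finite_measure.emeasure_eq_measure ennreal_plus[symmetric] del: ennreal_plus)
    with set sets sPN show ?case by simp
  next
    case (mult u c)
    then show ?case
      using *[OF mult(2)] by (simp add: nn_integral_cmult distrib_left[symmetric])
  next
    case (add u v)
    then show ?case
      using *[OF add(1)] *[OF add(3)] add
      by (simp add: nn_integral_add) (metis (no_types, lifting) add.assoc add.commute)
  next
    case (seq U)
    have inc: "incseq U" by fact
    have mono: "incseq (\<lambda>i. \<integral>\<^sup>+x. U i x \<partial>M)" for M :: "'a measure"
      using inc by (auto simp: incseq_def le_fun_def intro!: nn_integral_mono)
    have "(\<integral>\<^sup>+x. (SUP i. U i) x \<partial>M) = (SUP i. \<integral>\<^sup>+x. U i x \<partial>M)" if "\<And>i. U i \<in> borel_measurable M" for M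
      using nn_integral_monotone_convergence_SUP[OF inc that] by (simp add: image_comp)
    then show ?case
      using seq.IH seq(4) *[OF seq(1)] seq(1) by (simp add: ennreal_SUP_add[OF mono mono, symmetric])
  qed
qed

text \<open>The Jordan parts pull in opposite directions: for \<open>0 \<le> f \<le> c\<close> the
  difference is an integral over \<open>P\<close> minus one over \<open>N\<close>, each between 0
  and \<open>c\<close> times the mass, so no factor 2 arises.\<close>

lemma integral_diff_le_tv_dist:
  fixes f :: "'a \<Rightarrow> real"
  assumes fin: "finite_measure \<mu>" "finite_measure \<nu>" and sets: "sets \<nu> = sets \<mu>"
    and f: "f \<in> borel_measurable \<mu>" and b: "\<And>x. x \<in> space \<mu> \<Longrightarrow> 0 \<le> f x \<and> f x \<le> c"
  shows "\<bar>(\<integral>x. f x \<partial>\<mu>) - (\<integral>x. f x \<partial>\<nu>)\<bar> \<le> c * tv_dist \<mu> \<nu>"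
proof -
  obtain P N where J: "jordan_decomposition \<mu> (\<lambda>E. measure \<mu> E - measure \<nu> E) P N"
    using jordan_decomposition_exists[OF fin sets] by blast
  then have fPN: "finite_measure P" "finite_measure N" and sPN: "sets P = sets \<mu>" "sets N = sets \<mu>"
    by (auto simp: jordan_decomposition_def)
  have sp: "space \<nu> = space \<mu>" "space P = space \<mu>" "space N = space \<mu>"
    using sets sPN by (auto dest: sets_eq_imp_space_eq)
  have tv: "tv_dist \<mu> \<nu> = measure P (space \<mu>) + measure N (space \<mu>)"
    unfolding tv_dist_def using J by (rule total_variation_eqI)
  have fm: "f \<in> borel_measurable \<nu>" "f \<in> borel_measurable P" "f \<in> borel_measurable N"
    using f sets sPN by (simp_all cong: measurable_cong_sets)
  have i: "integrable M f" if "finite_measure M" "space M = space \<mu>" "f \<in> borel_measurable M" for M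
    using that b by (intro finite_measure.integrable_const_bound[of _ _ c]) (auto intro!: AE_I2)
  have e: "(\<integral>\<^sup>+x. ennreal (f x) \<partial>M) = ennreal (\<integral>x. f x \<partial>M)"
    if "finite_measure M" "space M = space \<mu>" "f \<in> borel_measurable M" for M
    using b that(2) by (intro nn_integral_eq_integral i that) (auto intro!: AE_I2)
  have n: "0 \<le> (\<integral>x. f x \<partial>M)" if "space M = space \<mu>" for M
    using that b by (intro integral_nonneg_AE) (auto intro!: AE_I2)
  have up: "(\<integral>x. f x \<partial>M) \<le> c * measure M (space \<mu>)"
    if "finite_measure M" "space M = space \<mu>" "f \<in> borel_measurable M" for M
  proof -
    have "(\<integral>x. f x \<partial>M) \<le> (\<integral>x. c \<partial>M)"
      using b that(2) by (intro integral_mono i that finite_measure.integrable_const) auto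
    then show ?thesis using that(2) by (simp add: mult.commute)
  qed
  have "ennreal ((\<integral>x. f x \<partial>\<mu>) + (\<integral>x. f x \<partial>N)) = ennreal ((\<integral>x. f x \<partial>\<nu>) + (\<integral>x. f x \<partial>P))"
    using jordan_nn_integral[OF fin sets J, of "\<lambda>x. ennreal (f x)"] f fin fPN sp fm n by (simp add: e)
  then have "(\<integral>x. f x \<partial>\<mu>) + (\<integral>x. f x \<partial>N) = (\<integral>x. f x \<partial>\<nu>) + (\<integral>x. f x \<partial>P)"
    using n sp by (subst (asm) ennreal_inj) auto
  then show ?thesis
    using up[OF fPN(1) sp(2) fm(2)] up[OF fPN(2) sp(3) fm(3)] n[OF sp(2)] n[OF sp(3)]
    by (simp add: tv algebra_simps abs_le_iff)
qed

lemma tv_dist_nonneg: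
  assumes "finite_measure \<mu>" "finite_measure \<nu>" "sets \<nu> = sets \<mu>"
  shows "0 \<le> tv_dist \<mu> \<nu>"
  using jordan_decomposition_exists[OF assms] unfolding tv_dist_def
  by (auto dest!: total_variation_eqI)

text \<open>The Hahn set \<open>D\<close> carries \<open>P\<close> and its complement carries
  \<open>N\<close>, so each of the two masses is a difference on one set and is bounded by
  \<open>K\<close>.\<close>

lemma tv_dist_le:
  assumes fin: "finite_measure \<mu>" "finite_measure \<nu>" and sets: "sets \<nu> = sets \<mu>"
    and K: "\<And>E. E \<in> sets \<mu> \<Longrightarrow> \<bar>measure \<mu> E - measure \<nu> E\<bar> \<le> K"
  shows "tv_dist \<mu> \<nu> \<le> 2 * K"
proof -
  obtain P N where J: "jordan_decomposition \<mu> (\<lambda>E. measure \<mu> E - measure \<nu> E) P N"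
    using jordan_decomposition_exists[OF fin sets] by blast
  then obtain D where fPN: "finite_measure P" "finite_measure N" and sPN: "sets P = sets \<mu>" "sets N = sets \<mu>"
    and eta: "\<And>E. E \<in> sets \<mu> \<Longrightarrow> measure \<mu> E - measure \<nu> E = measure P E - measure N E"
    and D: "D \<in> sets \<mu>" "measure P (space \<mu> - D) = 0" "measure N D = 0"
    by (auto simp: jordan_decomposition_def)
  have sp: "space \<nu> = space \<mu>" "space P = space \<mu>" "space N = space \<mu>"
    using sets sPN by (auto dest: sets_eq_imp_space_eq)
  have tv: "tv_dist \<mu> \<nu> = measure P (space \<mu>) + measure N (space \<mu>)"
    unfolding tv_dist_def using J by (rule total_variation_eqI)
  have D': "space \<mu> - D \<in> sets \<mu>" using D by auto
  have "measure P (space \<mu>) = measure P D"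
    using finite_measure.finite_measure_compl[OF fPN(1), of D] D sPN by (simp add: sp)
  moreover have "measure N (space \<mu>) = measure N (space \<mu> - D)"
    using finite_measure.finite_measure_compl[OF fPN(2), of D] D sPN by (simp add: sp)
  ultimately show ?thesis
    using K[OF D(1)] K[OF D'] eta[OF D(1)] eta[OF D'] D by (simp add: tv)
qed

text \<open>On \<open>[c, \<infinity>)\<close> the logarithm is Lipschitz with constant
  \<open>1 / c\<close>. This is used with \<open>c = lik_lower\<close>, a lower bound for every
  predictive probability.\<close>

lemma abs_ln_diff_le:
  fixes x y c d :: real
  assumes "0 < c" "c \<le> x" "c \<le> y" "\<bar>x - y\<bar> \<le> d"
  shows "\<bar>ln x - ln y\<bar> \<le> d / c"
proof -
  have *: "ln u - ln v \<le> d / c" if "c \<le> u" "c \<le> v" "u - v \<le> d" for u v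
  proof (cases "u \<le> v")
    case True
    then have "ln u - ln v \<le> 0" using that assms(1) by simp
    also have "0 \<le> d / c" using assms(1,4) by simp
    finally show ?thesis .
  next
    case False
    have "ln u - ln v = ln (u / v)" using that assms(1) by (simp add: ln_div)
    also have "\<dots> \<le> u / v - 1" using that assms(1) by (intro ln_le_minus_one) simp
    also have "\<dots> = (u - v) / v" using that assms(1) by (simp add: field_simps)
    also have "\<dots> \<le> (u - v) / c" using that assms(1) False by (intro divide_left_mono) auto
    also have "\<dots> \<le> d / c" using that assms(1) by (intro divide_right_mono) auto
    finally show ?thesis .
  qed
  show ?thesis using *[of x y] *[of y x] assms by (auto simp: abs_le_iff)
qed

section \<open>Backward likelihoods\<close>

text \<open>The exponential and the power are bounded separately. This is not sharp, but it makes
  the quotient of the upper by the lower bound a pure geometric function of the observation, whose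
  Poisson mean is explicit.\<close>

definition lik_lower :: "real \<Rightarrow> real \<Rightarrow> nat \<Rightarrow> real" where
  "lik_lower lam0 A y = exp (- (lam0 + A)) * (lam0 ^ y / fact y)"

definition lik_upper :: "real \<Rightarrow> real \<Rightarrow> nat \<Rightarrow> real" where
  "lik_upper lam0 A y = exp (- lam0) * ((lam0 + A) ^ y / fact y)"

definition lik_ratio :: "real \<Rightarrow> real \<Rightarrow> nat \<Rightarrow> real" where
  "lik_ratio lam0 A y = exp A * ((lam0 + A) / lam0) ^ y"

text \<open>\<open>F\<close> is a locale parameter, yet uniformity in \<open>F\<close> can be read
  off at the end: the exported constants take only \<open>A\<close>, \<open>lam0\<close> and
  \<open>L\<close> as parameters.\<close>

locale poisson_hmm =
  fixes A lam0 :: real and h :: "nat \<Rightarrow> real" and L :: nat and F :: "real measure"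
  assumes A_nonneg: "0 \<le> A" and lam0_pos: "0 < lam0"
    and h_nonneg: "\<And>l. l \<le> L \<Longrightarrow> 0 \<le> h l" and h_sum: "(\<Sum>l\<le>L. h l) = 1"
    and F: "F \<in> space (prob_algebra (restrict_space borel {0..A}))"
begin

abbreviation "S \<equiv> state_space A L"

definition lik :: "(nat \<Rightarrow> real) \<Rightarrow> nat \<Rightarrow> real" where
  "lik q y = exp (- rate lam0 h L q) * (rate lam0 h L q ^ y / fact y)"

text \<open>The Markov transition operator of the shift register, acting on functions.\<close>

definition step :: "((nat \<Rightarrow> real) \<Rightarrow> real) \<Rightarrow> (nat \<Rightarrow> real) \<Rightarrow> real" where
  "step f q = (\<integral>v. f (push L v q) \<partial>F)"

text \<open>
  \<open>bwd ys f q\<close> is the expectation, from the initial state \<open>q\<close>, of the likelihood of the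
  observations \<open>ys\<close> at times \<open>1, \<dots>, n\<close> times the value of \<open>f\<close> at the state at time \<open>n + 1\<close>.
\<close>

primrec bwd :: "nat list \<Rightarrow> ((nat \<Rightarrow> real) \<Rightarrow> real) \<Rightarrow> (nat \<Rightarrow> real) \<Rightarrow> real" where
  "bwd [] f = step f"
| "bwd (y # ys) f = step (\<lambda>q. lik q y * bwd ys f q)"

text \<open>A class closed under products, under \<open>step\<close>, and under differences
  \<open>f - c * g\<close> that stay nonnegative; membership settles integrability against every
  probability law on the states.\<close>

definition test_fun :: "((nat \<Rightarrow> real) \<Rightarrow> real) \<Rightarrow> bool" where
  "test_fun f \<longleftrightarrow> f \<in> borel_measurable S \<and> (\<exists>c. \<forall>q\<in>space S. 0 \<le> f q \<and> f q \<le> c)"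

lemma prob_space_F: "prob_space F" and sets_F: "sets F = sets (restrict_space borel {0..A})"
  and space_F: "space F = {0..A}"
proof -
  show "prob_space F" and s: "sets F = sets (restrict_space borel {0..A})"
    using F by (auto simp: space_prob_algebra)
  show "space F = {0..A}"
    using sets_eq_imp_space_eq[OF s] by (simp add: space_restrict_space)
qed

lemma space_S: "space S = (\<Pi>\<^sub>E l\<in>{..L}. {0..A})"
  by (simp add: state_space_def space_PiM space_restrict_space)

lemma space_S_nonempty: "space S \<noteq> {}"
  using A_nonneg by (auto simp: space_S PiE_eq_empty_iff)

lemma rate_lower: "lam0 \<le> rate lam0 h L q" and rate_upper: "rate lam0 h L q \<le> lam0 + A"
  if "q \<in> space S"
proof -
  have q: "0 \<le> q l \<and> q l \<le> A" if "l \<le> L" for l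
    using \<open>q \<in> space S\<close> that by (auto simp: space_S PiE_def Pi_def)
  show "lam0 \<le> rate lam0 h L q"
    using q h_nonneg by (auto simp: rate_def intro!: sum_nonneg)
  have "(\<Sum>l\<le>L. h l * q l) \<le> (\<Sum>l\<le>L. h l * A)"
    using q h_nonneg by (intro sum_mono mult_left_mono) auto
  also have "\<dots> = A" by (simp add: sum_distrib_right[symmetric] h_sum)
  finally show "rate lam0 h L q \<le> lam0 + A" by (simp add: rate_def)
qed

lemma lik_lower: "lik_lower lam0 A y \<le> lik q y" and lik_upper: "lik q y \<le> lik_upper lam0 A y"
  if "q \<in> space S"
  using rate_lower[OF that] rate_upper[OF that] lam0_pos
  by (auto simp: lik_def lik_lower_def lik_upper_def
      intro!: mult_mono divide_right_mono power_mono)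

lemma lik_lower_pos: "0 < lik_lower lam0 A y"
  using lam0_pos by (simp add: lik_lower_def)

lemma lik_upper_nonneg: "0 \<le> lik_upper lam0 A y"
  using lam0_pos A_nonneg by (simp add: lik_upper_def)

lemma lik_upper_eq: "lik_upper lam0 A y = lik_ratio lam0 A y * lik_lower lam0 A y"
proof -
  have "exp (- lam0) = exp A * exp (- (lam0 + A))" by (simp add: exp_add[symmetric])
  then show ?thesis using lam0_pos
    by (simp add: lik_upper_def lik_lower_def lik_ratio_def power_divide)
qed

lemma lik_ratio_ge_1: "1 \<le> lik_ratio lam0 A y"
proof -
  have "1 \<le> exp A" using A_nonneg by simp
  moreover have "1 \<le> ((lam0 + A) / lam0) ^ y" using A_nonneg lam0_pos by (intro one_le_power) simp
  ultimately have "1 * 1 \<le> exp A * ((lam0 + A) / lam0) ^ y" by (intro mult_mono) auto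
  then show ?thesis by (simp add: lik_ratio_def)
qed

lemma lik_compare:
  assumes "q \<in> space S" "q' \<in> space S" shows "lik q y \<le> lik_ratio lam0 A y * lik q' y"
proof -
  have "lik q y \<le> lik_ratio lam0 A y * lik_lower lam0 A y"
    using lik_upper[OF assms(1)] by (simp add: lik_upper_eq)
  also have "\<dots> \<le> lik_ratio lam0 A y * lik q' y"
    using lik_lower[OF assms(2)] lik_ratio_ge_1[of y] by (intro mult_left_mono) auto
  finally show ?thesis .
qed

lemma lik_pos: "q \<in> space S \<Longrightarrow> 0 < lik q y"
  using lik_lower[of q y] lik_lower_pos[of y] by linarith

lemma push_in_space: "q \<in> space S \<Longrightarrow> v \<in> {0..A} \<Longrightarrow> push L v q \<in> space S"
  by (auto simp: space_S push_def PiE_def Pi_def extensional_def split: nat.split)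

lemma measurable_rate: "rate lam0 h L \<in> borel_measurable S"
proof -
  have "(\<lambda>q. q l) \<in> borel_measurable S" if "l \<le> L" for l
    using that unfolding state_space_def
    by (intro measurable_compose[OF measurable_component_singleton[of l]])
      (auto intro: measurable_restrict_space1)
  then show ?thesis unfolding rate_def[abs_def] by measurable
qed

lemma measurable_lik: "(\<lambda>q. lik q y) \<in> borel_measurable S"
  unfolding lik_def using measurable_rate by measurable

lemma measurable_push: "(\<lambda>(q, v). push L v q) \<in> S \<Otimes>\<^sub>M F \<rightarrow>\<^sub>M S"
proof -
  have F_eq: "X \<rightarrow>\<^sub>M F = X \<rightarrow>\<^sub>M restrict_space borel {0..A}" for X :: "'z measure"
    by (rule measurable_cong_sets[OF refl sets_F])
  have "(\<lambda>z. case l of 0 \<Rightarrow> snd z | Suc k \<Rightarrow> fst z k)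
      \<in> S \<Otimes>\<^sub>M F \<rightarrow>\<^sub>M restrict_space borel {0..A}" if "l \<in> {..L}" for l
  proof (cases l)
    case 0
    then show ?thesis using measurable_snd[of S F] by (simp add: F_eq)
  next
    case (Suc k)
    then have "(\<lambda>q. q k) \<in> S \<rightarrow>\<^sub>M restrict_space borel {0..A}"
      using that unfolding state_space_def by (intro measurable_component_singleton) auto
    then show ?thesis using Suc by (auto intro: measurable_compose[OF measurable_fst])
  qed
  then have "(\<lambda>z. push L (snd z) (fst z)) \<in> S \<Otimes>\<^sub>M F \<rightarrow>\<^sub>M S"
    unfolding push_def state_space_def by (intro measurable_restrict) simp
  then show ?thesis by (simp add: case_prod_beta')
qed

section \<open>Bounded nonnegative test functions\<close>

lemma test_funD: "f \<in> borel_measurable S" "q \<in> space S \<Longrightarrow> 0 \<le> f q" if "test_fun f"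
  using that by (auto simp: test_fun_def)

lemma test_funE:
  assumes "test_fun f"
  obtains c where "0 \<le> c" "\<And>q. q \<in> space S \<Longrightarrow> 0 \<le> f q \<and> f q \<le> c"
proof -
  from assms obtain c where c: "\<forall>q\<in>space S. 0 \<le> f q \<and> f q \<le> c" by (auto simp: test_fun_def)
  with space_S_nonempty have "0 \<le> c" by fastforce
  with c that show ?thesis by blast
qed

lemma test_funI:
  assumes "f \<in> borel_measurable S" "\<And>q. q \<in> space S \<Longrightarrow> 0 \<le> f q" "\<And>q. q \<in> space S \<Longrightarrow> f q \<le> c"
  shows "test_fun f"
  using assms by (auto simp: test_fun_def)

lemma test_fun_const: "0 \<le> c \<Longrightarrow> test_fun (\<lambda>_. c)"
  by (rule test_funI[of _ c]) auto

lemma test_fun_lik: "test_fun (\<lambda>q. lik q y)"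
  using measurable_lik lik_upper lik_pos by (intro test_funI) (auto intro: less_imp_le)

lemma test_fun_mult:
  assumes "test_fun f" "test_fun g" shows "test_fun (\<lambda>q. f q * g q)"
proof -
  obtain c d where c: "0 \<le> c" "\<And>q. q \<in> space S \<Longrightarrow> 0 \<le> f q \<and> f q \<le> c"
    and d: "\<And>q. q \<in> space S \<Longrightarrow> 0 \<le> g q \<and> g q \<le> d"
    using assms by (metis test_funE)
  show ?thesis
  proof (rule test_funI)
    show "(\<lambda>q. f q * g q) \<in> borel_measurable S" using assms by (auto dest!: test_funD(1))
    show "f q * g q \<le> c * d" if "q \<in> space S" for q
      using c d that by (intro mult_mono) auto
  qed (use c d in auto)
qed

lemma test_fun_diff:
  assumes "test_fun f" "test_fun g" "\<And>q. q \<in> space S \<Longrightarrow> c * g q \<le> f q"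
    and "0 \<le> c"
  shows "test_fun (\<lambda>q. f q - c * g q)"
proof -
  obtain d where d: "\<And>q. q \<in> space S \<Longrightarrow> 0 \<le> f q \<and> f q \<le> d"
    using assms(1) by (metis test_funE)
  show ?thesis
  proof (rule test_funI)
    show "(\<lambda>q. f q - c * g q) \<in> borel_measurable S"
      using test_funD(1)[OF assms(1)] test_funD(1)[OF assms(2)] by simp
    show "f q - c * g q \<le> d" if "q \<in> space S" for q
      using d[OF that] test_funD(2)[OF assms(2) that] assms(4)
      by (simp add: diff_le_eq add_increasing2)
  qed (use assms in auto)
qed

lemma integrable_test_fun:
  assumes "test_fun f" "prob_space M" "sets M = sets S" shows "integrable M f"
proof -
  obtain c where c: "\<And>q. q \<in> space S \<Longrightarrow> 0 \<le> f q \<and> f q \<le> c" using assms(1) by (metis test_funE)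
  interpret prob_space M by fact
  show ?thesis
    using c test_funD(1)[OF assms(1)] sets_eq_imp_space_eq[OF assms(3)]
    by (intro integrable_const_bound[of _ c]) (auto simp: measurable_cong_sets[OF assms(3)])
qed

section \<open>The transition operator of the shift register\<close>

lemma measurable_test_fun_push:
  assumes "test_fun f" shows "(\<lambda>(q, v). f (push L v q)) \<in> borel_measurable (S \<Otimes>\<^sub>M F)"
  using measurable_compose[OF measurable_push test_funD(1)[OF assms]] by (simp add: case_prod_beta')

lemma integrable_step:
  assumes "test_fun f" "q \<in> space S" shows "integrable F (\<lambda>v. f (push L v q))"
proof -
  obtain c where c: "\<And>q. q \<in> space S \<Longrightarrow> 0 \<le> f q \<and> f q \<le> c" using assms(1) by (metis test_funE)
  interpret prob_space F by (rule prob_space_F)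
  have "(\<lambda>v. f (push L v q)) \<in> borel_measurable F"
    using measurable_Pair2[OF measurable_test_fun_push[OF assms(1)] assms(2)] by simp
  then show ?thesis
    using c push_in_space[OF assms(2)] by (intro integrable_const_bound[of _ c]) (auto simp: space_F)
qed

lemma step_mono:
  assumes "test_fun f" "test_fun g" "\<And>q. q \<in> space S \<Longrightarrow> f q \<le> g q" "q \<in> space S"
  shows "step f q \<le> step g q"
  unfolding step_def using assms push_in_space[OF assms(4)]
  by (intro integral_mono integrable_step) (auto simp: space_F)

lemma step_diff:
  assumes "test_fun f" "test_fun g" "q \<in> space S"
  shows "step (\<lambda>q. f q - c * g q) q = step f q - c * step g q"
  unfolding step_def using assms by (simp add: integrable_step)

lemma step_const: "step (\<lambda>_. c) q = c"
  using prob_space.prob_space[OF prob_space_F] by (simp add: step_def)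

lemma step_cmult: "step (\<lambda>q. c * f q) q = c * step f q"
  by (simp add: step_def)

lemma test_fun_step:
  assumes "test_fun f" shows "test_fun (step f)"
proof -
  interpret prob_space F by (rule prob_space_F)
  obtain c where c: "0 \<le> c" "\<And>q. q \<in> space S \<Longrightarrow> 0 \<le> f q \<and> f q \<le> c" using assms by (metis test_funE)
  show ?thesis
  proof (rule test_funI)
    show "step f \<in> borel_measurable S"
      using borel_measurable_lebesgue_integral[OF measurable_test_fun_push[OF assms]]
      by (simp add: step_def[abs_def])
    show "0 \<le> step f q" if "q \<in> space S" for q
      using step_mono[OF test_fun_const[of 0] assms _ that] c by (simp add: step_const)
    show "step f q \<le> c" if "q \<in> space S" for q
      using step_mono[OF assms test_fun_const[of c] _ that] c by (simp add: step_const)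
  qed
qed

section \<open>Algebra and positivity of the backward recursion\<close>

lemma test_fun_bwd: "test_fun f \<Longrightarrow> test_fun (bwd ys f)"
  by (induction ys) (auto intro!: test_fun_step test_fun_mult[OF test_fun_lik])

text \<open>A splitting needs a middle observation \<open>z\<close>: even \<open>bwd []\<close>
  takes one step, so \<open>bwd ys\<close> leads to the state at the time of \<open>z\<close>, whose
  likelihood has to be inserted there.\<close>

lemma bwd_append:
  "bwd (ys @ z # zs) f = bwd ys (\<lambda>q. lik q z * bwd zs f q)"
  by (induction ys) simp_all

lemma bwd_snoc: "bwd (ys @ [z]) f = bwd ys (\<lambda>q. lik q z * step f q)"
  by (simp add: bwd_append)

lemma step_cong:
  assumes "\<And>q. q \<in> space S \<Longrightarrow> f q = g q" "q \<in> space S"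
  shows "step f q = step g q"
  unfolding step_def using assms push_in_space[OF assms(2)]
  by (intro Bochner_Integration.integral_cong) (auto simp: space_F)

lemma bwd_mono:
  assumes "test_fun f" "test_fun g" "\<And>q. q \<in> space S \<Longrightarrow> f q \<le> g q" "q \<in> space S"
  shows "bwd ys f q \<le> bwd ys g q"
  using assms(4)
proof (induction ys arbitrary: q)
  case Nil
  then show ?case using assms by (simp add: step_mono)
next
  case (Cons y ys)
  then show ?case
    using lik_pos assms(1,2)
    by (auto intro!: step_mono mult_left_mono test_fun_mult test_fun_lik test_fun_bwd intro: less_imp_le)
qed

lemma bwd_diff:
  assumes "test_fun f" "test_fun g" "q \<in> space S"
  shows "bwd ys (\<lambda>q. f q - c * g q) q = bwd ys f q - c * bwd ys g q"
  using assms(3)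
proof (induction ys arbitrary: q)
  case Nil
  then show ?case using assms by (simp add: step_diff)
next
  case (Cons y ys)
  have "bwd (y # ys) (\<lambda>q. f q - c * g q) q
      = step (\<lambda>q. lik q y * bwd ys f q - c * (lik q y * bwd ys g q)) q"
    using Cons by (auto intro!: step_cong simp: right_diff_distrib)
  also have "\<dots> = bwd (y # ys) f q - c * bwd (y # ys) g q"
    using Cons(2) assms(1,2)
    by (subst step_diff) (auto intro!: test_fun_mult test_fun_lik test_fun_bwd)
  finally show ?case .
qed

lemma bwd_cmult: "bwd ys (\<lambda>q. c * f q) q = c * bwd ys f q"
proof (induction ys arbitrary: q)
  case (Cons y ys)
  have "bwd (y # ys) (\<lambda>q. c * f q) q = step (\<lambda>q. c * (lik q y * bwd ys f q)) q"
    using Cons by (simp add: mult.left_commute)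
  then show ?case by (simp add: step_cmult)
qed (simp add: step_cmult)

text \<open>Uniformity in the state makes the integral against any initial law positive, so the
  normaliser in Bayes' formula never vanishes.\<close>

lemma bwd_one_lower:
  "\<exists>c>0. \<forall>q\<in>space S. c \<le> bwd ys (\<lambda>_. 1) q"
proof (induction ys)
  case Nil
  then show ?case by (auto simp: step_const intro!: exI[of _ 1])
next
  case (Cons y ys)
  then obtain c where c: "0 < c" "\<And>q. q \<in> space S \<Longrightarrow> c \<le> bwd ys (\<lambda>_. 1) q" by auto
  let ?d = "lik_lower lam0 A y * c"
  have "?d \<le> bwd (y # ys) (\<lambda>_. 1) q" if "q \<in> space S" for q
  proof -
    have "step (\<lambda>_. ?d) q \<le> step (\<lambda>q. lik q y * bwd ys (\<lambda>_. 1) q) q"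
      using c lik_lower lik_lower_pos[of y] that
      by (intro step_mono test_fun_const test_fun_mult test_fun_lik test_fun_bwd mult_mono)
        (auto intro: less_imp_le less_imp_le[OF lik_pos])
    then show ?thesis by (simp add: step_const)
  qed
  then show ?case using c lik_lower_pos[of y] by (intro exI[of _ ?d]) auto
qed

lemma bwd_one_pos: "q \<in> space S \<Longrightarrow> 0 < bwd ys (\<lambda>_. 1) q"
  using bwd_one_lower[of ys] by fastforce

section \<open>Dependence on the initial state\<close>

text \<open>Every \<open>bwd\<close> begins with a push, which discards coordinate \<open>L\<close>;
  hence agreement of the \<open>L\<close> newest symbols already suffices.\<close>

lemma bwd_eq:
  assumes "L \<le> k" and "\<And>l. l < k \<Longrightarrow> q l = q' l"
  shows "bwd ys f q = bwd ys f q'"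
proof -
  have "push L v q = push L v q'" for v
    using assms by (auto simp: push_def fun_eq_iff split: nat.split)
  then have "step g q = step g q'" for g by (simp add: step_def)
  then show ?thesis by (cases ys) simp_all
qed

text \<open>
  Two states sharing their \<open>k\<close> most recent symbols have the same rates from \<open>L - k\<close> pushes on,
  so only the first \<open>L - k\<close> likelihood factors differ.
\<close>

lemma bwd_compare:
  assumes f: "test_fun f" and q: "q \<in> space S" "q' \<in> space S"
    and agree: "\<And>l. l < k \<Longrightarrow> q l = q' l"
    and fin: "L \<le> k + length ys \<or> (\<forall>q\<in>space S. \<forall>q'\<in>space S. f q = f q')"
  shows "bwd ys f q \<le> prod_list (map (lik_ratio lam0 A) (take (L - k) ys)) * bwd ys f q'"
proof (cases "L \<le> k")
  case True
  with bwd_eq[OF True agree] show ?thesis by simp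
next
  case False
  then show ?thesis using q agree fin
  proof (induction ys arbitrary: k q q')
    case Nil
    \<comment> \<open>Without observations and with \<open>k < L\<close> only the second alternative
      of the last hypothesis remains, so \<open>f\<close> is constant on the states.\<close>
    obtain c where "\<And>q. q \<in> space S \<Longrightarrow> f q = c"
      using Nil by (metis add.right_neutral list.size(3))
    then have "step f q = step (\<lambda>_. c) q" "step f q' = step (\<lambda>_. c) q'"
      using Nil(2,3) by (auto intro!: step_cong)
    then show ?case by (simp add: step_const)
  next
    case (Cons y ys)
    let ?r = "prod_list (map (lik_ratio lam0 A) (take (L - Suc k) ys))"
    let ?g = "\<lambda>q. lik q y * bwd ys f q"
    have g: "test_fun ?g" by (intro test_fun_mult test_fun_lik test_fun_bwd f)
    have r: "0 \<le> ?r" by (intro prod_list_nonneg) (auto intro: order_trans[OF _ lik_ratio_ge_1])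
    have "?g (push L v q) \<le> lik_ratio lam0 A y * ?r * ?g (push L v q')" if v: "v \<in> {0..A}" for v
    proof -
      have p: "push L v q \<in> space S" "push L v q' \<in> space S"
        using v Cons.prems push_in_space by auto
      \<comment> \<open>The two states receive the same fresh symbol, which extends their agreement
        by one coordinate.\<close>
      have ag: "push L v q l = push L v q' l" if "l < Suc k" for l
        using that Cons.prems(4) by (auto simp: push_def split: nat.split)
      have "bwd ys f (push L v q) \<le> ?r * bwd ys f (push L v q')"
      proof (cases "L \<le> Suc k")
        case True
        with bwd_eq[OF True ag] show ?thesis by simp
      next
        case False
        then show ?thesis
          using Cons.prems(5) p ag by (intro Cons.IH) auto
      qed
      then have "lik (push L v q) y * bwd ys f (push L v q)
          \<le> (lik_ratio lam0 A y * lik (push L v q') y) * (?r * bwd ys f (push L v q'))"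
        using lik_compare[OF p] lik_pos[OF p(1), of y] lik_pos[OF p(2), of y] lik_ratio_ge_1[of y]
          test_funD(2)[OF test_fun_bwd[OF f] p(1)]
        by (intro mult_mono) auto
      then show ?thesis by (simp add: mult_ac)
    qed
    then have "step ?g q \<le> (\<integral>v. lik_ratio lam0 A y * ?r * ?g (push L v q') \<partial>F)"
      unfolding step_def using g Cons.prems
      by (intro integral_mono integrable_step integrable_mult_right) (auto simp: space_F)
    also have "\<dots> = lik_ratio lam0 A y * ?r * step ?g q'" by (simp add: step_def)
    finally have "step ?g q \<le> lik_ratio lam0 A y * ?r * step ?g q'" .
    moreover have "L - k = Suc (L - Suc k)" using Cons.prems(1) by simp
    ultimately show ?case by simp
  qed
qed

section \<open>Contraction of the oscillation\<close>

text \<open>Over a block of zeros the numerator and the normaliser can each change by the factor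
  \<open>exp (A * L)\<close> between two states, whence the exponent. The half keeps
  \<open>decay\<close> positive when \<open>L = 0\<close>; otherwise the rate would be 0
  there.\<close>

definition doeblin :: real where
  "doeblin = exp (- 2 * A * L) / 2"

text \<open>
  Only blocks whose first \<open>L\<close> observations vanish are credited with a contraction: this already
  happens with probability bounded away from \<open>0\<close>, whatever the hidden states.
\<close>

definition block_factor :: "(nat \<Rightarrow> nat) \<Rightarrow> real" where
  "block_factor y = (if \<forall>i<L. y i = 0 then 1 - doeblin else 1)"

lemma doeblin_pos: "0 < doeblin" and doeblin_less: "doeblin < 1"
proof -
  show "0 < doeblin" by (simp add: doeblin_def)
  have "exp (- 2 * A * L) \<le> 1" using A_nonneg by simp
  then show "doeblin < 1" unfolding doeblin_def by linarith
qed

lemma block_factor_nonneg: "0 \<le> block_factor y" and block_factor_le_1: "block_factor y \<le> 1"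
  using doeblin_pos doeblin_less by (auto simp: block_factor_def)

text \<open>Blocks are counted from the oldest observation, the end from which \<open>bwd\<close>
  unfolds. They have length \<open>L + 1\<close> although only \<open>L\<close> values are
  inspected: the last observation of a block meets a state already flushed of the initial
  symbols.\<close>

definition contraction :: "nat \<Rightarrow> (nat \<Rightarrow> nat) \<Rightarrow> real" where
  "contraction j y = (\<Prod>b<j. block_factor (\<lambda>i. y (b * (L + 1) + i)))"

lemma contraction_nonneg: "0 \<le> contraction j y"
  using block_factor_nonneg by (auto simp: contraction_def intro: prod_nonneg)

lemma contraction_Suc:
  "contraction (Suc j) y = block_factor y * contraction j (\<lambda>i. y (L + 1 + i))"
  unfolding contraction_def by (subst prod.lessThan_Suc_shift) (simp add: ac_simps)

text \<open>
  Bayes' formula turns \<open>f\<close> into the ratio \<open>bwd ys f q / bwd ys 1 q\<close>; a first block of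
  observations followed by \<open>zs\<close> makes it a weighted average of the ratios for \<open>zs\<close>, with
  comparable weights for any two initial states if the first \<open>L\<close> observations vanish.
\<close>

lemma oscillation_step:
  assumes f: "test_fun f" and B: "0 \<le> B" and len: "length ys = L"
    and m: "0 \<le> m" "\<And>q. q \<in> space S \<Longrightarrow> m * bwd zs (\<lambda>_. 1) q \<le> bwd zs f q"
      "\<And>q. q \<in> space S \<Longrightarrow> bwd zs f q \<le> (m + B) * bwd zs (\<lambda>_. 1) q"
  shows "\<exists>m\<ge>0. \<forall>q\<in>space S. m * bwd (ys @ z # zs) (\<lambda>_. 1) q \<le> bwd (ys @ z # zs) f q \<and>
    bwd (ys @ z # zs) f q \<le> (m + block_factor ((!) ys) * B) * bwd (ys @ z # zs) (\<lambda>_. 1) q"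
proof -
  define w where "w = bwd (ys @ z # zs) (\<lambda>_. 1)"
  define u where "u = bwd (ys @ z # zs) f"
  define G where "G = block_factor ((!) ys) * B"
  have one: "test_fun (\<lambda>_. 1)" by (rule test_fun_const) simp
  note tf = test_fun_mult[OF test_fun_lik test_fun_bwd]
  have wpos: "0 < w q" if "q \<in> space S" for q using that bwd_one_pos by (simp add: w_def)
  \<comment> \<open>Subtracting \<open>m * w\<close> leaves a nonnegative function of size at most
    \<open>B * w\<close>, again of the form \<open>bwd ys\<close>; the comparison of states is
    applied to this oscillating part only.\<close>
  have v_eq: "u q - m * w q = bwd ys (\<lambda>q. lik q z * bwd zs f q - m * (lik q z * bwd zs (\<lambda>_. 1) q)) q"
    if "q \<in> space S" for q
    using that by (subst bwd_diff) (auto simp: u_def w_def bwd_append intro!: tf f one)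
  let ?v = "\<lambda>q. lik q z * bwd zs f q - m * (lik q z * bwd zs (\<lambda>_. 1) q)"
  have vt: "test_fun ?v"
    using m(1,2) lik_pos by (intro test_fun_diff tf f one) (auto simp: mult.left_commute less_imp_le)
  have v0: "0 \<le> u q - m * w q" if "q \<in> space S" for q
    unfolding v_eq[OF that] by (rule test_funD(2)[OF test_fun_bwd[OF vt] that])
  have vB: "u q - m * w q \<le> B * w q" if "q \<in> space S" for q
  proof -
    have "bwd ys ?v q \<le> bwd ys (\<lambda>q. B * (lik q z * bwd zs (\<lambda>_. 1) q)) q"
    proof (rule bwd_mono[OF vt _ _ that])
      show "test_fun (\<lambda>q. B * (lik q z * bwd zs (\<lambda>_. 1) q))"
        by (intro test_fun_mult test_fun_const test_fun_lik test_fun_bwd B) auto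
      show "?v q \<le> B * (lik q z * bwd zs (\<lambda>_. 1) q)" if "q \<in> space S" for q
      proof -
        have "lik q z * (bwd zs f q - m * bwd zs (\<lambda>_. 1) q) \<le> lik q z * (B * bwd zs (\<lambda>_. 1) q)"
          using m(3)[OF that] lik_pos[OF that, of z]
          by (intro mult_left_mono) (auto simp: distrib_right)
        then show ?thesis by (simp add: algebra_simps)
      qed
    qed
    then show ?thesis using v_eq[OF that] by (simp add: bwd_cmult bwd_append w_def)
  qed
  let ?\<phi> = "\<lambda>q. u q / w q"
  have osc: "?\<phi> q - ?\<phi> q' \<le> G" if q: "q \<in> space S" "q' \<in> space S" for q q'
  proof -
    define a where "a = (u q - m * w q) / w q"
    define b where "b = (u q' - m * w q') / w q'"
    have ab: "?\<phi> q - ?\<phi> q' = a - b"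
      using wpos[OF q(1)] wpos[OF q(2)] by (simp add: a_def b_def field_simps)
    have a: "0 \<le> a" "a \<le> B" and b: "0 \<le> b"
      using v0[OF q(1)] v0[OF q(2)] vB[OF q(1)] wpos[OF q(1)] wpos[OF q(2)]
      by (auto simp: a_def b_def divide_le_eq)
    show ?thesis
    proof (cases "\<forall>i<L. ys ! i = 0")
      case True
      then have "ys = replicate L 0" using len by (auto intro: nth_equalityI)
      \<comment> \<open>At the observation 0 the power in \<open>lik_ratio\<close> is 1, so each of
        the \<open>L\<close> factors is \<open>exp A\<close>.\<close>
      then have r: "prod_list (map (lik_ratio lam0 A) ys) = exp (A * L)"
        by (simp add: lik_ratio_def exp_of_nat2_mult prod_list_replicate)
      have c1: "u q - m * w q \<le> exp (A * L) * (u q' - m * w q')"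
        using bwd_compare[OF vt q, of 0 ys] len by (simp add: v_eq q r)
      have c2: "w q' \<le> exp (A * L) * w q"
        using bwd_compare[OF tf[OF one] q(2,1), of 0 ys] len
        by (simp add: w_def bwd_append r)
      \<comment> \<open>The comparisons of numerator and normaliser run in opposite directions and
        are multiplied: \<open>a \<le> exp (2 * A * L) * b\<close>, that is,
        \<open>2 * doeblin * a \<le> b\<close>.\<close>
      have "a * w q * w q' \<le> (exp (A * L) * (b * w q')) * (exp (A * L) * w q)"
      proof (rule mult_mono)
        show "a * w q \<le> exp (A * L) * (b * w q')"
          using c1 wpos[OF q(1)] wpos[OF q(2)] by (simp add: a_def b_def)
      qed (use c2 b wpos[OF q(1)] wpos[OF q(2)] in auto)
      then have "a * (w q * w q') \<le> ((exp (A * L))\<^sup>2 * b) * (w q * w q')"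
        by (simp add: algebra_simps power2_eq_square)
      then have "a \<le> (exp (A * L))\<^sup>2 * b"
        using wpos[OF q(1)] wpos[OF q(2)] by simp
      moreover have "(exp (A * L))\<^sup>2 * (2 * doeblin) = 1"
        by (simp add: doeblin_def exp_double[symmetric] exp_add[symmetric] algebra_simps)
      ultimately have "(exp (A * L))\<^sup>2 * (2 * doeblin * a) \<le> (exp (A * L))\<^sup>2 * b"
        by (metis (no_types, lifting) mult.assoc mult_1)
      then have "2 * doeblin * a \<le> b" by simp
      moreover have "doeblin * a \<le> 2 * doeblin * a" using doeblin_pos a by simp
      ultimately have "a - b \<le> (1 - doeblin) * a" by (simp add: algebra_simps)
      also have "\<dots> \<le> (1 - doeblin) * B" using a doeblin_less by (intro mult_left_mono) auto
      finally show ?thesis using True ab by (simp add: G_def block_factor_def)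
    next
      case False
      then have "block_factor ((!) ys) = 1" unfolding block_factor_def by (rule if_not_P)
      then show ?thesis using ab a b by (simp add: G_def)
    qed
  qed
  \<comment> \<open>The given \<open>m\<close> need not be the best lower bound after the block; the
    infimum of the new ratio is, and the oscillation bound then controls the ratio from
    above.\<close>
  define n where "n = (INF q\<in>space S. ?\<phi> q)"
  have \<phi>0: "0 \<le> ?\<phi> q" if "q \<in> space S" for q
    using test_funD(2)[OF test_fun_bwd[OF f] that] wpos[OF that] by (simp add: u_def)
  have bdd: "bdd_below (?\<phi> ` space S)" using \<phi>0 by (intro bdd_belowI[of _ 0]) auto
  have n0: "0 \<le> n" unfolding n_def using \<phi>0 space_S_nonempty by (intro cINF_greatest)
  have nl: "n \<le> ?\<phi> q" if "q \<in> space S" for q unfolding n_def using bdd that by (rule cINF_lower)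
  have nu: "?\<phi> q \<le> n + G" if "q \<in> space S" for q
  proof -
    have "?\<phi> q - G \<le> n"
      unfolding n_def using osc[OF that] space_S_nonempty by (intro cINF_greatest) (auto simp: algebra_simps)
    then show ?thesis by simp
  qed
  have "n * w q \<le> u q \<and> u q \<le> (n + G) * w q" if "q \<in> space S" for q
    using nl[OF that] nu[OF that] wpos[OF that] by (simp add: field_simps)
  with n0 show ?thesis unfolding w_def u_def G_def by blast
qed

text \<open>The ratio starts in \<open>[0, s]\<close>, and each block prepended on the side of the
  past narrows its range. Observations after the last complete block are the newest ones; the base
  case absorbs them by monotonicity.\<close>

lemma oscillation:
  assumes f: "test_fun f" "\<And>q. q \<in> space S \<Longrightarrow> f q \<le> s" and s: "0 \<le> s"
    and j: "j * (L + 1) \<le> length ys"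
  shows "\<exists>m\<ge>0. \<forall>q\<in>space S. m * bwd ys (\<lambda>_. 1) q \<le> bwd ys f q \<and>
    bwd ys f q \<le> (m + contraction j ((!) ys) * s) * bwd ys (\<lambda>_. 1) q"
  using j
proof (induction j arbitrary: ys)
  case 0
  have "bwd ys f q \<le> s * bwd ys (\<lambda>_. 1) q" if "q \<in> space S" for q
    using bwd_mono[OF f(1) test_fun_const[OF s] f(2) that, of ys] bwd_cmult[of ys s "\<lambda>_. 1" q] by simp
  then show ?case
    using test_funD(2)[OF test_fun_bwd[OF f(1)]] by (intro exI[of _ 0]) (auto simp: contraction_def)
next
  case (Suc j)
  define as where "as = take L ys"
  define zs where "zs = drop (Suc L) ys"
  \<comment> \<open>The block consists of \<open>as\<close> and of \<open>ys ! L\<close>, which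
    becomes the middle observation of \<open>oscillation_step\<close>.\<close>
  have ys: "ys = as @ ys ! L # zs"
    using Suc.prems by (simp add: as_def zs_def id_take_nth_drop)
  have las: "length as = L" using Suc.prems by (simp add: as_def)
  let ?B = "contraction j ((!) zs) * s"
  have "\<exists>m\<ge>0. \<forall>q\<in>space S. m * bwd zs (\<lambda>_. 1) q \<le> bwd zs f q \<and> bwd zs f q \<le> (m + ?B) * bwd zs (\<lambda>_. 1) q"
    using Suc.prems by (intro Suc.IH) (simp add: zs_def)
  then obtain m where m: "0 \<le> m" "\<And>q. q \<in> space S \<Longrightarrow> m * bwd zs (\<lambda>_. 1) q \<le> bwd zs f q"
      "\<And>q. q \<in> space S \<Longrightarrow> bwd zs f q \<le> (m + ?B) * bwd zs (\<lambda>_. 1) q" by auto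
  have B: "0 \<le> ?B" using s contraction_nonneg by (intro mult_nonneg_nonneg)
  have "block_factor ((!) as) = block_factor ((!) ys)"
    by (auto simp: block_factor_def as_def)
  moreover have "(\<lambda>i. ys ! (L + 1 + i)) = (!) zs"
    using Suc.prems by (auto simp: zs_def nth_drop)
  ultimately have "block_factor ((!) as) * ?B = contraction (Suc j) ((!) ys) * s"
    by (simp only: contraction_Suc mult.assoc)
  then show ?case
    using oscillation_step[OF f(1) B las m, of "ys ! L"] ys[symmetric] by (simp only:)
qed

section \<open>Bayes ratios of integrated likelihoods\<close>

lemma integral_bwd_bounds:
  assumes f: "test_fun f"
    and M: "prob_space M" "sets M = sets S"
    and le: "\<And>q. q \<in> space S \<Longrightarrow> a * bwd ys (\<lambda>_. 1) q \<le> bwd ys f q"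
      "\<And>q. q \<in> space S \<Longrightarrow> bwd ys f q \<le> b * bwd ys (\<lambda>_. 1) q"
  shows "a * (\<integral>q. bwd ys (\<lambda>_. 1) q \<partial>M) \<le> (\<integral>q. bwd ys f q \<partial>M)"
    "(\<integral>q. bwd ys f q \<partial>M) \<le> b * (\<integral>q. bwd ys (\<lambda>_. 1) q \<partial>M)"
proof -
  have one: "test_fun (\<lambda>_. 1)" by (rule test_fun_const) simp
  have i: "integrable M (bwd ys f)" "integrable M (bwd ys (\<lambda>_. 1))"
    using f one M by (auto intro!: integrable_test_fun test_fun_bwd)
  have sp: "space M = space S" using M(2) by (rule sets_eq_imp_space_eq)
  have "(\<integral>q. a * bwd ys (\<lambda>_. 1) q \<partial>M) \<le> (\<integral>q. bwd ys f q \<partial>M)"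
    using le(1) i by (intro integral_mono) (auto simp: sp)
  then show "a * (\<integral>q. bwd ys (\<lambda>_. 1) q \<partial>M) \<le> (\<integral>q. bwd ys f q \<partial>M)" by simp
  have "(\<integral>q. bwd ys f q \<partial>M) \<le> (\<integral>q. b * bwd ys (\<lambda>_. 1) q \<partial>M)"
    using le(2) i by (intro integral_mono) (auto simp: sp)
  then show "(\<integral>q. bwd ys f q \<partial>M) \<le> b * (\<integral>q. bwd ys (\<lambda>_. 1) q \<partial>M)" by simp
qed

lemma integral_bwd_one_pos:
  assumes "prob_space M" "sets M = sets S"
  shows "0 < (\<integral>q. bwd ys (\<lambda>_. 1) q \<partial>M)"
proof -
  interpret prob_space M by fact
  obtain c where c: "0 < c" "\<And>q. q \<in> space S \<Longrightarrow> c \<le> bwd ys (\<lambda>_. 1) q"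
    using bwd_one_lower[of ys] by auto
  have "(\<integral>q. c \<partial>M) \<le> (\<integral>q. bwd ys (\<lambda>_. 1) q \<partial>M)"
    using c sets_eq_imp_space_eq[OF assms(2)]
    by (intro integral_mono integrable_test_fun test_fun_bwd test_fun_const assms) auto
  with c show ?thesis by (simp add: prob_space)
qed

text \<open>The integral of \<open>f\<close> under the predictive filter, in the form on which all
  estimates are made; \<open>integral_pred_filter\<close> gives the identification.\<close>

definition bayes :: "(nat \<Rightarrow> real) measure \<Rightarrow> nat list \<Rightarrow> ((nat \<Rightarrow> real) \<Rightarrow> real) \<Rightarrow> real" where
  "bayes M ys f = (\<integral>q. bwd ys f q \<partial>M) / (\<integral>q. bwd ys (\<lambda>_. 1) q \<partial>M)"

lemma bayes_bounds:
  assumes f: "test_fun f" "\<And>q. q \<in> space S \<Longrightarrow> a \<le> f q" "\<And>q. q \<in> space S \<Longrightarrow> f q \<le> b"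
    and a: "0 \<le> a" and M: "prob_space M" "sets M = sets S"
  shows "a \<le> bayes M ys f" "bayes M ys f \<le> b"
proof -
  obtain q where "q \<in> space S" using space_S_nonempty by auto
  then have b: "0 \<le> b" using f(2,3) a by (meson order_trans)
  have "a * bwd ys (\<lambda>_. 1) q \<le> bwd ys f q" if "q \<in> space S" for q
    using bwd_mono[OF test_fun_const[OF a] f(1,2) that, of ys] bwd_cmult[of ys a "\<lambda>_. 1" q] by simp
  moreover have "bwd ys f q \<le> b * bwd ys (\<lambda>_. 1) q" if "q \<in> space S" for q
    using bwd_mono[OF f(1) test_fun_const[OF b] f(3) that, of ys] bwd_cmult[of ys b "\<lambda>_. 1" q] by simp
  ultimately show "a \<le> bayes M ys f" "bayes M ys f \<le> b"
    using integral_bwd_bounds[OF f(1) M, of a ys b] integral_bwd_one_pos[OF M, of ys]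
    by (auto simp: bayes_def pos_le_divide_eq pos_divide_le_eq)
qed

text \<open>Subtracting \<open>m\<close> from both ratios does not change their difference and
  replaces \<open>u\<close> by \<open>u - m * w\<close>, which is at most \<open>B * w\<close>.
  Numerator and normaliser are then bounded test functions, to which
  \<open>integral_diff_le_tv_dist\<close> applies.\<close>

lemma bayes_initial_law:
  assumes f: "test_fun f" "\<And>q. q \<in> space S \<Longrightarrow> f q \<le> s" and s: "0 \<le> s"
    and j: "j * (L + 1) \<le> length ys"
    and M: "prob_space \<mu>" "sets \<mu> = sets S" and N: "prob_space \<nu>" "sets \<nu> = sets S"
  shows "\<bar>bayes \<mu> ys f - bayes \<nu> ys f\<bar>
    \<le> 2 * prod_list (map (lik_ratio lam0 A) (take L ys))
        * (contraction j ((!) ys) * s) * tv_dist \<mu> \<nu>"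
proof -
  define w where "w = bwd ys (\<lambda>_. 1)"
  define u where "u = bwd ys f"
  define r where "r = prod_list (map (lik_ratio lam0 A) (take L ys))"
  define B where "B = contraction j ((!) ys) * s"
  obtain m where m: "0 \<le> m" "\<And>q. q \<in> space S \<Longrightarrow> m * w q \<le> u q"
      "\<And>q. q \<in> space S \<Longrightarrow> u q \<le> (m + B) * w q"
    using oscillation[OF f s j] by (auto simp: w_def u_def B_def)
  have B: "0 \<le> B" unfolding B_def using s contraction_nonneg
    by (intro mult_nonneg_nonneg)
  have r: "0 \<le> r"
    unfolding r_def by (intro prod_list_nonneg) (auto intro: order_trans[OF _ lik_ratio_ge_1])
  interpret M: prob_space \<mu> by fact
  interpret N: prob_space \<nu> by fact
  have spM: "space \<mu> = space S"
    using M(2) by (rule sets_eq_imp_space_eq)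
  have fin: "finite_measure \<mu>" "finite_measure \<nu>" by unfold_locales
  have se: "sets \<nu> = sets \<mu>" using M(2) N(2) by simp
  have tv0: "0 \<le> tv_dist \<mu> \<nu>" by (rule tv_dist_nonneg[OF fin se])
  have tw: "test_fun w" and tu: "test_fun u"
    unfolding w_def u_def by (auto intro!: test_fun_bwd test_fun_const f)
  have tv: "test_fun (\<lambda>q. u q - m * w q)" using m tw tu by (intro test_fun_diff) auto
  have wr: "w q \<le> r * w q'" if "q \<in> space S" "q' \<in> space S" for q q'
    using bwd_compare[OF test_fun_const[of 1] that, of 0 ys] by (simp add: w_def r_def)
  let ?wM = "\<integral>q. w q \<partial>\<mu>" and ?wN = "\<integral>q. w q \<partial>\<nu>"
  let ?vM = "\<integral>q. u q - m * w q \<partial>\<mu>" and ?vN = "\<integral>q. u q - m * w q \<partial>\<nu>"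
  have wM: "0 < ?wM" and wN: "0 < ?wN"
    unfolding w_def by (rule integral_bwd_one_pos[OF M] integral_bwd_one_pos[OF N])+
  \<comment> \<open>Averaging over the second state turns the comparison of two values into one with
    the mean, so that the supremum of \<open>w\<close> divided by \<open>?wM\<close> is at most
    \<open>r\<close>.\<close>
  have wup: "w q \<le> r * ?wM" if "q \<in> space S" for q
  proof -
    have "(\<integral>q'. w q \<partial>\<mu>) \<le> (\<integral>q'. r * w q' \<partial>\<mu>)"
      using wr[OF that] integrable_test_fun[OF tw M] by (intro integral_mono) (auto simp: spM)
    then show ?thesis by (simp add: M.prob_space)
  qed
  have w0: "0 \<le> w q" if "q \<in> space S" for q using test_funD(2)[OF tw that] .
  have dw: "\<bar>?wM - ?wN\<bar> \<le> r * ?wM * tv_dist \<mu> \<nu>"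
    using wup w0 test_funD(1)[OF tw] M(2)
    by (intro integral_diff_le_tv_dist fin se) (auto simp: spM cong: measurable_cong_sets)
  have dv: "\<bar>?vM - ?vN\<bar> \<le> B * (r * ?wM) * tv_dist \<mu> \<nu>"
  proof (rule integral_diff_le_tv_dist[OF fin se])
    show "(\<lambda>q. u q - m * w q) \<in> borel_measurable \<mu>"
      using test_funD(1)[OF tv] M(2) by (simp cong: measurable_cong_sets)
    fix q assume "q \<in> space \<mu>"
    then have q: "q \<in> space S" by (simp add: spM)
    have "u q - m * w q \<le> B * w q" using m(3)[OF q] by (simp add: algebra_simps)
    also have "\<dots> \<le> B * (r * ?wM)" using wup[OF q] B by (rule mult_left_mono)
    finally show "0 \<le> u q - m * w q \<and> u q - m * w q \<le> B * (r * ?wM)" using m(2)[OF q] by simp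
  qed
  have iM: "?vM = (\<integral>q. u q \<partial>\<mu>) - m * ?wM" and iN: "?vN = (\<integral>q. u q \<partial>\<nu>) - m * ?wN"
    using integrable_test_fun[OF tw M] integrable_test_fun[OF tu M]
      integrable_test_fun[OF tw N] integrable_test_fun[OF tu N] by simp_all
  have vN: "0 \<le> ?vN" "?vN \<le> B * ?wN"
    using integral_bwd_bounds[OF f(1) N, of m ys "m + B"] m
    unfolding iN by (auto simp: w_def u_def distrib_right)
  have "bayes \<mu> ys f - bayes \<nu> ys f = ?vM / ?wM - ?vN / ?wN"
    using wM wN unfolding iM iN by (simp add: bayes_def u_def w_def field_simps)
  \<comment> \<open>One term is the change of the numerator, the other that of the normaliser,
    weighted by \<open>?vN / ?wN \<le> B\<close>. Both admit the same estimate, hence the factor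
    2.\<close>
  also have "\<dots> = (?vM - ?vN) / ?wM + ?vN / ?wN * ((?wN - ?wM) / ?wM)"
    using wM wN by (simp add: field_simps)
  finally have "\<bar>bayes \<mu> ys f - bayes \<nu> ys f\<bar>
      \<le> \<bar>?vM - ?vN\<bar> / ?wM + ?vN / ?wN * (\<bar>?wN - ?wM\<bar> / ?wM)"
    using wM wN vN by (simp add: abs_mult[symmetric] order_trans[OF abs_triangle_ineq] abs_mult)
  also have "\<dots> \<le> B * r * tv_dist \<mu> \<nu> + B * (r * tv_dist \<mu> \<nu>)"
  proof (intro add_mono mult_mono)
    show "\<bar>?vM - ?vN\<bar> / ?wM \<le> B * r * tv_dist \<mu> \<nu>"
      using dv wM by (simp add: divide_le_eq mult_ac)
    show "?vN / ?wN \<le> B" using vN wN by (simp add: divide_le_eq)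
    show "\<bar>?wN - ?wM\<bar> / ?wM \<le> r * tv_dist \<mu> \<nu>"
      using dw wM by (simp add: divide_le_eq mult_ac abs_minus_commute)
  qed (use B wM in auto)
  finally show ?thesis unfolding r_def[symmetric] B_def[symmetric] by (simp add: algebra_simps)
qed

text \<open>Both values lie in the same interval \<open>[m, m + ?B]\<close> determined by
  \<open>ys\<close> alone. No likelihood ratio and no distance of laws enters, so every complete
  block may be credited here, including the oldest.\<close>

lemma bayes_extend_past:
  assumes f: "test_fun f" "\<And>q. q \<in> space S \<Longrightarrow> f q \<le> s" and s: "0 \<le> s"
    and j: "j * (L + 1) \<le> length ys"
    and M: "prob_space \<mu>" "sets \<mu> = sets S"
  shows "\<bar>bayes \<mu> (zs @ ys) f - bayes \<mu> ys f\<bar>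
    \<le> contraction j ((!) ys) * s"
proof -
  let ?B = "contraction j ((!) ys) * s"
  have B: "0 \<le> ?B" using s contraction_nonneg by (intro mult_nonneg_nonneg)
  obtain m where m: "0 \<le> m" "\<And>q. q \<in> space S \<Longrightarrow> m * bwd ys (\<lambda>_. 1) q \<le> bwd ys f q"
      "\<And>q. q \<in> space S \<Longrightarrow> bwd ys f q \<le> (m + ?B) * bwd ys (\<lambda>_. 1) q"
    using oscillation[OF f s j] by auto
  have one: "test_fun (\<lambda>_. 1)" by (rule test_fun_const) simp
  have *: "m * bwd (zs @ ys) (\<lambda>_. 1) q \<le> bwd (zs @ ys) f q \<and>
      bwd (zs @ ys) f q \<le> (m + ?B) * bwd (zs @ ys) (\<lambda>_. 1) q" if "q \<in> space S" for q
  \<comment> \<open>The last element of \<open>zs\<close> is the middle observation required by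
    \<open>bwd_append\<close>; for empty \<open>zs\<close> the sandwich is already at hand.\<close>
  proof (cases zs rule: rev_cases)
    case (snoc as z)
    have tf: "test_fun (\<lambda>q. c * (lik q z * bwd ys (\<lambda>_. 1) q))" if "0 \<le> c" for c
      using that by (intro test_fun_mult test_fun_lik test_fun_bwd one) (simp add: test_fun_const)
    have tg: "test_fun (\<lambda>q. lik q z * bwd ys f q)" by (intro test_fun_mult test_fun_lik test_fun_bwd f)
    have l: "0 \<le> lik q z" if "q \<in> space S" for q using lik_pos[OF that, of z] by simp
    have "bwd as (\<lambda>q. m * (lik q z * bwd ys (\<lambda>_. 1) q)) q \<le> bwd as (\<lambda>q. lik q z * bwd ys f q) q"
      using m(1,2) that l by (intro bwd_mono tf tg) (auto simp: mult.left_commute[of m] intro: mult_left_mono)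
    moreover have "bwd as (\<lambda>q. lik q z * bwd ys f q) q
        \<le> bwd as (\<lambda>q. (m + ?B) * (lik q z * bwd ys (\<lambda>_. 1) q)) q"
      using m(1,3) that l B
      by (intro bwd_mono tf tg) (auto simp only: mult.left_commute[of "m + ?B"] intro!: mult_left_mono add_nonneg_nonneg)
    ultimately show ?thesis by (simp add: snoc bwd_append bwd_cmult)
  qed (use m that in auto)
  have 1: "m \<le> bayes \<mu> (zs @ ys) f \<and> bayes \<mu> (zs @ ys) f \<le> m + ?B"
    using integral_bwd_bounds[OF f(1) M, of m "zs @ ys" "m + ?B"] * integral_bwd_one_pos[OF M, of "zs @ ys"]
    by (auto simp: bayes_def pos_le_divide_eq pos_divide_le_eq)
  have 2: "m \<le> bayes \<mu> ys f \<and> bayes \<mu> ys f \<le> m + ?B"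
    using integral_bwd_bounds[OF f(1) M, of m "ys" "m + ?B"] m integral_bwd_one_pos[OF M, of "ys"]
    by (auto simp: bayes_def pos_le_divide_eq pos_divide_le_eq)
  from 1 2 show ?thesis by (simp add: abs_le_iff)
qed

end

section \<open>Path integrals and Bayes' formula\<close>

context
  fixes M :: "'i \<Rightarrow> 'a measure" and I :: "'i set" and n :: 'i
  assumes M: "\<And>i. i \<in> I \<Longrightarrow> prob_space (M i)" and n: "n \<in> I"
begin

lemma measurable_fun_upd_PiM:
  "(\<lambda>(x, v). x(n := v)) \<in> PiM I M \<Otimes>\<^sub>M M n \<rightarrow>\<^sub>M PiM I M"
  using n by (auto simp: case_prod_beta' intro!: measurable_fun_upd[of _ I])

text \<open>Redrawing one coordinate from its own law preserves a product measure. In this form the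
  outer integral remains over the full product, which lets the argument be repeated for other
  coordinates.\<close>

lemma nn_integral_PiM_resample:
  assumes f: "f \<in> borel_measurable (PiM I M)"
  shows "(\<integral>\<^sup>+x. f x \<partial>PiM I M) = (\<integral>\<^sup>+x. \<integral>\<^sup>+v. f (x(n := v)) \<partial>M n \<partial>PiM I M)"
proof -
  let ?I = "I - {n}"
  interpret n: prob_space "M n" using M n by blast
  interpret R: prob_space "PiM ?I M" using M by (intro prob_space_PiM) auto
  interpret pair_sigma_finite "M n" "PiM ?I M" ..
  have D: "PiM I M = distr (M n \<Otimes>\<^sub>M PiM ?I M) (PiM I M) (\<lambda>(v, x). x(n := v))"
    using distr_pair_PiM_eq_PiM[of ?I M n] M n by (simp add: insert_absorb)
  have u: "(\<lambda>(v, x). x(n := v)) \<in> M n \<Otimes>\<^sub>M PiM ?I M \<rightarrow>\<^sub>M PiM I M"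
    using n by (auto simp: case_prod_beta' insert_absorb intro!: measurable_fun_upd[of _ ?I])
  have *: "(\<integral>\<^sup>+x. g x \<partial>PiM I M) = (\<integral>\<^sup>+x. \<integral>\<^sup>+v. g (x(n := v)) \<partial>M n \<partial>PiM ?I M)"
    if g: "g \<in> borel_measurable (PiM I M)" for g
  proof -
    have "(\<integral>\<^sup>+x. g x \<partial>PiM I M) = (\<integral>\<^sup>+z. g (case z of (v, x) \<Rightarrow> x(n := v)) \<partial>(M n \<Otimes>\<^sub>M PiM ?I M))"
      by (subst D) (rule nn_integral_distr[OF u], simp add: g)
    also have "\<dots> = (\<integral>\<^sup>+x. \<integral>\<^sup>+v. g (x(n := v)) \<partial>M n \<partial>PiM ?I M)"
      using nn_integral_snd[OF measurable_compose[OF u g]] by (simp add: case_prod_beta')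
    finally show ?thesis .
  qed
  have "(\<lambda>(x, v). f (x(n := v))) \<in> borel_measurable (PiM I M \<Otimes>\<^sub>M M n)"
    using measurable_compose[OF measurable_fun_upd_PiM f] by (simp add: case_prod_beta')
  then have g: "(\<lambda>x. \<integral>\<^sup>+v. f (x(n := v)) \<partial>M n) \<in> borel_measurable (PiM I M)"
    by (rule n.borel_measurable_nn_integral)
  \<comment> \<open>The inner function ignores coordinate \<open>n\<close>; expanding both sides
    over the remaining coordinates leaves a redundant integral of mass 1 on the right.\<close>
  show ?thesis
    by (subst *[OF g], subst *[OF f]) (simp add: n.emeasure_space_1)
qed

end

lemma state_Suc: "state L \<omega> (Suc t) = push L (snd \<omega> (Suc t)) (state L \<omega> t)"
  by (cases \<omega>) simp

lemma state_fun_upd: "t < n \<Longrightarrow> state L (q, x(n := v)) t = state L (q, x) t"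
  by (induction t) auto

context poisson_hmm begin

definition state_law :: "(nat \<Rightarrow> real) measure \<Rightarrow> bool" where
  "state_law \<mu> \<longleftrightarrow> prob_space \<mu> \<and> sets \<mu> = sets S"

lemma state_lawD: "prob_space \<mu>" "sets \<mu> = sets S" "space \<mu> = space S" if "state_law \<mu>"
  using that by (auto simp: state_law_def dest: sets_eq_imp_space_eq)

lemma prob_space_inputs: "prob_space (\<Pi>\<^sub>M i\<in>I. F)"
  using prob_space_F by (intro prob_space_PiM)

lemma prob_space_hidden_law: "state_law \<mu> \<Longrightarrow> prob_space (hidden_law F \<mu>)"
  unfolding hidden_law_def by (intro prob_space_pair prob_space_inputs state_lawD)

lemma sets_hidden_law: "state_law \<mu> \<Longrightarrow> sets (hidden_law F \<mu>) = sets (S \<Otimes>\<^sub>M (\<Pi>\<^sub>M t\<in>{1..}. F))"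
  unfolding hidden_law_def by (intro sets_pair_measure_cong state_lawD refl)

lemma measurable_state:
  "(\<lambda>\<omega>. state L \<omega> t) \<in> S \<Otimes>\<^sub>M (\<Pi>\<^sub>M t\<in>{1..}. F) \<rightarrow>\<^sub>M S"
proof (induction t)
  case 0
  have "(\<lambda>\<omega>. state L \<omega> 0) = fst" by (auto simp: fun_eq_iff)
  then show ?case by simp
next
  case (Suc t)
  have "(\<lambda>\<omega>. snd \<omega> (Suc t)) \<in> S \<Otimes>\<^sub>M (\<Pi>\<^sub>M t\<in>{1..}. F) \<rightarrow>\<^sub>M F"
    by (rule measurable_compose[OF measurable_snd measurable_component_singleton]) simp
  from measurable_compose[OF measurable_Pair[OF Suc this] measurable_push]
  show ?case by (simp add: state_Suc)
qed

lemma measurable_state': "state_law \<mu> \<Longrightarrow> (\<lambda>\<omega>. state L \<omega> t) \<in> hidden_law F \<mu> \<rightarrow>\<^sub>M S"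
  using measurable_state by (subst measurable_cong_sets[OF sets_hidden_law refl])

lemma state_in_space: "state_law \<mu> \<Longrightarrow> \<omega> \<in> space (hidden_law F \<mu>) \<Longrightarrow> state L \<omega> t \<in> space S"
  using measurable_space[OF measurable_state'] .

lemma pmf_rate: "q \<in> space S \<Longrightarrow> pmf (poisson_pmf (rate lam0 h L q)) y = lik q y"
  using rate_lower[of q] lam0_pos by (simp add: lik_def poisson_pmf.rep_eq)

text \<open>Agrees with \<open>path_likelihood\<close> on hidden paths, where the rates are
  positive; the closed formula makes measurability immediate.\<close>

definition path_lik :: "nat \<Rightarrow> (nat \<Rightarrow> nat) \<Rightarrow> (nat \<Rightarrow> real) \<times> (nat \<Rightarrow> real) \<Rightarrow> real" where
  "path_lik t y \<omega> = (\<Prod>s\<in>{1..<t}. lik (state L \<omega> s) (y s))"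

lemma path_likelihood_eq:
  assumes "state_law \<mu>" "\<omega> \<in> space (hidden_law F \<mu>)"
  shows "path_likelihood lam0 h L t y \<omega> = path_lik t y \<omega>"
  using state_in_space[OF assms] by (simp add: path_likelihood_def path_lik_def pmf_rate)

lemma path_lik_nonneg:
  assumes "state_law \<mu>" "\<omega> \<in> space (hidden_law F \<mu>)" shows "0 \<le> path_lik t y \<omega>"
  unfolding path_lik_def using state_in_space[OF assms] lik_pos
  by (intro prod_nonneg) (auto intro: less_imp_le)

lemma measurable_path_lik: "path_lik t y \<in> borel_measurable (S \<Otimes>\<^sub>M (\<Pi>\<^sub>M t\<in>{1..}. F))"
  unfolding path_lik_def[abs_def]
  by (intro borel_measurable_prod measurable_compose[OF measurable_state measurable_lik])

lemma path_lik_fun_upd: "path_lik (Suc t) y (q, x(Suc t := v)) = path_lik (Suc t) y (q, x)"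
  by (simp add: path_lik_def state_fun_upd)

lemma nn_integral_hidden_law_resample:
  assumes \<mu>: "state_law \<mu>" and n: "1 \<le> n"
    and f: "f \<in> borel_measurable (S \<Otimes>\<^sub>M (\<Pi>\<^sub>M t\<in>{1..}. F))"
  shows "(\<integral>\<^sup>+\<omega>. f \<omega> \<partial>hidden_law F \<mu>)
    = (\<integral>\<^sup>+\<omega>. \<integral>\<^sup>+v. f (fst \<omega>, (snd \<omega>)(n := v)) \<partial>F \<partial>hidden_law F \<mu>)"
proof -
  let ?P = "\<Pi>\<^sub>M t\<in>{1..}. F"
  interpret F: prob_space F by (rule prob_space_F)
  interpret P: prob_space ?P by (rule prob_space_inputs)
  have f': "f \<in> borel_measurable (\<mu> \<Otimes>\<^sub>M ?P)"
    using f \<mu> by (subst measurable_cong_sets[OF sets_hidden_law[unfolded hidden_law_def] refl])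
  have up: "(\<lambda>(x, v). x(n := v)) \<in> ?P \<Otimes>\<^sub>M F \<rightarrow>\<^sub>M ?P"
    using measurable_fun_upd_PiM[of "{1..}" "\<lambda>_. F" n] prob_space_F n by simp
  have "(\<lambda>z. (fst (fst z), (snd (fst z))(n := snd z))) \<in> (\<mu> \<Otimes>\<^sub>M ?P) \<Otimes>\<^sub>M F \<rightarrow>\<^sub>M \<mu> \<Otimes>\<^sub>M ?P"
    using measurable_compose[OF _ up, of "\<lambda>z. (snd (fst z), snd z)" "(\<mu> \<Otimes>\<^sub>M ?P) \<Otimes>\<^sub>M F"]
    by (intro measurable_Pair) (auto simp: case_prod_beta')
  from measurable_compose[OF this f']
  have g: "(\<lambda>\<omega>. \<integral>\<^sup>+v. f (fst \<omega>, (snd \<omega>)(n := v)) \<partial>F) \<in> borel_measurable (\<mu> \<Otimes>\<^sub>M ?P)"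
    by (intro F.borel_measurable_nn_integral) (simp add: case_prod_beta')
  have "(\<integral>\<^sup>+\<omega>. f \<omega> \<partial>hidden_law F \<mu>) = (\<integral>\<^sup>+q. \<integral>\<^sup>+x. f (q, x) \<partial>?P \<partial>\<mu>)"
    unfolding hidden_law_def by (rule P.nn_integral_fst[OF f', symmetric])
  also have "\<dots> = (\<integral>\<^sup>+q. \<integral>\<^sup>+x. \<integral>\<^sup>+v. f (q, x(n := v)) \<partial>F \<partial>?P \<partial>\<mu>)"
    using measurable_Pair2[OF f'] n prob_space_F
    by (intro nn_integral_cong nn_integral_PiM_resample[where n = n and M = "\<lambda>_. F"]) auto
  also have "\<dots> = (\<integral>\<^sup>+\<omega>. \<integral>\<^sup>+v. f (fst \<omega>, (snd \<omega>)(n := v)) \<partial>F \<partial>hidden_law F \<mu>)"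
    unfolding hidden_law_def by (subst P.nn_integral_fst[OF g, symmetric]) simp
  finally show ?thesis .
qed

section \<open>Path integrals in terms of the backward recursion\<close>

lemma nn_integral_step:
  assumes "test_fun f" "q \<in> space S"
  shows "(\<integral>\<^sup>+v. ennreal (f (push L v q)) \<partial>F) = ennreal (step f q)"
  unfolding step_def using assms push_in_space[OF assms(2)]
  by (intro nn_integral_eq_integral integrable_step) (auto simp: space_F intro!: AE_I2 test_funD(2)[OF assms(1)])

text \<open>The likelihood of the observations up to time \<open>t\<close> does not see the input
  entering at \<open>Suc t\<close>; redrawing that input averages \<open>f\<close> over one
  transition.\<close>

lemma nn_integral_path_last:
  assumes \<mu>: "state_law \<mu>" and f: "test_fun f"
  shows "(\<integral>\<^sup>+\<omega>. ennreal (path_lik (Suc t) y \<omega> * f (state L \<omega> (Suc t))) \<partial>hidden_law F \<mu>)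
    = (\<integral>\<^sup>+\<omega>. ennreal (path_lik (Suc t) y \<omega> * step f (state L \<omega> t)) \<partial>hidden_law F \<mu>)"
proof -
  have m: "(\<lambda>\<omega>. ennreal (path_lik (Suc t) y \<omega> * f (state L \<omega> (Suc t))))
      \<in> borel_measurable (S \<Otimes>\<^sub>M (\<Pi>\<^sub>M t\<in>{1..}. F))"
    using measurable_path_lik[of "Suc t" y] measurable_compose[OF measurable_state test_funD(1)[OF f]]
    by measurable
  have "(\<integral>\<^sup>+v. ennreal (path_lik (Suc t) y (fst \<omega>, (snd \<omega>)(Suc t := v))
        * f (state L (fst \<omega>, (snd \<omega>)(Suc t := v)) (Suc t))) \<partial>F)
      = ennreal (path_lik (Suc t) y \<omega> * step f (state L \<omega> t))" if \<omega>: "\<omega> \<in> space (hidden_law F \<mu>)" for \<omega>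
  proof -
    have s: "state L \<omega> t \<in> space S" using state_in_space[OF \<mu> \<omega>] .
    have meas: "(\<lambda>v. ennreal (f (push L v (state L \<omega> t)))) \<in> borel_measurable F"
      using integrable_step[OF f s] by simp
    have "(\<integral>\<^sup>+v. ennreal (path_lik (Suc t) y (fst \<omega>, (snd \<omega>)(Suc t := v))
          * f (state L (fst \<omega>, (snd \<omega>)(Suc t := v)) (Suc t))) \<partial>F)
        = (\<integral>\<^sup>+v. ennreal (path_lik (Suc t) y \<omega>) * ennreal (f (push L v (state L \<omega> t))) \<partial>F)"
      using path_lik_nonneg[OF \<mu> \<omega>]
      by (simp add: path_lik_fun_upd state_fun_upd ennreal_mult' del: state.simps add: state_Suc)
    also have "\<dots> = ennreal (path_lik (Suc t) y \<omega>) * ennreal (step f (state L \<omega> t))"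
      using meas by (simp add: nn_integral_cmult nn_integral_step[OF f s])
    finally show ?thesis using path_lik_nonneg[OF \<mu> \<omega>] by (simp add: ennreal_mult')
  qed
  then show ?thesis
    by (subst nn_integral_hidden_law_resample[OF \<mu> _ m, of "Suc t"]) (auto intro!: nn_integral_cong)
qed

text \<open>Time is removed from the newest end: the last likelihood and the last transition are
  absorbed into \<open>f\<close>, which is why \<open>f\<close> is arbitrary in the induction and
  \<open>bwd_snoc\<close> closes it.\<close>

lemma nn_integral_path:
  assumes \<mu>: "state_law \<mu>" and f: "test_fun f"
  shows "(\<integral>\<^sup>+\<omega>. ennreal (path_lik (Suc t) y \<omega> * f (state L \<omega> (Suc t))) \<partial>hidden_law F \<mu>)
    = (\<integral>\<^sup>+q. ennreal (bwd (map y [1..<Suc t]) f q) \<partial>\<mu>)"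
  using f
proof (induction t arbitrary: f)
  case 0
  interpret P: prob_space "\<Pi>\<^sub>M t\<in>{1::nat..}. F" by (rule prob_space_inputs)
  have m: "(\<lambda>z. ennreal (step f (fst z))) \<in> borel_measurable (\<mu> \<Otimes>\<^sub>M (\<Pi>\<^sub>M t\<in>{1..}. F))"
    using test_funD(1)[OF test_fun_step[OF 0]] state_lawD(2)[OF \<mu>]
    by (intro measurable_compose[OF measurable_fst]) (simp cong: measurable_cong_sets)
  have s0: "state L \<omega> 0 = fst \<omega>" for \<omega> by (cases \<omega>) simp
  have "(\<integral>\<^sup>+\<omega>. ennreal (path_lik (Suc 0) y \<omega> * step f (state L \<omega> 0)) \<partial>hidden_law F \<mu>)
      = (\<integral>\<^sup>+q. ennreal (step f q) \<partial>\<mu>)"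
    using P.nn_integral_fst[OF m] P.emeasure_space_1 by (simp add: path_lik_def hidden_law_def s0)
  then show ?case by (simp add: nn_integral_path_last[OF \<mu> 0])
next
  case (Suc t)
  have "(\<integral>\<^sup>+\<omega>. ennreal (path_lik (Suc (Suc t)) y \<omega> * f (state L \<omega> (Suc (Suc t)))) \<partial>hidden_law F \<mu>)
      = (\<integral>\<^sup>+\<omega>. ennreal (path_lik (Suc t) y \<omega> *
          (lik (state L \<omega> (Suc t)) (y (Suc t)) * step f (state L \<omega> (Suc t)))) \<partial>hidden_law F \<mu>)"
    unfolding nn_integral_path_last[OF \<mu> Suc.prems, of "Suc t"]
    by (simp add: path_lik_def mult.assoc)
  also have "\<dots> = (\<integral>\<^sup>+q. ennreal (bwd (map y [1..<Suc t]) (\<lambda>q. lik q (y (Suc t)) * step f q) q) \<partial>\<mu>)"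
    by (intro Suc.IH test_fun_mult test_fun_lik test_fun_step Suc.prems)
  finally show ?case by (simp add: bwd_snoc)
qed

lemma nn_integral_test_fun:
  assumes "test_fun f" "state_law \<mu>"
  shows "(\<integral>\<^sup>+q. ennreal (f q) \<partial>\<mu>) = ennreal (\<integral>q. f q \<partial>\<mu>)"
  using assms state_lawD[OF assms(2)] integrable_test_fun[OF assms(1)] test_funD(2)[OF assms(1)]
  by (intro nn_integral_eq_integral) (auto intro!: AE_I2)

lemma integral_path_lik:
  assumes \<mu>: "state_law \<mu>" and t: "1 \<le> t"
  shows "(\<integral>\<omega>. path_lik t y \<omega> \<partial>hidden_law F \<mu>) = (\<integral>q. bwd (map y [1..<t]) (\<lambda>_. 1) q \<partial>\<mu>)"
proof -
  obtain n where n: "t = Suc n" using t by (cases t) auto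
  have one: "test_fun (\<lambda>_. 1)" by (rule test_fun_const) simp
  have "(\<integral>\<omega>. path_lik t y \<omega> \<partial>hidden_law F \<mu>) = enn2real (\<integral>\<^sup>+\<omega>. ennreal (path_lik t y \<omega>) \<partial>hidden_law F \<mu>)"
    using measurable_path_lik path_lik_nonneg[OF \<mu>]
    by (intro integral_eq_nn_integral) (auto simp: measurable_cong_sets[OF sets_hidden_law[OF \<mu>] refl])
  also have "\<dots> = enn2real (\<integral>\<^sup>+q. ennreal (bwd (map y [1..<t]) (\<lambda>_. 1) q) \<partial>\<mu>)"
    using nn_integral_path[OF \<mu> one, of n y] by (simp add: n)
  also have "\<dots> = (\<integral>q. bwd (map y [1..<t]) (\<lambda>_. 1) q \<partial>\<mu>)"
    using integral_bwd_one_pos[OF state_lawD(1,2)[OF \<mu>]]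
    by (simp add: nn_integral_test_fun[OF test_fun_bwd[OF one] \<mu>] less_imp_le)
  finally show ?thesis .
qed

text \<open>Numerator and normaliser of Bayes' formula are path integrals of the same kind, the
  normaliser being the case \<open>f = 1\<close>.\<close>

lemma nn_integral_pred_filter:
  assumes \<mu>: "state_law \<mu>" and t: "1 \<le> t" and f: "test_fun f"
  shows "(\<integral>\<^sup>+q. ennreal (f q) \<partial>pred_filter lam0 h L F \<mu> t y) = ennreal (bayes \<mu> (map y [1..<t]) f)"
proof -
  obtain n where n: "t = Suc n" using t by (cases t) auto
  let ?P = "hidden_law F \<mu>"
  let ?ys = "map y [1..<t]"
  define W where "W = (\<integral>q. bwd ?ys (\<lambda>_. 1) q \<partial>\<mu>)"
  have W: "0 < W" unfolding W_def by (rule integral_bwd_one_pos[OF state_lawD(1,2)[OF \<mu>]])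
  have WP: "(\<integral>\<omega>. path_likelihood lam0 h L t y \<omega> \<partial>?P) = W"
    unfolding W_def integral_path_lik[OF \<mu> t, symmetric]
    by (intro Bochner_Integration.integral_cong path_likelihood_eq[OF \<mu>]) auto
  have pl: "path_lik t y \<in> borel_measurable ?P"
    using measurable_path_lik by (simp add: measurable_cong_sets[OF sets_hidden_law[OF \<mu>] refl])
  have "(\<lambda>\<omega>. ennreal (path_lik t y \<omega> / W)) \<in> borel_measurable ?P"
    using pl by measurable
  then have w: "(\<lambda>\<omega>. ennreal (path_likelihood lam0 h L t y \<omega> / W)) \<in> borel_measurable ?P"
    by (rule measurable_cong[THEN iffD1, rotated]) (simp add: path_likelihood_eq[OF \<mu>])
  have st: "(\<lambda>\<omega>. state L \<omega> t) \<in> ?P \<rightarrow>\<^sub>M \<mu>"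
    using measurable_state'[OF \<mu>] by (subst measurable_cong_sets[OF refl state_lawD(2)[OF \<mu>]])
  have fm: "(\<lambda>\<omega>. ennreal (f (state L \<omega> t))) \<in> borel_measurable ?P"
    using measurable_compose[OF measurable_state'[OF \<mu>] test_funD(1)[OF f]] by measurable
  have f\<mu>: "f \<in> borel_measurable \<mu>"
    using test_funD(1)[OF f] by (subst measurable_cong_sets[OF state_lawD(2)[OF \<mu>] refl])
  have "(\<integral>\<^sup>+q. ennreal (f q) \<partial>pred_filter lam0 h L F \<mu> t y)
      = (\<integral>\<^sup>+\<omega>. ennreal (path_likelihood lam0 h L t y \<omega> / W) * ennreal (f (state L \<omega> t)) \<partial>?P)"
    unfolding pred_filter_def Let_def WP
    using st f\<mu> fm w by (subst nn_integral_distr) (auto simp: nn_integral_density)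
  also have "\<dots> = (\<integral>\<^sup>+\<omega>. ennreal (path_lik t y \<omega> * f (state L \<omega> t)) / ennreal W \<partial>?P)"
    using W path_lik_nonneg[OF \<mu>] test_funD(2)[OF f state_in_space[OF \<mu>]]
    by (intro nn_integral_cong)
      (simp add: path_likelihood_eq[OF \<mu>] divide_ennreal ennreal_mult'[symmetric] )
  also have "\<dots> = (\<integral>\<^sup>+\<omega>. ennreal (path_lik t y \<omega> * f (state L \<omega> t)) \<partial>?P) / ennreal W"
    using pl measurable_compose[OF measurable_state'[OF \<mu>] test_funD(1)[OF f]]
    by (intro nn_integral_divide) measurable
  also have "\<dots> = ennreal (\<integral>q. bwd ?ys f q \<partial>\<mu>) / ennreal W"
    using nn_integral_path[OF \<mu> f, of n y] by (simp add: n nn_integral_test_fun[OF test_fun_bwd[OF f] \<mu>])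
  also have "\<dots> = ennreal (bayes \<mu> ?ys f)"
    using W test_funD(2)[OF test_fun_bwd[OF f]] state_lawD(3)[OF \<mu>]
    by (subst divide_ennreal) (auto simp: bayes_def W_def intro!: integral_nonneg_AE AE_I2)
  finally show ?thesis .
qed

lemma sets_pred_filter: "sets (pred_filter lam0 h L F \<mu> t y) = sets \<mu>"
  by (simp add: pred_filter_def Let_def)

lemma bayes_nonneg:
  assumes "state_law \<mu>" "test_fun f" shows "0 \<le> bayes \<mu> ys f"
proof -
  obtain c where c: "\<And>q. q \<in> space S \<Longrightarrow> 0 \<le> f q \<and> f q \<le> c" using assms(2) by (metis test_funE)
  then show ?thesis
    using state_lawD[OF assms(1)] by (intro bayes_bounds(1)[OF assms(2), of 0 c]) auto
qed

lemma integral_pred_filter: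
  assumes \<mu>: "state_law \<mu>" and t: "1 \<le> t" and f: "test_fun f"
  shows "(\<integral>q. f q \<partial>pred_filter lam0 h L F \<mu> t y) = bayes \<mu> (map y [1..<t]) f"
proof -
  have s: "sets (pred_filter lam0 h L F \<mu> t y) = sets S"
    by (simp add: sets_pred_filter state_lawD(2)[OF \<mu>])
  have "(\<integral>q. f q \<partial>pred_filter lam0 h L F \<mu> t y) = enn2real (ennreal (bayes \<mu> (map y [1..<t]) f))"
    using test_funD[OF f] sets_eq_imp_space_eq[OF s]
    by (subst nn_integral_pred_filter[OF assms, symmetric], intro integral_eq_nn_integral)
      (auto simp: measurable_cong_sets[OF s refl])
  then show ?thesis using bayes_nonneg[OF \<mu> f] by simp
qed

lemma emeasure_pred_filter:
  assumes \<mu>: "state_law \<mu>" and t: "1 \<le> t" and E: "E \<in> sets S"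
  shows "emeasure (pred_filter lam0 h L F \<mu> t y) E = ennreal (bayes \<mu> (map y [1..<t]) (indicator E))"
proof -
  have "test_fun (indicator E)" using E by (intro test_funI[of _ 1]) auto
  from nn_integral_pred_filter[OF \<mu> t this, of y]
  show ?thesis using E by (simp add: ennreal_indicator sets_pred_filter state_lawD(2)[OF \<mu>])
qed

end

section \<open>Conditionally independent Poisson observations\<close>

abbreviation observations :: "'i set \<Rightarrow> ('i \<Rightarrow> nat) measure" where
  "observations T \<equiv> \<Pi>\<^sub>M t\<in>T. count_space UNIV"

abbreviation poisson_product :: "'i set \<Rightarrow> ('i \<Rightarrow> real) \<Rightarrow> ('i \<Rightarrow> nat) measure" where
  "poisson_product T \<rho> \<equiv> \<Pi>\<^sub>M t\<in>T. measure_pmf (poisson_pmf (\<rho> t))"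

lemma sets_poisson_product: "sets (poisson_product T \<rho>) = sets (observations T)"
  by (intro sets_PiM_cong) auto

lemma prob_space_poisson_product: "prob_space (poisson_product T \<rho>)"
  by (intro prob_space_PiM measure_pmf.prob_space_axioms)

text \<open>For positive rates the mass of any set is a countable sum of explicit functions of the
  rate.\<close>

lemma measurable_emeasure_poisson:
  assumes r: "r \<in> borel_measurable M" "\<And>\<omega>. \<omega> \<in> space M \<Longrightarrow> 0 < r \<omega>"
  shows "(\<lambda>\<omega>. emeasure (measure_pmf (poisson_pmf (r \<omega>))) X) \<in> borel_measurable M"
proof -
  have "emeasure (measure_pmf (poisson_pmf (r \<omega>))) X
      = (\<Sum>k. ennreal (r \<omega> ^ k / fact k * exp (- r \<omega>)) * indicator X k)" if "\<omega> \<in> space M" for \<omega>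
  proof -
    have "emeasure (measure_pmf (poisson_pmf (r \<omega>))) X = (\<integral>\<^sup>+k. indicator X k \<partial>measure_pmf (poisson_pmf (r \<omega>)))"
      by simp
    also have "\<dots> = (\<Sum>k. ennreal (r \<omega> ^ k / fact k * exp (- r \<omega>)) * indicator X k)"
      using r(2)[OF that] by (simp only: nn_integral_measure_pmf nn_integral_count_space_nat pmf_poisson)
    finally show ?thesis .
  qed
  moreover have "(\<lambda>\<omega>. \<Sum>k. ennreal (r \<omega> ^ k / fact k * exp (- r \<omega>)) * indicator X k) \<in> borel_measurable M"
    using r(1) by measurable
  ultimately show ?thesis by (subst measurable_cong) auto
qed

text \<open>Measurability of a kernel need only be tested on a generating system stable under
  intersection; on finite cylinders the mass is a finite product of one-coordinate masses.\<close>

lemma measurable_poisson_product: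
  assumes r: "\<And>t. t \<in> T \<Longrightarrow> (\<lambda>\<omega>. r \<omega> t) \<in> borel_measurable M"
    and pos: "\<And>\<omega> t. \<omega> \<in> space M \<Longrightarrow> t \<in> T \<Longrightarrow> 0 < r \<omega> t"
  shows "(\<lambda>\<omega>. poisson_product T (r \<omega>)) \<in> M \<rightarrow>\<^sub>M prob_algebra (observations T)"
proof (rule measurable_prob_algebra_generated)
  show "sets (observations T) = sigma_sets (\<Pi>\<^sub>E t\<in>T. UNIV) (prod_algebra T (\<lambda>_. count_space UNIV))"
    using sets_PiM[of T "\<lambda>_. count_space UNIV"] by simp
  show "Int_stable (prod_algebra T (\<lambda>_. count_space (UNIV :: nat set)))" by (rule Int_stable_prod_algebra)
  show "prod_algebra T (\<lambda>_. count_space (UNIV :: nat set)) \<subseteq> Pow (\<Pi>\<^sub>E t\<in>T. UNIV)"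
    using prod_algebra_sets_into_space[of T "\<lambda>_. count_space UNIV"] by simp
  show "prob_space (poisson_product T (r \<omega>))" for \<omega> by (rule prob_space_poisson_product)
  show "sets (poisson_product T (r \<omega>)) = sets (observations T)" for \<omega> by (rule sets_poisson_product)
  fix X :: "('a \<Rightarrow> nat) set" assume "X \<in> prod_algebra T (\<lambda>_. count_space UNIV)"
  then obtain J E where X: "X = prod_emb T (\<lambda>_. count_space UNIV) J (\<Pi>\<^sub>E j\<in>J. E j)"
    and J: "finite J" "J \<subseteq> T"
    by (force elim!: prod_algebraE)
  have "X = prod_emb T (\<lambda>t. measure_pmf (poisson_pmf (r \<omega> t))) J (\<Pi>\<^sub>E j\<in>J. E j)" for \<omega>
    by (simp add: X prod_emb_def)
  then have "emeasure (poisson_product T (r \<omega>)) X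
      = (\<Prod>j\<in>J. emeasure (measure_pmf (poisson_pmf (r \<omega> j))) (E j))" for \<omega>
    using emeasure_PiM_emb[of T "\<lambda>t. measure_pmf (poisson_pmf (r \<omega> t))" J E] J
    by (simp add: measure_pmf.prob_space_axioms)
  moreover have "(\<lambda>\<omega>. \<Prod>j\<in>J. emeasure (measure_pmf (poisson_pmf (r \<omega> j))) (E j)) \<in> borel_measurable M"
    using J r pos by (intro borel_measurable_prod_ennreal measurable_emeasure_poisson) auto
  ultimately show "(\<lambda>\<omega>. emeasure (poisson_product T (r \<omega>)) X) \<in> borel_measurable M" by simp
qed

context
  fixes M :: "'a measure" and T :: "'i set" and r :: "'a \<Rightarrow> 'i \<Rightarrow> real"
  assumes M: "prob_space M"
    and r: "\<And>t. t \<in> T \<Longrightarrow> (\<lambda>\<omega>. r \<omega> t) \<in> borel_measurable M"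
      "\<And>\<omega> t. \<omega> \<in> space M \<Longrightarrow> t \<in> T \<Longrightarrow> 0 < r \<omega> t"
begin

lemma poisson_observed_kernel:
  "(\<lambda>\<omega>. distr (poisson_product T (r \<omega>)) (M \<Otimes>\<^sub>M observations T) (Pair \<omega>))
    \<in> M \<rightarrow>\<^sub>M subprob_algebra (M \<Otimes>\<^sub>M observations T)"
  by (rule measurable_distr2[OF _ measurable_prob_algebraD[OF measurable_poisson_product[OF r]]]) auto

lemma sets_poisson_observed: "sets (poisson_observed T M r) = sets (M \<Otimes>\<^sub>M observations T)"
  unfolding poisson_observed_def using prob_space.not_empty[OF M]
  by (intro sets_bind_measurable[OF poisson_observed_kernel])

lemma space_poisson_observed: "space (poisson_observed T M r) = space M \<times> space (observations T)"
  using sets_eq_imp_space_eq[OF sets_poisson_observed] by (simp add: space_pair_measure)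

lemma prob_space_poisson_observed: "prob_space (poisson_observed T M r)"
  unfolding poisson_observed_def
proof (rule prob_space.prob_space_bind[OF M _ poisson_observed_kernel])
  show "AE \<omega> in M. prob_space (distr (poisson_product T (r \<omega>)) (M \<Otimes>\<^sub>M observations T) (Pair \<omega>))"
    by (intro AE_I2 prob_space.prob_space_distr prob_space_poisson_product)
      (auto simp: measurable_cong_sets[OF sets_poisson_product refl])
qed

lemma nn_integral_poisson_observed:
  assumes f: "f \<in> borel_measurable (M \<Otimes>\<^sub>M observations T)"
  shows "(\<integral>\<^sup>+z. f z \<partial>poisson_observed T M r) = (\<integral>\<^sup>+\<omega>. \<integral>\<^sup>+y. f (\<omega>, y) \<partial>poisson_product T (r \<omega>) \<partial>M)"
  unfolding poisson_observed_def nn_integral_bind[OF f poisson_observed_kernel]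
  using f by (intro nn_integral_cong nn_integral_distr)
    (auto simp: measurable_cong_sets[OF sets_poisson_product refl])

text \<open>
  Distances of filters are not known to be measurable in the observations; the integral of a
  nonmeasurable \<open>f\<close> is the supremum over simple functions below it, hence still monotone.
\<close>

lemma nn_integral_poisson_observed_le:
  assumes f: "\<And>\<omega> y. \<omega> \<in> space M \<Longrightarrow> f (\<omega>, y) \<le> g y" and g: "g \<in> borel_measurable (observations T)"
    and B: "\<And>\<omega>. \<omega> \<in> space M \<Longrightarrow> (\<integral>\<^sup>+y. g y \<partial>poisson_product T (r \<omega>)) \<le> B"
  shows "(\<integral>\<^sup>+z. f z \<partial>poisson_observed T M r) \<le> B"
proof -
  have "(\<integral>\<^sup>+z. f z \<partial>poisson_observed T M r) \<le> (\<integral>\<^sup>+z. g (snd z) \<partial>poisson_observed T M r)"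
    using f by (intro nn_integral_mono) (auto simp: space_poisson_observed)
  also have "\<dots> = (\<integral>\<^sup>+\<omega>. \<integral>\<^sup>+y. g y \<partial>poisson_product T (r \<omega>) \<partial>M)"
    using nn_integral_poisson_observed[OF measurable_compose[OF measurable_snd g]] by simp
  also have "\<dots> \<le> (\<integral>\<^sup>+\<omega>. B \<partial>M)" using B by (intro nn_integral_mono)
  also have "\<dots> = B" using prob_space.emeasure_space_1[OF M] by simp
  finally show ?thesis .
qed

end

section \<open>Functions of finitely many observations\<close>

lemma sets_observations_cylinder:
  assumes "finite K" "K \<subseteq> T"
  shows "{y \<in> space (observations T). \<forall>k\<in>K. y k = v k} \<in> sets (observations T)"
proof -
  have "{y \<in> space (observations T). y k = v k} \<in> sets (observations T)" if "k \<in> K" for k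
  proof -
    have "(\<lambda>y. y k) \<in> observations T \<rightarrow>\<^sub>M count_space (UNIV :: nat set)" using that assms by auto
    from measurable_sets[OF this, of "{v k}"] show ?thesis
      by (simp add: vimage_def Int_def conj_commute)
  qed
  with assms(1) show ?thesis by (intro sets.sets_Collect_finite_All) auto
qed

text \<open>Finitely many observations take only countably many values, so every preimage is a
  countable union of cylinders. This covers filters and bounds without any analysis of their
  formulas.\<close>

lemma measurable_observations_finite:
  assumes K: "finite K" "K \<subseteq> T" and f: "\<And>y y'. (\<And>k. k \<in> K \<Longrightarrow> y k = y' k) \<Longrightarrow> f y = f y'"
    and sp: "\<And>y. f y \<in> space N"
  shows "f \<in> observations T \<rightarrow>\<^sub>M N"
proof (rule measurableI)
  fix X assume "X \<in> sets N"
  let ?V = "{v \<in> \<Pi>\<^sub>E k\<in>K. (UNIV :: nat set). f v \<in> X}"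
  have fr: "f y = f (restrict y K)" for y by (rule f) simp
  have "f -` X \<inter> space (observations T) = (\<Union>v\<in>?V. {y \<in> space (observations T). \<forall>k\<in>K. y k = v k})"
  proof (intro set_eqI iffI)
    fix y assume "y \<in> f -` X \<inter> space (observations T)"
    then show "y \<in> (\<Union>v\<in>?V. {y \<in> space (observations T). \<forall>k\<in>K. y k = v k})"
      using fr[of y] by (intro UN_I[of "restrict y K"]) auto
  next
    fix y assume "y \<in> (\<Union>v\<in>?V. {y \<in> space (observations T). \<forall>k\<in>K. y k = v k})"
    then obtain v where "f v \<in> X" "y \<in> space (observations T)" "\<forall>k\<in>K. y k = v k" by auto
    then show "y \<in> f -` X \<inter> space (observations T)" using f[of y v] by auto
  qed
  moreover have "countable ?V"
    using K(1) by (intro countable_subset[OF _ countable_PiE[of K "\<lambda>_. UNIV"]]) auto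
  ultimately show "f -` X \<inter> space (observations T) \<in> sets (observations T)"
    using sets_observations_cylinder[OF K] by (auto intro!: sets.countable_UN')
qed (rule sp)

lemma indep_vars_PiM_components:
  assumes M: "\<And>i. i \<in> T \<Longrightarrow> prob_space (M i)"
  shows "prob_space.indep_vars (PiM T M) M (\<lambda>i y. y i) T"
proof -
  interpret P: prob_space "PiM T M" using M by (rule prob_space_PiM)
  show ?thesis
  proof (cases "T = {}")
    \<comment> \<open>The characterisation of independence by the joint law, used in the other case,
      is for a nonempty index set.\<close>
    case True
    then show ?thesis unfolding P.indep_vars_def P.indep_sets_def by simp
  next
    case False
    have "distr (PiM T M) (PiM T M) (\<lambda>x. \<lambda>i\<in>T. x i) = distr (PiM T M) (PiM T M) (\<lambda>x. x)"
      by (intro distr_cong) (auto simp: space_PiM PiE_def extensional_restrict)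
    also have "\<dots> = PiM T M" by (rule distr_id2) simp
    also have "\<dots> = PiM T (\<lambda>i. distr (PiM T M) (M i) (\<lambda>y. y i))"
      using M by (intro PiM_cong) (simp_all add: distr_PiM_component)
    finally show ?thesis
      using False by (subst P.indep_vars_iff_distr_eq_PiM') auto
  qed
qed

text \<open>Restrictions to disjoint sets of coordinates are independent; writing
  \<open>restrict y (K j)\<close> makes visible which coordinates each factor sees.\<close>

lemma nn_integral_PiM_prod_disjoint:
  fixes M :: "'i \<Rightarrow> 'a measure" and f :: "'j \<Rightarrow> ('i \<Rightarrow> 'a) \<Rightarrow> ennreal"
  assumes M: "\<And>i. i \<in> T \<Longrightarrow> prob_space (M i)" and J: "finite J"
    and K: "\<And>j. j \<in> J \<Longrightarrow> K j \<subseteq> T" "disjoint_family_on K J"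
    and f: "\<And>j. j \<in> J \<Longrightarrow> f j \<in> borel_measurable (PiM (K j) M)"
  shows "(\<integral>\<^sup>+y. (\<Prod>j\<in>J. f j (restrict y (K j))) \<partial>PiM T M)
    = (\<Prod>j\<in>J. \<integral>\<^sup>+y. f j (restrict y (K j)) \<partial>PiM T M)"
proof -
  interpret P: prob_space "PiM T M" using M by (rule prob_space_PiM)
  have "P.indep_vars (\<lambda>j. PiM (K j) M) (\<lambda>j y. restrict (\<lambda>i. y i) (K j)) J"
    using indep_vars_PiM_components[of T M] M K by (intro P.indep_vars_restrict) auto
  from P.indep_vars_compose2[OF this f]
  have "P.indep_vars (\<lambda>_. borel) (\<lambda>j y. f j (restrict y (K j))) J" by simp
  from P.indep_vars_nn_integral[OF J this] show ?thesis by simp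
qed

section \<open>Means of likelihood ratios and block factors\<close>

context poisson_hmm begin

text \<open>The Poisson generating function at \<open>(lam0 + A) / lam0\<close> gives the mean of
  \<open>lik_ratio\<close>; its exponent is bounded using the largest rate, and the factor
  \<open>exp (- \<rho>)\<close> is estimated by 1.\<close>

definition ratio_bound :: real where
  "ratio_bound = exp A * exp ((lam0 + A) * ((lam0 + A) / lam0))"

lemma ratio_bound_ge_1: "1 \<le> ratio_bound"
  using A_nonneg lam0_pos unfolding ratio_bound_def exp_add[symmetric] by simp

text \<open>Bounds the mean of \<open>block_factor\<close>: with all rates at most
  \<open>lam0 + A\<close>, \<open>L\<close> observations vanish together with probability at least
  \<open>exp (- (lam0 + A)) ^ L\<close>.\<close>

definition decay :: real where
  "decay = 1 - doeblin * exp (- (lam0 + A)) ^ L"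

lemma decay_pos: "0 < decay" and decay_less_1: "decay < 1"
proof -
  have "exp (- (lam0 + A)) ^ L \<le> 1" using A_nonneg lam0_pos by (intro power_le_one) auto
  then have "doeblin * exp (- (lam0 + A)) ^ L \<le> doeblin"
    using doeblin_pos by simp
  then show "0 < decay" using doeblin_less by (simp add: decay_def)
  show "decay < 1" using doeblin_pos by (simp add: decay_def)
qed

lemma nn_integral_lik_ratio:
  assumes \<rho>: "lam0 \<le> \<rho>" "\<rho> \<le> lam0 + A"
  shows "(\<integral>\<^sup>+k. ennreal (lik_ratio lam0 A k) \<partial>measure_pmf (poisson_pmf \<rho>)) \<le> ennreal ratio_bound"
proof -
  define c where "c = (lam0 + A) / lam0"
  have c: "0 \<le> c" using A_nonneg lam0_pos by (simp add: c_def)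
  have \<rho>0: "0 < \<rho>" using \<rho> lam0_pos by linarith
  have "(\<lambda>k. exp (A - \<rho>) * ((\<rho> * c) ^ k /\<^sub>R fact k)) sums (exp (A - \<rho>) * exp (\<rho> * c))"
    by (intro sums_mult exp_converges)
  moreover have "exp (A - \<rho>) * ((\<rho> * c) ^ k /\<^sub>R fact k) = pmf (poisson_pmf \<rho>) k * lik_ratio lam0 A k" for k
  proof -
    have "lik_ratio lam0 A k = exp A * c ^ k" by (simp add: lik_ratio_def c_def)
    then show ?thesis
      using \<rho>0 by (simp add: power_mult_distrib exp_diff exp_minus divide_inverse mult_ac)
  qed
  ultimately have s: "(\<lambda>k. pmf (poisson_pmf \<rho>) k * lik_ratio lam0 A k) sums (exp (A - \<rho>) * exp (\<rho> * c))"
    by simp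
  have l: "0 \<le> lik_ratio lam0 A k" for k using lik_ratio_ge_1[of k] by linarith
  have "(\<integral>\<^sup>+k. ennreal (lik_ratio lam0 A k) \<partial>measure_pmf (poisson_pmf \<rho>))
      = (\<Sum>k. ennreal (pmf (poisson_pmf \<rho>) k * lik_ratio lam0 A k))"
    unfolding nn_integral_measure_pmf nn_integral_count_space_nat by (simp add: ennreal_mult l del: pmf_poisson)
  also have "\<dots> = ennreal (exp (A - \<rho>) * exp (\<rho> * c))"
    using s l by (intro suminf_ennreal_eq) auto
  also have "\<dots> \<le> ennreal ratio_bound"
  proof (rule ennreal_leI)
    have "\<rho> * c \<le> (lam0 + A) * c" using \<rho> c by (intro mult_right_mono)
    then show "exp (A - \<rho>) * exp (\<rho> * c) \<le> ratio_bound"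
      unfolding ratio_bound_def c_def[symmetric] using \<rho>0 by (intro mult_mono) auto
  qed
  finally show ?thesis .
qed

lemma nn_integral_block_factor:
  assumes \<rho>: "\<And>t. t \<in> T \<Longrightarrow> lam0 \<le> \<rho> t \<and> \<rho> t \<le> lam0 + A"
    and e: "\<And>i. i < L \<Longrightarrow> e i \<in> T"
  shows "(\<integral>\<^sup>+y. ennreal (block_factor (\<lambda>i. y (e i))) \<partial>poisson_product T \<rho>) \<le> ennreal decay"
proof -
  interpret P: prob_space "poisson_product T \<rho>" by (rule prob_space_poisson_product)
  define K where "K = e ` {..<L}"
  define Z where "Z = prod_emb T (\<lambda>t. measure_pmf (poisson_pmf (\<rho> t))) K (\<Pi>\<^sub>E j\<in>K. {0})"
  have K: "finite K" "K \<subseteq> T" using e by (auto simp: K_def)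
  have Zs: "Z \<in> sets (poisson_product T \<rho>)" unfolding Z_def using K by (intro sets_PiM_I) auto
  have bf: "block_factor (\<lambda>i. y (e i)) = 1 - doeblin * indicator Z y"
    if "y \<in> space (poisson_product T \<rho>)" for y
  proof -
    have "y \<in> Z \<longleftrightarrow> restrict y K \<in> (\<Pi>\<^sub>E j\<in>K. {0})"
      using that by (auto simp: Z_def prod_emb_def space_PiM simp del: PiE_singleton)
    also have "\<dots> \<longleftrightarrow> (\<forall>i<L. y (e i) = 0)"
      by (simp only: restrict_PiE_iff) (auto simp: K_def)
    finally show ?thesis by (simp add: block_factor_def indicator_def)
  qed
  have pos: "0 < \<rho> t" if "t \<in> T" for t using \<rho>[OF that] lam0_pos by linarith
  have "P.prob Z = (\<Prod>j\<in>K. measure (measure_pmf (poisson_pmf (\<rho> j))) {0})"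
  proof (rule measure_eq_emeasure_eq_ennreal)
    show "emeasure (poisson_product T \<rho>) Z = ennreal (\<Prod>j\<in>K. measure (measure_pmf (poisson_pmf (\<rho> j))) {0})"
      unfolding Z_def using K
      by (subst emeasure_PiM_emb) (auto simp: measure_pmf.prob_space_axioms measure_pmf.emeasure_eq_measure prod_ennreal)
  qed (simp add: prod_nonneg)
  also have "\<dots> = (\<Prod>j\<in>K. exp (- \<rho> j))"
    using pos K by (intro prod.cong) (auto simp: measure_pmf_single)
  also have "\<dots> \<ge> (\<Prod>j\<in>K. exp (- (lam0 + A)))"
    using \<rho> K(2) by (intro prod_mono) force
  finally have "exp (- (lam0 + A)) ^ card K \<le> P.prob Z" by simp
  \<comment> \<open>\<open>e\<close> may repeat indices; fewer distinct coordinates only increase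
    the probability that all of them vanish.\<close>
  moreover have "exp (- (lam0 + A)) ^ L \<le> exp (- (lam0 + A)) ^ card K"
    using A_nonneg lam0_pos card_image_le[of "{..<L}" e] by (intro power_decreasing) (auto simp: K_def)
  ultimately have pZ: "doeblin * exp (- (lam0 + A)) ^ L \<le> doeblin * P.prob Z"
    using doeblin_pos by simp
  have "(\<integral>\<^sup>+y. ennreal (block_factor (\<lambda>i. y (e i))) \<partial>poisson_product T \<rho>)
      = (\<integral>\<^sup>+y. ennreal (1 - doeblin * indicator Z y) \<partial>poisson_product T \<rho>)"
    by (intro nn_integral_cong) (simp add: bf)
  also have "\<dots> = ennreal (\<integral>y. 1 - doeblin * indicator Z y \<partial>poisson_product T \<rho>)"
    using Zs doeblin_less doeblin_pos
    by (intro nn_integral_eq_integral) (auto intro!: AE_I2 split: split_indicator simp: less_top[symmetric])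
  also have "(\<integral>y. 1 - doeblin * indicator Z y \<partial>poisson_product T \<rho>) = 1 - doeblin * P.prob Z"
    using Zs by (simp add: less_top[symmetric] P.prob_space)
  also have "ennreal (1 - doeblin * P.prob Z) \<le> ennreal decay"
    using pZ by (intro ennreal_leI) (simp add: decay_def)
  finally show ?thesis .
qed

lemma nn_integral_ratio_block_factor:
  fixes \<rho> :: "'i \<Rightarrow> real" and e :: "nat \<Rightarrow> nat \<Rightarrow> 'i"
  assumes \<rho>: "\<And>t. t \<in> T \<Longrightarrow> lam0 \<le> \<rho> t \<and> \<rho> t \<le> lam0 + A"
    and U: "finite U" "U \<subseteq> T" and J: "finite J"
    and e: "\<And>b i. b \<in> J \<Longrightarrow> i < L \<Longrightarrow> e b i \<in> T - U"
      "\<And>b b' i i'. \<lbrakk>b \<in> J; b' \<in> J; b \<noteq> b'; i < L; i' < L\<rbrakk> \<Longrightarrow> e b i \<noteq> e b' i'"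
  shows "(\<integral>\<^sup>+y. ennreal ((\<Prod>s\<in>U. lik_ratio lam0 A (y s)) * (\<Prod>b\<in>J. block_factor (\<lambda>i. y (e b i))))
      \<partial>poisson_product T \<rho>) \<le> ennreal (ratio_bound ^ card U * decay ^ card J)"
proof -
  let ?P = "poisson_product T \<rho>"
  \<comment> \<open>The disjoint sum indexes ratios and blocks together, so that the product formula
    is applied once to factors depending on disjoint sets of observations.\<close>
  let ?I = "U <+> J"
  define K where "K = case_sum (\<lambda>s. {s}) (\<lambda>b. e b ` {..<L})"
  define f where "f = case_sum (\<lambda>s y. ennreal (lik_ratio lam0 A (y s))) (\<lambda>b y. ennreal (block_factor (\<lambda>i. y (e b i))))"
  have fr: "f j (restrict y (K j)) = f j y" for j y
    by (cases j) (auto simp: f_def K_def block_factor_def)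
  have pf: "(\<Prod>j\<in>?I. f j y) = (\<Prod>s\<in>U. f (Inl s) y) * (\<Prod>b\<in>J. f (Inr b) y)" for y
    using prod.Plus[OF U(1) J, of "\<lambda>j. f j y"] by (simp add: comp_def)
  have l: "0 \<le> lik_ratio lam0 A k" for k using lik_ratio_ge_1[of k] by linarith
  have "(\<integral>\<^sup>+y. ennreal ((\<Prod>s\<in>U. lik_ratio lam0 A (y s)) * (\<Prod>b\<in>J. block_factor (\<lambda>i. y (e b i)))) \<partial>?P)
      = (\<integral>\<^sup>+y. (\<Prod>j\<in>?I. f j (restrict y (K j))) \<partial>?P)"
    unfolding fr pf by (simp add: f_def ennreal_mult prod_nonneg block_factor_nonneg prod_ennreal l)
  also have "\<dots> = (\<Prod>j\<in>?I. \<integral>\<^sup>+y. f j (restrict y (K j)) \<partial>?P)"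
  proof (rule nn_integral_PiM_prod_disjoint)
    show "finite ?I" using U J by simp
    show "K j \<subseteq> T" if "j \<in> ?I" for j using that U e(1) by (auto simp: K_def)
    show "disjoint_family_on K ?I"
      using e U by (fastforce simp: disjoint_family_on_def K_def)
    fix j assume "j \<in> ?I"
    have "f j \<in> borel_measurable (observations (K j))"
      using U by (intro measurable_observations_finite[of "K j"]) (auto simp: K_def f_def block_factor_def split: sum.splits)
    then show "f j \<in> borel_measurable (poisson_product (K j) \<rho>)"
      by (simp add: measurable_cong_sets[OF sets_poisson_product refl])
  qed (rule measure_pmf.prob_space_axioms)
  also have "\<dots> = (\<Prod>s\<in>U. \<integral>\<^sup>+y. ennreal (lik_ratio lam0 A (y s)) \<partial>?P) *
      (\<Prod>b\<in>J. \<integral>\<^sup>+y. ennreal (block_factor (\<lambda>i. y (e b i))) \<partial>?P)"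
    unfolding fr using prod.Plus[OF U(1) J, of "\<lambda>j. \<integral>\<^sup>+y. f j y \<partial>?P"] by (simp add: f_def comp_def)
  also have "\<dots> \<le> (\<Prod>s\<in>U. ennreal ratio_bound) * (\<Prod>b\<in>J. ennreal decay)"
  proof (intro mult_mono prod_mono_ennreal)
    fix s assume s: "s \<in> U"
    then have sT: "s \<in> T" using U by auto
    have "(\<integral>\<^sup>+y. ennreal (lik_ratio lam0 A (y s)) \<partial>?P)
        = (\<integral>\<^sup>+k. ennreal (lik_ratio lam0 A k) \<partial>distr ?P (measure_pmf (poisson_pmf (\<rho> s))) (\<lambda>y. y s))"
      using sT by (subst nn_integral_distr) auto
    also have "\<dots> = (\<integral>\<^sup>+k. ennreal (lik_ratio lam0 A k) \<partial>measure_pmf (poisson_pmf (\<rho> s)))"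
      using sT by (subst distr_PiM_component) (auto simp: measure_pmf.prob_space_axioms)
    also have "\<dots> \<le> ennreal ratio_bound" using \<rho>[OF sT] by (intro nn_integral_lik_ratio) auto
    finally show "(\<integral>\<^sup>+y. ennreal (lik_ratio lam0 A (y s)) \<partial>?P) \<le> ennreal ratio_bound" .
  next
    fix b assume "b \<in> J"
    then show "(\<integral>\<^sup>+y. ennreal (block_factor (\<lambda>i. y (e b i))) \<partial>?P) \<le> ennreal decay"
      using \<rho> e(1) by (intro nn_integral_block_factor) auto
  qed auto
  also have "\<dots> = ennreal (ratio_bound ^ card U * decay ^ card J)"
    using ratio_bound_ge_1 decay_pos by (simp add: ennreal_power ennreal_mult)
  finally show ?thesis .
qed

end

section \<open>Forgetting of the initial law\<close>

lemma block_index_less: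
  fixes b i k n :: nat
  assumes "b < n div k" "i < k" shows "b * k + i < n"
proof -
  have "b * k + i < Suc b * k" using assms by simp
  also have "\<dots> \<le> (n div k) * k" using assms by (intro mult_right_mono) auto
  also have "\<dots> \<le> n" by (rule div_times_less_eq_dividend)
  finally show ?thesis .
qed

lemma prod_drop_first_le:
  fixes g :: "nat \<Rightarrow> real"
  assumes "\<And>b. 0 \<le> g b" "\<And>b. g b \<le> 1"
  shows "(\<Prod>b<n. g b) \<le> (\<Prod>b\<in>{1..<n}. g b)"
proof (cases n)
  case (Suc k)
  have "{..<n} = insert 0 {1..<n}" using Suc by auto
  then have "(\<Prod>b<n. g b) = g 0 * (\<Prod>b\<in>{1..<n}. g b)" by simp
  also have "\<dots> \<le> (\<Prod>b\<in>{1..<n}. g b)" using assms by (intro mult_left_le_one_le prod_nonneg) auto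
  finally show ?thesis .
qed simp

context poisson_hmm begin

text \<open>One factor \<open>decay\<close> is earned per \<open>L + 1\<close> time steps, hence the
  root.\<close>

definition forget_rate :: real where
  "forget_rate = root (Suc L) decay"

text \<open>The 4 is the 2 of \<open>tv_dist_le\<close> times the 2 of
  \<open>bayes_initial_law\<close>. At most \<open>L\<close> early observations and the one at time
  \<open>t\<close> contribute ratios, and \<open>decay\<^sup>2\<close> pays for the uncredited first
  block and the incomplete last one.\<close>

definition forget_const :: real where
  "forget_const = 4 * ratio_bound ^ Suc L / decay\<^sup>2"

lemma forget_rate: "0 < forget_rate" "forget_rate < 1" "forget_rate ^ Suc L = decay"
proof -
  show "0 < forget_rate" unfolding forget_rate_def using decay_pos by (simp add: real_root_gt_zero)
  show "forget_rate < 1" unfolding forget_rate_def using decay_less_1 by (simp add: real_root_lt_1_iff)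
  show "forget_rate ^ Suc L = decay" unfolding forget_rate_def
    using decay_pos by (intro real_root_pow_pos2) auto
qed

lemma forget_const_nonneg: "0 \<le> forget_const"
  using ratio_bound_ge_1 by (simp add: forget_const_def)

lemma decay_power_le:
  assumes "t \<le> Suc L * (k + 2)" shows "decay ^ k \<le> forget_rate ^ t / decay\<^sup>2"
proof -
  have "decay ^ k * decay\<^sup>2 = forget_rate ^ (Suc L * (k + 2))"
    by (simp only: power_mult forget_rate(3) power_add)
  also have "\<dots> \<le> forget_rate ^ t"
    using assms forget_rate by (intro power_decreasing) auto
  finally show ?thesis using decay_pos by (simp add: pos_le_divide_eq)
qed

text \<open>The successor is there because observations are numbered from 1, while positions in the
  list of observations start at 0.\<close>

definition obs_block :: "(nat \<Rightarrow> nat) \<Rightarrow> nat \<Rightarrow> nat \<Rightarrow> nat" where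
  "obs_block y b i = y (Suc (b * Suc L + i))"

text \<open>
  The first block is not credited with a contraction, because its likelihood ratios are
  already used to bound the influence of the initial law.
\<close>

definition forget_bound :: "nat \<Rightarrow> (nat \<Rightarrow> nat) \<Rightarrow> real" where
  "forget_bound t y = (\<Prod>s\<in>insert t {1..<min (Suc L) t}. lik_ratio lam0 A (y s)) *
    (\<Prod>b\<in>{1..<(t - 1) div Suc L}. block_factor (obs_block y b))"

text \<open>The ratio at time \<open>t\<close> is carried along so that one bound serves both
  claims: for the filters it is dropped, being at least 1, and for the logarithms it cancels
  \<open>lik_upper / lik_lower\<close>.\<close>

lemma bayes_forget:
  assumes t: "1 \<le> t" and \<mu>: "state_law \<mu>" and \<nu>: "state_law \<nu>"
    and f: "test_fun f" "\<And>q. q \<in> space S \<Longrightarrow> f q \<le> s" and s: "0 \<le> s"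
  shows "\<bar>bayes \<mu> (map y [1..<t]) f - bayes \<nu> (map y [1..<t]) f\<bar> * lik_ratio lam0 A (y t)
    \<le> 2 * forget_bound t y * s * tv_dist \<mu> \<nu>"
proof -
  let ?ys = "map y [1..<t]"
  let ?j = "(t - 1) div Suc L"
  let ?r = "lik_ratio lam0 A"
  have j: "?j * (L + 1) \<le> length ?ys" using div_times_less_eq_dividend[of "t - 1" "Suc L"] by simp
  have tv: "0 \<le> tv_dist \<mu> \<nu>"
    using state_lawD[OF \<mu>] state_lawD[OF \<nu>]
    by (intro tv_dist_nonneg) (auto intro: prob_space.finite_measure)
  \<comment> \<open>Only \<open>t - 1\<close> observations are available, possibly fewer than
    \<open>L\<close>; hence the minimum.\<close>
  have "prod_list (map ?r (take L ?ys)) = (\<Prod>s\<in>{1..<min (Suc L) t}. ?r (y s))"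
  proof -
    have "take L [1..<t] = [1..<min (Suc L) t]"
      by (cases "Suc L \<le> t") (auto simp: take_upt min_def)
    then show ?thesis
      using prod.distinct_set_conv_list[of "[1..<min (Suc L) t]" "\<lambda>s. ?r (y s)"]
      by (simp add: take_map comp_def)
  qed
  then have r: "prod_list (map ?r (take L ?ys)) * ?r (y t)
      = (\<Prod>s\<in>insert t {1..<min (Suc L) t}. ?r (y s))"
    by (simp add: mult.commute)
  have "?ys ! (b * (L + 1) + i) = y (Suc (b * Suc L + i))" if "b < ?j" "i < L" for b i
    using block_index_less[OF that(1), of i] that(2) by (simp add: algebra_simps)
  then have bl: "block_factor (\<lambda>i. ?ys ! (b * (L + 1) + i)) = block_factor (obs_block y b)" if "b < ?j" for b
    using that by (auto simp: block_factor_def obs_block_def)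
  have "contraction ?j ((!) ?ys) = (\<Prod>b<?j. block_factor (obs_block y b))"
    unfolding contraction_def using bl by (intro prod.cong) auto
  also have "\<dots> \<le> (\<Prod>b\<in>{1..<?j}. block_factor (obs_block y b))"
    using block_factor_nonneg block_factor_le_1 by (intro prod_drop_first_le)
  finally have c: "contraction ?j ((!) ?ys) \<le> (\<Prod>b\<in>{1..<?j}. block_factor (obs_block y b))" .
  have l: "0 \<le> ?r k" for k using lik_ratio_ge_1[of k] by linarith
  have "\<bar>bayes \<mu> ?ys f - bayes \<nu> ?ys f\<bar> * ?r (y t)
      \<le> 2 * prod_list (map ?r (take L ?ys)) * (contraction ?j ((!) ?ys) * s) * tv_dist \<mu> \<nu> * ?r (y t)"
    using state_lawD[OF \<mu>] state_lawD[OF \<nu>] l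
    by (intro mult_right_mono bayes_initial_law f s j) auto
  also have "\<dots> = 2 * (prod_list (map ?r (take L ?ys)) * ?r (y t)) * contraction ?j ((!) ?ys) * (s * tv_dist \<mu> \<nu>)"
    by (simp add: mult_ac)
  also have "\<dots> \<le> 2 * (prod_list (map ?r (take L ?ys)) * ?r (y t)) *
      (\<Prod>b\<in>{1..<?j}. block_factor (obs_block y b)) * (s * tv_dist \<mu> \<nu>)"
    using c s tv l by (intro mult_right_mono mult_left_mono mult_nonneg_nonneg prod_list_nonneg) auto
  finally show ?thesis unfolding r forget_bound_def by (simp add: mult_ac)
qed

lemma forget_bound_nonneg: "0 \<le> forget_bound t y"
proof -
  have "0 \<le> lik_ratio lam0 A k" for k using lik_ratio_ge_1[of k] by linarith
  then show ?thesis unfolding forget_bound_def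
    using block_factor_nonneg by (intro mult_nonneg_nonneg prod_nonneg) auto
qed

lemma measurable_forget_bound:
  assumes "1 \<le> t" shows "forget_bound t \<in> borel_measurable (observations {1..})"
proof (rule measurable_observations_finite)
  show "finite {1..t}" "{1..t} \<subseteq> {1..}" by auto
  fix y y' :: "nat \<Rightarrow> nat" assume eq: "\<And>k. k \<in> {1..t} \<Longrightarrow> y k = y' k"
  have "block_factor (obs_block y b) = block_factor (obs_block y' b)" if b: "b < (t - 1) div Suc L" for b
  proof -
    have "obs_block y b i = obs_block y' b i" if "i < L" for i
      using block_index_less[OF b, of i] that unfolding obs_block_def by (intro eq) auto
    then show ?thesis by (simp add: block_factor_def)
  qed
  then show "forget_bound t y = forget_bound t y'"
    unfolding forget_bound_def using eq assms by (intro arg_cong2[where f = times] prod.cong) auto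
qed simp

lemma nn_integral_forget_bound:
  assumes t: "1 \<le> t" and \<rho>: "\<And>s. 1 \<le> s \<Longrightarrow> lam0 \<le> \<rho> s \<and> \<rho> s \<le> lam0 + A"
  shows "(\<integral>\<^sup>+y. ennreal (4 * forget_bound t y) \<partial>poisson_product {1..} \<rho>)
    \<le> ennreal (forget_const * forget_rate ^ t)"
proof -
  let ?U = "insert t {1..<min (Suc L) t}" and ?J = "{1..<(t - 1) div Suc L}"
  let ?e = "\<lambda>b i. Suc (b * Suc L + i)"
  \<comment> \<open>The credited blocks lie strictly between the first \<open>L + 1\<close> times
    and time \<open>t\<close>, so they share no observation with the likelihood ratios.\<close>
  have e: "?e b i \<in> {1..} - ?U" if "b \<in> ?J" "i < L" for b i
  proof -
    have "?e b i < t" using block_index_less[of b "t - 1" "Suc L" i] that t by simp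
    moreover have "1 * Suc L \<le> b * Suc L" using that by (intro mult_right_mono) auto
    ultimately show ?thesis by auto
  qed
  have "?e b i \<noteq> ?e b' i'" if "b \<noteq> b'" "i < L" "i' < L" for b b' i i'
  proof
    assume "?e b i = ?e b' i'"
    then have "(b * Suc L + i) div Suc L = (b' * Suc L + i') div Suc L" by simp
    with that show False by (simp del: mult_Suc_right)
  qed
  with e \<rho> t have "(\<integral>\<^sup>+y. ennreal ((\<Prod>s\<in>?U. lik_ratio lam0 A (y s)) *
      (\<Prod>b\<in>?J. block_factor (\<lambda>i. y (?e b i)))) \<partial>poisson_product {1..} \<rho>)
      \<le> ennreal (ratio_bound ^ card ?U * decay ^ card ?J)"
    by (intro nn_integral_ratio_block_factor) auto
  also have "ratio_bound ^ card ?U * decay ^ card ?J \<le> ratio_bound ^ Suc L * (forget_rate ^ t / decay\<^sup>2)"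
  proof (rule mult_mono)
    show "ratio_bound ^ card ?U \<le> ratio_bound ^ Suc L"
      using ratio_bound_ge_1 t by (intro power_increasing) auto
    \<comment> \<open>The omitted first block and the unfinished last one account for the 2 added to
      the number of credited blocks.\<close>
    have "t - 1 < Suc L * Suc ((t - 1) div Suc L)" using dividend_less_times_div[of "Suc L" "t - 1"] by simp
    also have "\<dots> \<le> Suc L * (card ?J + 2)" by (intro mult_left_mono) auto
    finally show "decay ^ card ?J \<le> forget_rate ^ t / decay\<^sup>2"
      using t by (intro decay_power_le) linarith
  qed (use ratio_bound_ge_1 decay_pos in auto)
  finally have *: "(\<integral>\<^sup>+y. ennreal (forget_bound t y) \<partial>poisson_product {1..} \<rho>)
      \<le> ennreal (ratio_bound ^ Suc L * (forget_rate ^ t / decay\<^sup>2))"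
    by (simp add: ennreal_leI forget_bound_def obs_block_def[abs_def])
  have m: "(\<lambda>y. ennreal (forget_bound t y)) \<in> borel_measurable (poisson_product {1..} \<rho>)"
    using measurable_forget_bound[OF t] by (simp add: measurable_cong_sets[OF sets_poisson_product refl])
  have "(\<integral>\<^sup>+y. ennreal (4 * forget_bound t y) \<partial>poisson_product {1..} \<rho>)
      = ennreal 4 * (\<integral>\<^sup>+y. ennreal (forget_bound t y) \<partial>poisson_product {1..} \<rho>)"
    using m by (simp add: ennreal_mult' nn_integral_cmult)
  also have "\<dots> \<le> ennreal 4 * ennreal (ratio_bound ^ Suc L * (forget_rate ^ t / decay\<^sup>2))"
    using * by (rule mult_left_mono) simp
  also have "\<dots> = ennreal (4 * (ratio_bound ^ Suc L * (forget_rate ^ t / decay\<^sup>2)))"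
    by (rule ennreal_mult'[symmetric]) simp
  also have "4 * (ratio_bound ^ Suc L * (forget_rate ^ t / decay\<^sup>2)) = forget_const * forget_rate ^ t"
    by (simp add: forget_const_def)
  finally show ?thesis .
qed

section \<open>Comparison of two filters\<close>

context
  fixes \<mu> \<nu> :: "(nat \<Rightarrow> real) measure" and t :: nat
  assumes \<mu>: "state_law \<mu>" and \<nu>: "state_law \<nu>" and t: "1 \<le> t"
begin

lemma tv_dist_pred_filter_le:
  "tv_dist (pred_filter lam0 h L F \<mu> t y) (pred_filter lam0 h L F \<nu> t y) \<le> 4 * forget_bound t y * tv_dist \<mu> \<nu>"
proof -
  have fin: "finite_measure (pred_filter lam0 h L F \<kappa> t y)" if "state_law \<kappa>" for \<kappa>
  proof (rule finite_measureI)
    have "space (pred_filter lam0 h L F \<kappa> t y) = space S"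
      using that by (intro sets_eq_imp_space_eq) (simp add: sets_pred_filter state_lawD(2))
    then show "emeasure (pred_filter lam0 h L F \<kappa> t y) (space (pred_filter lam0 h L F \<kappa> t y)) \<noteq> \<infinity>"
      using emeasure_pred_filter[OF that t, of "space S"] by simp
  qed
  have "\<bar>measure (pred_filter lam0 h L F \<mu> t y) E - measure (pred_filter lam0 h L F \<nu> t y) E\<bar> \<le> 2 * forget_bound t y * tv_dist \<mu> \<nu>"
    if "E \<in> sets (pred_filter lam0 h L F \<mu> t y)" for E
  proof -
    have E: "E \<in> sets S" using that by (simp add: sets_pred_filter state_lawD(2)[OF \<mu>])
    have tf: "test_fun (indicator E)" using E by (intro test_funI[of _ 1]) auto
    have m: "measure (pred_filter lam0 h L F \<kappa> t y) E = bayes \<kappa> (map y [1..<t]) (indicator E)"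
      if "state_law \<kappa>" for \<kappa>
      using emeasure_pred_filter[OF that t E] bayes_nonneg[OF that tf]
      by (intro measure_eq_emeasure_eq_ennreal) auto
    have "\<bar>measure (pred_filter lam0 h L F \<mu> t y) E - measure (pred_filter lam0 h L F \<nu> t y) E\<bar> * 1
        \<le> \<bar>measure (pred_filter lam0 h L F \<mu> t y) E - measure (pred_filter lam0 h L F \<nu> t y) E\<bar> * lik_ratio lam0 A (y t)"
      using lik_ratio_ge_1 by (intro mult_left_mono) auto
    also have "\<dots> \<le> 2 * forget_bound t y * 1 * tv_dist \<mu> \<nu>"
      unfolding m[OF \<mu>] m[OF \<nu>] by (rule bayes_forget[OF t \<mu> \<nu> tf]) (auto simp: indicator_def)
    finally show ?thesis by simp
  qed
  then have "tv_dist (pred_filter lam0 h L F \<mu> t y) (pred_filter lam0 h L F \<nu> t y) \<le> 2 * (2 * forget_bound t y * tv_dist \<mu> \<nu>)"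
    using fin \<mu> \<nu> by (intro tv_dist_le) (auto simp: sets_pred_filter state_lawD(2))
  then show ?thesis by simp
qed

lemma tv_dist_state_law_nonneg: "0 \<le> tv_dist \<mu> \<nu>"
  using state_lawD[OF \<mu>] state_lawD[OF \<nu>]
  by (intro tv_dist_nonneg) (auto intro: prob_space.finite_measure)

lemma predictive_pmf_pred_filter:
  "state_law \<kappa> \<Longrightarrow> predictive_pmf lam0 h L (pred_filter lam0 h L F \<kappa> t y) k = bayes \<kappa> (map y [1..<t]) (\<lambda>q. lik q k)"
  using integral_pred_filter[OF _ t test_fun_lik] by (simp add: predictive_pmf_def lik_def)

lemma bayes_lik_lower: "state_law \<kappa> \<Longrightarrow> lik_lower lam0 A k \<le> bayes \<kappa> ys (\<lambda>q. lik q k)"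
  using state_lawD lik_lower_pos[of k]
  by (intro bayes_bounds(1)[OF test_fun_lik lik_lower lik_upper]) auto

lemma ln_predictive_pmf_le:
  "\<bar>ln (predictive_pmf lam0 h L (pred_filter lam0 h L F \<mu> t y) (y t)) - ln (predictive_pmf lam0 h L (pred_filter lam0 h L F \<nu> t y) (y t))\<bar>
    \<le> 4 * forget_bound t y * tv_dist \<mu> \<nu>"
proof -
  let ?m = "bayes \<mu> (map y [1..<t]) (\<lambda>q. lik q (y t))" and ?n = "bayes \<nu> (map y [1..<t]) (\<lambda>q. lik q (y t))"
  have up: "lik_upper lam0 A (y t) / lik_lower lam0 A (y t) = lik_ratio lam0 A (y t)"
    using lik_lower_pos[of "y t"] by (simp add: lik_upper_eq)
  have r: "0 < lik_ratio lam0 A (y t)" using lik_ratio_ge_1[of "y t"] by linarith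
  have "\<bar>?m - ?n\<bar> * lik_ratio lam0 A (y t) \<le> 2 * forget_bound t y * lik_upper lam0 A (y t) * tv_dist \<mu> \<nu>"
    by (intro bayes_forget t \<mu> \<nu> test_fun_lik lik_upper lik_upper_nonneg)
  then have d: "\<bar>?m - ?n\<bar> \<le> 2 * forget_bound t y * lik_upper lam0 A (y t) * tv_dist \<mu> \<nu> / lik_ratio lam0 A (y t)"
    using r by (simp add: pos_le_divide_eq)
  have "\<bar>ln ?m - ln ?n\<bar>
      \<le> 2 * forget_bound t y * lik_upper lam0 A (y t) * tv_dist \<mu> \<nu> / lik_ratio lam0 A (y t) / lik_lower lam0 A (y t)"
    using d lik_lower_pos bayes_lik_lower \<mu> \<nu> by (intro abs_ln_diff_le) auto
  \<comment> \<open>Here \<open>lik_upper = lik_ratio * lik_lower\<close> cancels the carried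
    ratio.\<close>
  also have "\<dots> = 2 * forget_bound t y * tv_dist \<mu> \<nu>"
    using r lik_lower_pos[of "y t"] by (simp add: lik_upper_eq)
  \<comment> \<open>The constant is enlarged to the one for the filters, so that both claims share
    it.\<close>
  also have "\<dots> \<le> 4 * forget_bound t y * tv_dist \<mu> \<nu>"
    using forget_bound_nonneg tv_dist_state_law_nonneg by (intro mult_right_mono) auto
  finally show ?thesis by (simp add: predictive_pmf_pred_filter \<mu> \<nu>)
qed

text \<open>The observations are integrated first, along a fixed hidden path. That bound uses only
  the range of the rates and is uniform in the path, so the law \<open>\<rho>\<close> generating the
  data is arbitrary.\<close>

lemma nn_integral_hmm_law_le:
  assumes \<rho>: "state_law \<rho>"
    and f: "\<And>\<omega> y. f (\<omega>, y) \<le> ennreal (4 * forget_bound t y * tv_dist \<mu> \<nu>)"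
  shows "(\<integral>\<^sup>+z. f z \<partial>hmm_law lam0 h L F \<rho>) \<le> ennreal (forget_const * forget_rate ^ t * tv_dist \<mu> \<nu>)"
  unfolding hmm_law_def
proof (rule nn_integral_poisson_observed_le)
  show "prob_space (hidden_law F \<rho>)" by (rule prob_space_hidden_law[OF \<rho>])
  show "(\<lambda>\<omega>. rate lam0 h L (state L \<omega> s)) \<in> borel_measurable (hidden_law F \<rho>)" for s
    by (rule measurable_compose[OF measurable_state'[OF \<rho>] measurable_rate])
  show "0 < rate lam0 h L (state L \<omega> s)" if "\<omega> \<in> space (hidden_law F \<rho>)" for \<omega> s
    using rate_lower[OF state_in_space[OF \<rho> that]] lam0_pos by (rule less_le_trans[rotated])
  show "f (\<omega>, y) \<le> ennreal (4 * forget_bound t y) * ennreal (tv_dist \<mu> \<nu>)" for \<omega> y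
    using f[of \<omega> y] tv_dist_state_law_nonneg forget_bound_nonneg by (simp add: ennreal_mult)
  show "(\<lambda>y. ennreal (4 * forget_bound t y) * ennreal (tv_dist \<mu> \<nu>)) \<in> borel_measurable (observations {1..})"
    using measurable_forget_bound[OF t] by measurable
  fix \<omega> assume \<omega>: "\<omega> \<in> space (hidden_law F \<rho>)"
  let ?P = "poisson_product {1..} (\<lambda>s. rate lam0 h L (state L \<omega> s))"
  have "(\<lambda>y. ennreal (4 * forget_bound t y)) \<in> borel_measurable ?P"
    using measurable_forget_bound[OF t] by (simp add: measurable_cong_sets[OF sets_poisson_product refl])
  then have "(\<integral>\<^sup>+y. ennreal (4 * forget_bound t y) * ennreal (tv_dist \<mu> \<nu>) \<partial>?P)
      = (\<integral>\<^sup>+y. ennreal (4 * forget_bound t y) \<partial>?P) * ennreal (tv_dist \<mu> \<nu>)"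
    by (rule nn_integral_multc)
  also have "\<dots> \<le> ennreal (forget_const * forget_rate ^ t) * ennreal (tv_dist \<mu> \<nu>)"
    using rate_lower rate_upper state_in_space[OF \<rho> \<omega>]
    by (intro mult_right_mono nn_integral_forget_bound t) auto
  also have "\<dots> = ennreal (forget_const * forget_rate ^ t * tv_dist \<mu> \<nu>)"
    using forget_const_nonneg forget_rate tv_dist_state_law_nonneg by (simp add: ennreal_mult)
  finally show "(\<integral>\<^sup>+y. ennreal (4 * forget_bound t y) * ennreal (tv_dist \<mu> \<nu>) \<partial>?P)
      \<le> ennreal (forget_const * forget_rate ^ t * tv_dist \<mu> \<nu>)" .
qed

end

section \<open>The stationary process\<close>

abbreviation "inputs \<equiv> \<Pi>\<^sub>M k\<in>(UNIV :: int set). F"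

abbreviation "stationary \<equiv> stationary_law lam0 h L F"

text \<open>The stationary law of the hidden state.\<close>

definition init_law :: "(nat \<Rightarrow> real) measure" where
  "init_law = (\<Pi>\<^sub>M l\<in>{..L}. F)"

text \<open>Restriction makes this a point of \<open>state_space\<close>; the rate of the two-sided
  process reads the same \<open>L + 1\<close> values.\<close>

definition window :: "(int \<Rightarrow> real) \<Rightarrow> int \<Rightarrow> nat \<Rightarrow> real" where
  "window x k = (\<lambda>l\<in>{..L}. x (k - int l))"

lemma state_law_init_law: "state_law init_law"
  unfolding state_law_def init_law_def state_space_def
  using prob_space_inputs sets_F by (auto intro!: sets_PiM_cong)

lemma rate_window: "rate lam0 h L (\<lambda>l. x (k - int l)) = rate lam0 h L (window x k)"
  by (simp add: rate_def window_def)

lemma push_window: "push L (x (k + 1)) (window x k) = window x (k + 1)"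
  by (auto simp: push_def window_def fun_eq_iff algebra_simps split: nat.split)

lemma window_in_space: "x \<in> space inputs \<Longrightarrow> window x k \<in> space S"
  by (auto simp: window_def space_S space_PiM space_F)

lemma measurable_window: "(\<lambda>x. window x k) \<in> inputs \<rightarrow>\<^sub>M S"
proof -
  have "(\<lambda>x. window x k) \<in> inputs \<rightarrow>\<^sub>M (\<Pi>\<^sub>M l\<in>{..L}. F)"
    unfolding window_def by (intro measurable_restrict measurable_component_singleton) auto
  then show ?thesis
    using state_lawD(2)[OF state_law_init_law] by (simp add: init_law_def cong: measurable_cong_sets)
qed

lemma stationary_rate:
  "(\<lambda>x. rate lam0 h L (\<lambda>l. x (k - int l))) \<in> borel_measurable inputs"
  "x \<in> space inputs \<Longrightarrow> 0 < rate lam0 h L (\<lambda>l. x (k - int l))"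
  "x \<in> space inputs \<Longrightarrow> lam0 \<le> rate lam0 h L (\<lambda>l. x (k - int l)) \<and> rate lam0 h L (\<lambda>l. x (k - int l)) \<le> lam0 + A"
proof -
  show "(\<lambda>x. rate lam0 h L (\<lambda>l. x (k - int l))) \<in> borel_measurable inputs"
    unfolding rate_window by (rule measurable_compose[OF measurable_window measurable_rate])
  show *: "lam0 \<le> rate lam0 h L (\<lambda>l. x (k - int l)) \<and> rate lam0 h L (\<lambda>l. x (k - int l)) \<le> lam0 + A"
    if "x \<in> space inputs" for x
    unfolding rate_window using rate_lower rate_upper window_in_space[OF that] by blast
  show "0 < rate lam0 h L (\<lambda>l. x (k - int l))" if "x \<in> space inputs" for x
    using *[OF that] lam0_pos by linarith
qed

lemma prob_space_stationary: "prob_space stationary"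
  unfolding stationary_law_def
  by (intro prob_space_poisson_observed prob_space_inputs stationary_rate)

lemma sets_stationary: "sets stationary = sets (inputs \<Otimes>\<^sub>M observations UNIV)"
  unfolding stationary_law_def
  by (intro sets_poisson_observed prob_space_inputs stationary_rate)

lemma measurable_observation: "snd \<in> stationary \<rightarrow>\<^sub>M observations UNIV"
  by (simp add: measurable_cong_sets[OF sets_stationary refl])

section \<open>The one-sided model inside the two-sided process\<close>

text \<open>Model time \<open>t\<close> is process time \<open>t - n - 1\<close>: the observations
  at \<open>- n, ..., - 1\<close> get the times \<open>1, ..., n\<close>, and process time 0 becomes
  \<open>n + 1\<close>, where the prediction is made.\<close>

definition window_path :: "nat \<Rightarrow> (int \<Rightarrow> real) \<Rightarrow> (nat \<Rightarrow> real) \<times> (nat \<Rightarrow> real)" where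
  "window_path n x = (window x (- int n - 1), \<lambda>t\<in>{1..}. x (int t - int n - 1))"

lemma state_window_path: "state L (window_path n x) t = window x (int t - int n - 1)"
proof (induction t)
  case 0
  then show ?case by (simp add: window_path_def)
next
  case (Suc t)
  then show ?case
    using push_window[of x "int t - int n - 1"] by (simp add: state_Suc window_path_def algebra_simps)
qed

text \<open>The starting window and the later inputs use disjoint sets of coordinates, so they are
  independent; each is an injective reindexing of i.i.d. inputs.\<close>

lemma distr_window_path:
  "distr inputs (S \<Otimes>\<^sub>M (\<Pi>\<^sub>M t\<in>{1..}. F)) (window_path n) = hidden_law F init_law"
proof -
  interpret P: prob_space inputs by (rule prob_space_inputs)
  let ?X = "\<lambda>x. \<lambda>l\<in>{..L}. x (- int n - 1 - int l)"
  let ?Y = "\<lambda>x. \<lambda>t\<in>{1::nat..}. x (int t - int n - 1)"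
  let ?A = "{..- int n - 1}" and ?B = "{- int n..}"
  have "P.indep_var (\<Pi>\<^sub>M k\<in>?A. F) (\<lambda>x. restrict (\<lambda>i. x i) ?A) (\<Pi>\<^sub>M k\<in>?B. F) (\<lambda>x. restrict (\<lambda>i. x i) ?B)"
    using prob_space_F
    by (intro P.indep_var_restrict[where I = UNIV] indep_vars_PiM_components) auto
  then have "P.indep_var (\<Pi>\<^sub>M l\<in>{..L}. F) (?X \<circ> (\<lambda>x. restrict (\<lambda>i. x i) ?A))
      (\<Pi>\<^sub>M t\<in>{1..}. F) (?Y \<circ> (\<lambda>x. restrict (\<lambda>i. x i) ?B))"
    by (rule P.indep_var_compose) (auto intro!: measurable_restrict measurable_component_singleton)
  moreover have X: "?X \<circ> (\<lambda>x. restrict (\<lambda>i. x i) ?A) = ?X" and Y: "?Y \<circ> (\<lambda>x. restrict (\<lambda>i. x i) ?B) = ?Y"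
    by (auto simp: fun_eq_iff)
  ultimately have "P.indep_var (\<Pi>\<^sub>M l\<in>{..L}. F) ?X (\<Pi>\<^sub>M t\<in>{1..}. F) ?Y" by (simp only: X Y)
  then have "distr inputs (\<Pi>\<^sub>M l\<in>{..L}. F) ?X \<Otimes>\<^sub>M distr inputs (\<Pi>\<^sub>M t\<in>{1..}. F) ?Y
      = distr inputs ((\<Pi>\<^sub>M l\<in>{..L}. F) \<Otimes>\<^sub>M (\<Pi>\<^sub>M t\<in>{1..}. F)) (\<lambda>x. (?X x, ?Y x))"
    by (simp add: P.indep_var_distribution_eq)
  moreover have "distr inputs (\<Pi>\<^sub>M l\<in>{..L}. F) ?X = init_law"
    unfolding init_law_def using prob_space_F
    by (intro distr_PiM_reindex[where M = "\<lambda>_. F" and f = "\<lambda>l. - int n - 1 - int l"]) (auto simp: inj_on_def)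
  moreover have "distr inputs (\<Pi>\<^sub>M t\<in>{1..}. F) ?Y = (\<Pi>\<^sub>M t\<in>{1..}. F)"
    using prob_space_F
    by (intro distr_PiM_reindex[where M = "\<lambda>_. F" and f = "\<lambda>t. int t - int n - 1"]) (auto simp: inj_on_def)
  ultimately have "hidden_law F init_law = distr inputs (init_law \<Otimes>\<^sub>M (\<Pi>\<^sub>M t\<in>{1..}. F)) (\<lambda>x. (?X x, ?Y x))"
    by (simp add: hidden_law_def init_law_def)
  also have "\<dots> = distr inputs (S \<Otimes>\<^sub>M (\<Pi>\<^sub>M t\<in>{1..}. F)) (window_path n)"
    using state_lawD(2)[OF state_law_init_law]
    by (intro distr_cong sets_pair_measure_cong refl) (auto simp: window_path_def window_def)
  finally show ?thesis by simp
qed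

lemma measurable_window_path: "window_path n \<in> inputs \<rightarrow>\<^sub>M S \<Otimes>\<^sub>M (\<Pi>\<^sub>M t\<in>{1..}. F)"
  unfolding window_path_def
  by (intro measurable_Pair measurable_window measurable_restrict measurable_component_singleton) auto

text \<open>Oldest observation first, the order in which \<open>bwd\<close> consumes them.\<close>

definition past :: "nat \<Rightarrow> (int \<Rightarrow> nat) \<Rightarrow> nat list" where
  "past n y = map (\<lambda>i. y (int i - int n)) [0..<n]"

lemma length_past: "length (past n y) = n"
  by (simp add: past_def)

lemma nth_past: "i < n \<Longrightarrow> past n y ! i = y (int i - int n)"
  by (simp add: past_def)

lemma past_cong: "(\<And>k. k \<in> {- int n..-1} \<Longrightarrow> y k = y' k) \<Longrightarrow> past n y = past n y'"
  by (simp add: past_def)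

lemma past_split: "m \<le> n \<Longrightarrow> past n y = take (n - m) (past n y) @ past m y"
  by (rule nth_equalityI) (auto simp: nth_append length_past nth_past algebra_simps of_nat_diff)

lemma nn_integral_window_path:
  assumes f: "test_fun f"
  shows "(\<integral>\<^sup>+x. ennreal ((\<Prod>k\<in>{- int n..-1}. lik (window x k) (y k)) * f (window x 0)) \<partial>inputs)
    = ennreal (\<integral>q. bwd (past n y) f q \<partial>init_law)"
proof -
  define y' where "y' t = y (int t - int n - 1)" for t
  have pst: "past n y = map y' [1..<Suc n]"
    by (rule nth_equalityI) (simp_all add: past_def y'_def del: upt_Suc)
  have "(\<Prod>k\<in>{- int n..-1}. lik (window x k) (y k)) = path_lik (Suc n) y' (window_path n x)" for x
    unfolding path_lik_def
    by (rule prod.reindex_bij_witness[where i = "\<lambda>t. int t - int n - 1" and j = "\<lambda>k. nat (k + int n + 1)"])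
      (auto simp: state_window_path y'_def)
  moreover have "window x 0 = state L (window_path n x) (Suc n)" for x
    by (simp add: state_window_path)
  ultimately have "(\<integral>\<^sup>+x. ennreal ((\<Prod>k\<in>{- int n..-1}. lik (window x k) (y k)) * f (window x 0)) \<partial>inputs)
      = (\<integral>\<^sup>+x. ennreal (path_lik (Suc n) y' (window_path n x) * f (state L (window_path n x) (Suc n))) \<partial>inputs)"
    by simp
  also have "\<dots> = (\<integral>\<^sup>+\<omega>. ennreal (path_lik (Suc n) y' \<omega> * f (state L \<omega> (Suc n))) \<partial>hidden_law F init_law)"
    using measurable_path_lik[of "Suc n" y'] measurable_compose[OF measurable_state test_funD(1)[OF f]]
    by (subst distr_window_path[symmetric, of n], subst nn_integral_distr[OF measurable_window_path]) auto
  also have "\<dots> = (\<integral>\<^sup>+q. ennreal (bwd (past n y) f q) \<partial>init_law)"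
    unfolding pst by (rule nn_integral_path[OF state_law_init_law f])
  also have "\<dots> = ennreal (\<integral>q. bwd (past n y) f q \<partial>init_law)"
    by (rule nn_integral_test_fun[OF test_fun_bwd[OF f] state_law_init_law])
  finally show ?thesis .
qed

section \<open>Probabilities of observation cylinders\<close>

lemma emeasure_stationary_cylinder:
  assumes K: "finite K"
  shows "emeasure stationary {\<omega> \<in> space stationary. \<forall>k\<in>K. snd \<omega> k = v k}
    = (\<integral>\<^sup>+x. ennreal (\<Prod>k\<in>K. lik (window x k) (v k)) \<partial>inputs)"
proof -
  let ?C = "{y \<in> space (observations UNIV). \<forall>k\<in>K. y k = v k}"
  have C: "?C \<in> sets (observations (UNIV :: int set))"
    using K by (intro sets_observations_cylinder) auto
  have "{\<omega> \<in> space stationary. \<forall>k\<in>K. snd \<omega> k = v k} = snd -` ?C \<inter> space stationary"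
    by (auto simp: space_PiM)
  then have "emeasure stationary {\<omega> \<in> space stationary. \<forall>k\<in>K. snd \<omega> k = v k}
      = (\<integral>\<^sup>+\<omega>. indicator (snd -` ?C \<inter> space stationary) \<omega> \<partial>stationary)"
    by (simp only: nn_integral_indicator[OF measurable_sets[OF measurable_observation C]])
  also have "\<dots> = (\<integral>\<^sup>+\<omega>. indicator ?C (snd \<omega>) \<partial>stationary)"
    by (intro nn_integral_cong) (simp split: split_indicator)
  also have "\<dots> = (\<integral>\<^sup>+x. \<integral>\<^sup>+y. indicator ?C (snd (x, y))
      \<partial>poisson_product UNIV (\<lambda>k. rate lam0 h L (\<lambda>l. x (k - int l))) \<partial>inputs)"
    unfolding stationary_law_def using C
    by (intro nn_integral_poisson_observed prob_space_inputs stationary_rate) measurable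
  also have "\<dots> = (\<integral>\<^sup>+x. ennreal (\<Prod>k\<in>K. lik (window x k) (v k)) \<partial>inputs)"
  proof (rule nn_integral_cong)
    fix x assume x: "x \<in> space inputs"
    let ?\<rho> = "\<lambda>k. rate lam0 h L (\<lambda>l. x (k - int l))"
    have "?C = prod_emb UNIV (\<lambda>k. measure_pmf (poisson_pmf (?\<rho> k))) K (\<Pi>\<^sub>E k\<in>K. {v k})"
      by (auto simp: prod_emb_def space_PiM restrict_PiE_iff simp del: PiE_singleton)
    moreover have "emeasure (poisson_product UNIV ?\<rho>) \<dots> = (\<Prod>k\<in>K. emeasure (measure_pmf (poisson_pmf (?\<rho> k))) {v k})"
      using K by (intro emeasure_PiM_emb) (auto simp: measure_pmf.prob_space_axioms)
    ultimately have "emeasure (poisson_product UNIV ?\<rho>) ?C = (\<Prod>k\<in>K. ennreal (lik (window x k) (v k)))"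
      by (simp add: emeasure_pmf_single rate_window pmf_rate[OF window_in_space[OF x]] del: pmf_poisson)
    moreover have "?C \<in> sets (poisson_product UNIV ?\<rho>)" using C by (simp only: sets_poisson_product)
    ultimately show "(\<integral>\<^sup>+y. indicator ?C (snd (x, y)) \<partial>poisson_product UNIV ?\<rho>)
        = ennreal (\<Prod>k\<in>K. lik (window x k) (v k))"
      using lik_pos[OF window_in_space[OF x]] by (simp add: prod_ennreal less_imp_le)
  qed
  finally show ?thesis .
qed

definition cylinder :: "nat \<Rightarrow> (int \<Rightarrow> nat) \<Rightarrow> ((int \<Rightarrow> real) \<times> (int \<Rightarrow> nat)) set" where
  "cylinder n v = {\<omega> \<in> space stationary. \<forall>k\<in>{- int n..-1}. snd \<omega> k = v k}"

definition symbol :: "nat \<Rightarrow> ((int \<Rightarrow> real) \<times> (int \<Rightarrow> nat)) set" where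
  "symbol y = {\<omega> \<in> space stationary. snd \<omega> 0 = y}"

text \<open>The elementary conditional probability of the symbol \<open>y\<close> at time 0 given
  the cylinder of depth \<open>n\<close> around \<open>v\<close>; see
  \<open>pred_prob_cylinder\<close>.\<close>

definition pred_prob :: "nat \<Rightarrow> nat \<Rightarrow> (int \<Rightarrow> nat) \<Rightarrow> real" where
  "pred_prob n y v = bayes init_law (past n v) (\<lambda>q. lik q y)"

lemma sets_cylinder: "cylinder n v \<in> sets stationary"
proof -
  have "cylinder n v = snd -` {y \<in> space (observations UNIV). \<forall>k\<in>{- int n..-1}. y k = v k} \<inter> space stationary"
    by (auto simp: cylinder_def space_PiM)
  also have "\<dots> \<in> sets stationary"
    by (intro measurable_sets[OF measurable_observation] sets_observations_cylinder) auto
  finally show ?thesis .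
qed

lemma sets_symbol: "symbol y \<in> sets stationary"
proof -
  have "symbol y = snd -` {z \<in> space (observations UNIV). \<forall>k\<in>{0::int}. z k = y} \<inter> space stationary"
    by (auto simp: symbol_def space_PiM)
  also have "\<dots> \<in> sets stationary"
    by (intro measurable_sets[OF measurable_observation] sets_observations_cylinder) auto
  finally show ?thesis .
qed

lemma emeasure_cylinder:
  "emeasure stationary (cylinder n v) = ennreal (\<integral>q. bwd (past n v) (\<lambda>_. 1) q \<partial>init_law)"
  unfolding cylinder_def
  using nn_integral_window_path[OF test_fun_const[of 1], where n = n and y = v]
  by (subst emeasure_stationary_cylinder) auto

lemma emeasure_cylinder_symbol:
  "emeasure stationary (cylinder n v \<inter> symbol y) = ennreal (\<integral>q. bwd (past n v) (\<lambda>q. lik q y) q \<partial>init_law)"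
proof -
  \<comment> \<open>The symbol at time 0 becomes one more coordinate of the cylinder;
    \<open>past\<close> reads only negative times and does not notice the change.\<close>
  let ?v = "v(0 := y)"
  have "cylinder n v \<inter> symbol y = {\<omega> \<in> space stationary. \<forall>k\<in>insert 0 {- int n..-1}. snd \<omega> k = ?v k}"
    by (auto simp: cylinder_def symbol_def)
  then have "emeasure stationary (cylinder n v \<inter> symbol y)
      = (\<integral>\<^sup>+x. ennreal (\<Prod>k\<in>insert 0 {- int n..-1}. lik (window x k) (?v k)) \<partial>inputs)"
    by (simp only:) (rule emeasure_stationary_cylinder, simp)
  also have "\<dots> = (\<integral>\<^sup>+x. ennreal ((\<Prod>k\<in>{- int n..-1}. lik (window x k) (?v k)) * lik (window x 0) y) \<partial>inputs)"
    by (simp add: mult.commute)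
  also have "\<dots> = ennreal (\<integral>q. bwd (past n ?v) (\<lambda>q. lik q y) q \<partial>init_law)"
    by (rule nn_integral_window_path[OF test_fun_lik])
  also have "past n ?v = past n v" by (rule past_cong) auto
  finally show ?thesis .
qed

lemma pred_prob_bounds: "lik_lower lam0 A y \<le> pred_prob n y v" "pred_prob n y v \<le> lik_upper lam0 A y"
  unfolding pred_prob_def using state_lawD[OF state_law_init_law] lik_lower_pos[of y]
  by (auto intro!: bayes_bounds[OF test_fun_lik lik_lower lik_upper])

lemma pred_prob_nonneg: "0 \<le> pred_prob n y v"
  using pred_prob_bounds(1)[where y = y and n = n and v = v] lik_lower_pos[of y] by linarith

lemma pred_prob_cylinder:
  "ennreal (pred_prob n y v) * emeasure stationary (cylinder n v) = emeasure stationary (cylinder n v \<inter> symbol y)"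
proof -
  have "0 < (\<integral>q. bwd (past n v) (\<lambda>_. 1) q \<partial>init_law)"
    using state_lawD[OF state_law_init_law] by (intro integral_bwd_one_pos)
  then show ?thesis
    using pred_prob_nonneg[of n y v]
    by (simp add: emeasure_cylinder emeasure_cylinder_symbol ennreal_mult'[symmetric] pred_prob_def bayes_def)
qed

section \<open>Conditional probabilities given a finite past\<close>

definition obs_algebra :: "int set \<Rightarrow> ((int \<Rightarrow> real) \<times> (int \<Rightarrow> nat)) measure" where
  "obs_algebra J = vimage_algebra (space stationary) (\<lambda>\<omega>. restrict (snd \<omega>) J) (observations J)"

lemma cond_pmf_obs_eq:
  "cond_pmf_obs lam0 h L F J \<omega> = real_cond_exp stationary (obs_algebra J) (indicator (symbol (snd \<omega> 0))) \<omega>"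
  by (simp add: cond_pmf_obs_def Let_def obs_algebra_def symbol_def)

lemma space_obs_algebra: "space (obs_algebra J) = space stationary"
  by (simp add: obs_algebra_def)

lemma measurable_restrict_obs:
  "(\<lambda>\<omega>. restrict (snd \<omega>) J) \<in> stationary \<rightarrow>\<^sub>M observations J"
  by (intro measurable_restrict measurable_compose[OF measurable_observation measurable_component_singleton]) auto

lemma subalgebra_obs_algebra: "subalgebra stationary (obs_algebra J)"
  using measurable_restrict_obs[of J] unfolding measurable_iff_sets
  by (auto simp: subalgebra_def obs_algebra_def)

lemma cylinder_in_obs_algebra:
  assumes "{- int n..-1} \<subseteq> J" shows "cylinder n v \<in> sets (obs_algebra J)"
proof -
  let ?C = "{y \<in> space (observations J). \<forall>k\<in>{- int n..-1}. y k = v k}"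
  have "(\<lambda>\<omega>. restrict (snd \<omega>) J) -` ?C \<inter> space stationary \<in> sets (obs_algebra J)"
    unfolding obs_algebra_def using assms by (intro in_vimage_algebra sets_observations_cylinder) auto
  also have "(\<lambda>\<omega>. restrict (snd \<omega>) J) -` ?C \<inter> space stationary = cylinder n v"
    using assms by (auto simp: cylinder_def space_PiM subset_eq)
  finally show ?thesis .
qed

lemma Union_cylinders: "(\<Union>v\<in>{- int n..-1} \<rightarrow>\<^sub>E UNIV. cylinder n v) = space stationary"
proof (intro equalityI subsetI)
  fix \<omega> assume "\<omega> \<in> space stationary"
  then show "\<omega> \<in> (\<Union>v\<in>{- int n..-1} \<rightarrow>\<^sub>E UNIV. cylinder n v)"
    by (intro UN_I[of "restrict (snd \<omega>) {- int n..-1}"]) (auto simp: cylinder_def)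
qed (auto simp: cylinder_def)

lemma countable_cylinder_index: "countable ({- int n..-1} \<rightarrow>\<^sub>E (UNIV :: nat set))"
  by (intro countable_PiE) auto

section \<open>Generators of the observation algebras\<close>

text \<open>The depth set \<open>N\<close> is a singleton for a finite past and \<open>UNIV\<close>
  for the infinite one, so both cases share the uniqueness argument. The empty set is added for
  stability under intersection.\<close>

definition cylinders :: "nat set \<Rightarrow> ((int \<Rightarrow> real) \<times> (int \<Rightarrow> nat)) set set" where
  "cylinders N = insert {} {cylinder n v |n v. n \<in> N}"

text \<open>Cylinders form a tree: two of them are nested if their prescriptions agree on the
  shorter past, and disjoint otherwise.\<close>

lemma Int_stable_cylinders: "Int_stable (cylinders N)"
proof (rule Int_stableI)
  have *: "cylinder n v \<inter> cylinder n' v' \<in> cylinders N" if "n \<le> n'" "n' \<in> N" for n n' v v'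
  proof (cases "\<forall>k\<in>{- int n..-1}. v k = v' k")
    case True
    moreover have "{- int n..-1} \<subseteq> {- int n'..-1}" using that(1) by auto
    ultimately have "cylinder n' v' \<subseteq> cylinder n v" unfolding cylinder_def by (auto dest: subsetD)
    then have "cylinder n v \<inter> cylinder n' v' = cylinder n' v'" by blast
    then show ?thesis using that(2) by (auto simp: cylinders_def)
  next
    case False
    then obtain k where k: "k \<in> {- int n..-1}" "v k \<noteq> v' k" by blast
    then have k': "k \<in> {- int n'..-1}" using that(1) by auto
    have "snd \<omega> k = v k \<and> snd \<omega> k = v' k" if "\<omega> \<in> cylinder n v \<inter> cylinder n' v'" for \<omega>
      using that k(1) k' unfolding cylinder_def by blast
    with k(2) have "cylinder n v \<inter> cylinder n' v' = {}" by (metis ex_in_conv)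
    then show ?thesis by (simp add: cylinders_def)
  qed
  fix a b assume "a \<in> cylinders N" "b \<in> cylinders N"
  then consider "a = {}" | "b = {}" |
    n v n' v' where "a = cylinder n v" "n \<in> N" "b = cylinder n' v'" "n' \<in> N"
    by (auto simp: cylinders_def)
  then show "a \<inter> b \<in> cylinders N"
  proof cases
    case 3
    show ?thesis
    proof (cases "n \<le> n'")
      case True
      then show ?thesis using 3 * by simp
    next
      case False
      then show ?thesis using 3 *[of n' n v' v] by (simp add: Int_commute)
    qed
  qed (auto simp: cylinders_def)
qed

text \<open>The nontrivial inclusion holds because a level set of one observation is a countable
  union of cylinders reaching back far enough.\<close>

lemma sets_obs_algebra:
  assumes J: "J = (\<Union>n\<in>N. {- int n..-1})"
  shows "sets (obs_algebra J) = sigma_sets (space stationary) (cylinders N)"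
proof
  have "cylinder n v \<in> sets (obs_algebra J)" if "n \<in> N" for n v
    unfolding J using that by (intro cylinder_in_obs_algebra UN_upper)
  then have "cylinders N \<subseteq> sets (obs_algebra J)" unfolding cylinders_def by blast
  then show "sigma_sets (space stationary) (cylinders N) \<subseteq> sets (obs_algebra J)"
    using sets.sigma_sets_subset[of "cylinders N" "obs_algebra J"] by (simp add: space_obs_algebra)
next
  let ?G = "sigma (space stationary) (cylinders N)"
  have sub: "cylinders N \<subseteq> Pow (space stationary)" by (auto simp: cylinders_def cylinder_def)
  have sG: "space ?G = space stationary" "sets ?G = sigma_sets (space stationary) (cylinders N)"
    using sub by (auto simp: space_measure_of sets_measure_of)
  have coord: "(\<lambda>\<omega>. snd \<omega> j) \<in> ?G \<rightarrow>\<^sub>M count_space UNIV" if "j \<in> J" for j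
  proof -
    obtain n where n: "n \<in> N" "j \<in> {- int n..-1}" using \<open>j \<in> J\<close> J by auto
    have "(\<lambda>\<omega>. snd \<omega> j) -` {a} \<inter> space ?G \<in> sets ?G" for a
    proof -
      let ?V = "{v \<in> {- int n..-1} \<rightarrow>\<^sub>E UNIV. v j = a}"
      have "(\<lambda>\<omega>. snd \<omega> j) -` {a} \<inter> space ?G = (\<Union>v\<in>?V. cylinder n v)"
      proof (intro equalityI subsetI)
        fix \<omega> assume "\<omega> \<in> (\<lambda>\<omega>. snd \<omega> j) -` {a} \<inter> space ?G"
        then show "\<omega> \<in> (\<Union>v\<in>?V. cylinder n v)"
          using n by (intro UN_I[of "restrict (snd \<omega>) {- int n..-1}"]) (auto simp: cylinder_def sG)
      qed (use n in \<open>auto simp: cylinder_def sG\<close>)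
      moreover have "cylinder n v \<in> sets ?G" for v
        unfolding sG using n(1) by (intro sigma_sets.Basic) (auto simp: cylinders_def)
      moreover have "countable ?V" by (rule countable_subset[OF _ countable_cylinder_index[of n]]) auto
      ultimately show ?thesis by (auto intro!: sets.countable_UN')
    qed
    then show ?thesis by (subst measurable_count_space_eq2_countable) auto
  qed
  have "(\<lambda>\<omega>. restrict (snd \<omega>) J) \<in> ?G \<rightarrow>\<^sub>M observations J"
    using coord by (intro measurable_restrict) auto
  then show "sets (obs_algebra J) \<subseteq> sigma_sets (space stationary) (cylinders N)"
    unfolding measurable_iff_sets obs_algebra_def by (auto simp: sG)
qed

text \<open>Both sides are measures of \<open>E\<close> on the observation algebra, with densities
  \<open>Z\<close> and the indicator of the symbol. They agree on a generator stable under
  intersection, and the cylinders of a single depth form a countable cover of finite mass.\<close>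

lemma nn_integral_cylinders_eq:
  assumes J: "J = (\<Union>n\<in>N. {- int n..-1})" and N: "N \<noteq> {}"
    and Z: "Z \<in> borel_measurable stationary"
    and eq: "\<And>n v. n \<in> N \<Longrightarrow>
      (\<integral>\<^sup>+\<omega>. Z \<omega> * indicator (cylinder n v) \<omega> \<partial>stationary) = emeasure stationary (cylinder n v \<inter> symbol y)"
    and E: "E \<in> sets (obs_algebra J)"
  shows "(\<integral>\<^sup>+\<omega>. Z \<omega> * indicator E \<omega> \<partial>stationary) = emeasure stationary (E \<inter> symbol y)"
proof -
  interpret M: prob_space stationary by (rule prob_space_stationary)
  let ?M1 = "restr_to_subalg (density stationary Z) (obs_algebra J)"
  let ?M2 = "restr_to_subalg (density stationary (indicator (symbol y))) (obs_algebra J)"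
  have sub: "subalgebra (density stationary f) (obs_algebra J)" for f
    using subalgebra_obs_algebra[of J] by (simp add: subalgebra_def)
  have sE: "E \<in> sets stationary" if "E \<in> sets (obs_algebra J)" for E
    using subalgebra_obs_algebra[of J] that by (auto simp: subalgebra_def)
  have e1: "emeasure ?M1 E = (\<integral>\<^sup>+\<omega>. Z \<omega> * indicator E \<omega> \<partial>stationary)" if "E \<in> sets (obs_algebra J)" for E
    using that sE[OF that] Z by (simp add: emeasure_restr_to_subalg[OF sub] emeasure_density)
  have e2: "emeasure ?M2 E = emeasure stationary (E \<inter> symbol y)" if "E \<in> sets (obs_algebra J)" for E
  proof -
    have "emeasure ?M2 E = (\<integral>\<^sup>+\<omega>. indicator (symbol y) \<omega> * indicator E \<omega> \<partial>stationary)"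
      unfolding emeasure_restr_to_subalg[OF sub that]
      using sE[OF that] sets_symbol[of y] by (intro emeasure_density) auto
    also have "\<dots> = (\<integral>\<^sup>+\<omega>. indicator (E \<inter> symbol y) \<omega> \<partial>stationary)"
      by (intro nn_integral_cong) (auto split: split_indicator)
    also have "\<dots> = emeasure stationary (E \<inter> symbol y)"
      using sE[OF that] sets_symbol[of y] by (intro nn_integral_indicator) auto
    finally show ?thesis .
  qed
  obtain n0 where n0: "n0 \<in> N" using N by auto
  have "?M1 = ?M2"
  proof (rule measure_eqI_generator_eq_countable[OF Int_stable_cylinders[of N]])
    let ?A = "(\<lambda>v. cylinder n0 v) ` ({- int n0..-1} \<rightarrow>\<^sub>E UNIV)"
    show "cylinders N \<subseteq> Pow (space stationary)" by (auto simp: cylinders_def cylinder_def)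
    show "sets ?M1 = sigma_sets (space stationary) (cylinders N)"
      "sets ?M2 = sigma_sets (space stationary) (cylinders N)"
      using sets_obs_algebra[OF J] by (simp_all add: sets_restr_to_subalg[OF sub])
    show "?A \<subseteq> cylinders N" using n0 by (auto simp: cylinders_def)
    show "\<Union>?A = space stationary" using Union_cylinders[of n0] by simp
    show "countable ?A" by (intro countable_image countable_cylinder_index)
    have cyl: "cylinder n v \<in> sets (obs_algebra J)" if "n \<in> N" for n v
      unfolding J using that by (intro cylinder_in_obs_algebra UN_upper)
    show "emeasure ?M1 X = emeasure ?M2 X" if "X \<in> cylinders N" for X
      using that e1 e2 eq cyl by (auto simp: cylinders_def)
    show "emeasure ?M1 a \<noteq> \<infinity>" if "a \<in> ?A" for a
      using that e1 eq cyl n0 by (auto simp: M.emeasure_eq_measure)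
  qed
  with e1[OF E] e2[OF E] show ?thesis by simp
qed

text \<open>The bound \<open>c\<close> makes \<open>Z\<close> integrable, so the identity of
  nonnegative integrals turns into the identity of real set integrals that characterises conditional
  expectation.\<close>

lemma real_cond_exp_symbol:
  assumes Z: "Z \<in> borel_measurable (obs_algebra J)" "\<And>\<omega>. \<omega> \<in> space stationary \<Longrightarrow> 0 \<le> Z \<omega> \<and> Z \<omega> \<le> c"
    and eq: "\<And>E. E \<in> sets (obs_algebra J) \<Longrightarrow>
      (\<integral>\<^sup>+\<omega>. ennreal (Z \<omega>) * indicator E \<omega> \<partial>stationary) = emeasure stationary (E \<inter> symbol y)"
  shows "AE \<omega> in stationary. real_cond_exp stationary (obs_algebra J) (indicator (symbol y)) \<omega> = Z \<omega>"
proof -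
  interpret M: prob_space stationary by (rule prob_space_stationary)
  interpret finite_measure_subalgebra stationary "obs_algebra J"
    using subalgebra_obs_algebra by unfold_locales
  have Zm: "Z \<in> borel_measurable stationary"
    using measurable_from_subalg[OF subalgebra_obs_algebra Z(1)] .
  show ?thesis
  proof (rule real_cond_exp_charact)
    fix E assume E: "E \<in> sets (obs_algebra J)"
    then have sE: "E \<in> sets stationary"
      using subalgebra_obs_algebra[of J] by (auto simp: subalgebra_def)
    have "(\<integral>\<omega>\<in>E. indicator (symbol y) \<omega> \<partial>stationary) = (\<integral>\<omega>. indicator (E \<inter> symbol y) \<omega> \<partial>stationary)"
      unfolding set_lebesgue_integral_def
      by (intro Bochner_Integration.integral_cong) (auto split: split_indicator)
    also have "\<dots> = measure stationary (E \<inter> symbol y)"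
      using sE sets_symbol[of y] by (simp add: sets.sets_into_space Int_absorb2)
    also have "\<dots> = enn2real (\<integral>\<^sup>+\<omega>. ennreal (Z \<omega>) * indicator E \<omega> \<partial>stationary)"
      by (simp add: eq[OF E] measure_def)
    also have "\<dots> = enn2real (\<integral>\<^sup>+\<omega>. ennreal (indicator E \<omega> *\<^sub>R Z \<omega>) \<partial>stationary)"
      by (intro arg_cong[where f = enn2real] nn_integral_cong) (auto split: split_indicator)
    also have "\<dots> = (\<integral>\<omega>\<in>E. Z \<omega> \<partial>stationary)"
      unfolding set_lebesgue_integral_def using Zm sE Z(2)
      by (intro integral_eq_nn_integral[symmetric]) (auto split: split_indicator)
    finally show "(\<integral>\<omega>\<in>E. indicator (symbol y) \<omega> \<partial>stationary) = (\<integral>\<omega>\<in>E. Z \<omega> \<partial>stationary)" .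
  next
    show "integrable stationary (indicator (symbol y) :: _ \<Rightarrow> real)"
      using sets_symbol[of y] by (intro integrable_real_indicator) (auto simp: M.emeasure_eq_measure)
    show "integrable stationary Z"
      using Zm Z(2) by (intro M.integrable_const_bound[of _ c]) auto
  qed (rule Z(1))
qed

lemma measurable_pred_prob:
  assumes "{- int n..-1} \<subseteq> J"
  shows "(\<lambda>\<omega>. pred_prob n y (snd \<omega>)) \<in> borel_measurable (obs_algebra J)"
proof -
  have "pred_prob n y \<in> borel_measurable (observations J)"
    by (rule measurable_observations_finite[of "{- int n..-1}"])
      (use assms in \<open>auto simp: pred_prob_def intro!: arg_cong2[where f = "bayes init_law"] past_cong\<close>)
  moreover have "(\<lambda>\<omega>. restrict (snd \<omega>) J) \<in> obs_algebra J \<rightarrow>\<^sub>M observations J"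
    unfolding obs_algebra_def by (intro measurable_vimage_algebra1) (auto simp: space_PiM)
  ultimately have "(\<lambda>\<omega>. pred_prob n y (restrict (snd \<omega>) J)) \<in> borel_measurable (obs_algebra J)"
    by (rule measurable_compose[rotated])
  moreover have "past n (restrict z J) = past n z" for z
    using assms by (intro past_cong) auto
  ultimately show ?thesis by (simp add: pred_prob_def)
qed

lemma measurable_pred_prob_stationary: "(\<lambda>\<omega>. pred_prob n y (snd \<omega>)) \<in> borel_measurable stationary"
  using measurable_from_subalg[OF subalgebra_obs_algebra measurable_pred_prob[OF order_refl]] .

text \<open>On a cylinder of depth \<open>n\<close> the integrand is constant, equal to the
  elementary conditional probability; cylinders of this single depth generate the algebra.\<close>

lemma nn_integral_pred_prob:
  assumes E: "E \<in> sets (obs_algebra {- int n..-1})"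
  shows "(\<integral>\<^sup>+\<omega>. ennreal (pred_prob n y (snd \<omega>)) * indicator E \<omega> \<partial>stationary) = emeasure stationary (E \<inter> symbol y)"
proof (rule nn_integral_cylinders_eq[where N = "{n}", OF _ _ _ _ E])
  show "(\<lambda>\<omega>. ennreal (pred_prob n y (snd \<omega>))) \<in> borel_measurable stationary"
    using measurable_pred_prob_stationary by measurable
  fix m v assume "m \<in> {n}"
  then have m: "m = n" by simp
  have "(\<integral>\<^sup>+\<omega>. ennreal (pred_prob n y (snd \<omega>)) * indicator (cylinder m v) \<omega> \<partial>stationary)
      = (\<integral>\<^sup>+\<omega>. ennreal (pred_prob n y v) * indicator (cylinder n v) \<omega> \<partial>stationary)"
  proof (rule nn_integral_cong)
    fix \<omega>
    have "past n (snd \<omega>) = past n v" if "\<omega> \<in> cylinder n v"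
      using that by (intro past_cong) (auto simp: cylinder_def)
    then show "ennreal (pred_prob n y (snd \<omega>)) * indicator (cylinder m v) \<omega>
        = ennreal (pred_prob n y v) * indicator (cylinder n v) \<omega>"
      by (auto simp: pred_prob_def m split: split_indicator)
  qed
  also have "\<dots> = emeasure stationary (cylinder n v \<inter> symbol y)"
    using sets_cylinder[of n v] pred_prob_cylinder[of n y v] by (simp add: nn_integral_cmult_indicator)
  finally show "(\<integral>\<^sup>+\<omega>. ennreal (pred_prob n y (snd \<omega>)) * indicator (cylinder m v) \<omega> \<partial>stationary)
      = emeasure stationary (cylinder m v \<inter> symbol y)" by (simp add: m)
qed auto

lemma AE_cond_exp_finite_past:
  "AE \<omega> in stationary. real_cond_exp stationary (obs_algebra {- int n..-1}) (indicator (symbol y)) \<omega>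
    = pred_prob n y (snd \<omega>)"
  using pred_prob_nonneg pred_prob_bounds(2) nn_integral_pred_prob measurable_pred_prob[OF order_refl]
  by (intro real_cond_exp_symbol[where c = "lik_upper lam0 A y"]) auto

section \<open>Contraction along the recent past\<close>

text \<open>Blocks are aligned at time \<open>- n\<close> and all of them count, from
  \<open>b = 0\<close> on, in contrast to \<open>forget_bound\<close>.\<close>

definition past_contraction :: "nat \<Rightarrow> (int \<Rightarrow> nat) \<Rightarrow> real" where
  "past_contraction n v = (\<Prod>b<n div Suc L. block_factor (\<lambda>i. v (int (b * Suc L + i) - int n)))"

lemma block_in_past:
  assumes "b < n div Suc L" "i < L" shows "int (b * Suc L + i) - int n \<in> {- int n..-1}"
proof -
  have "int k - int n \<in> {- int n..-1}" if "k < n" for k using that by auto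
  moreover have "b * Suc L + i < n" using block_index_less[OF assms(1), of i] assms(2) by simp
  ultimately show ?thesis by blast
qed

lemma past_contraction_cong:
  assumes eq: "\<And>k. k \<in> {- int n..-1} \<Longrightarrow> y k = y' k"
  shows "past_contraction n y = past_contraction n y'"
proof -
  have "block_factor (\<lambda>i. y (int (b * Suc L + i) - int n)) = block_factor (\<lambda>i. y' (int (b * Suc L + i) - int n))"
    if "b < n div Suc L" for b
  proof -
    have "y (int (b * Suc L + i) - int n) = y' (int (b * Suc L + i) - int n)" if "i < L" for i
      by (rule eq[OF block_in_past[OF \<open>b < n div Suc L\<close> that]])
    then show ?thesis by (auto simp: block_factor_def)
  qed
  then show ?thesis unfolding past_contraction_def by (intro prod.cong) auto
qed

lemma past_contraction_nonneg: "0 \<le> past_contraction n v"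
  unfolding past_contraction_def using block_factor_nonneg by (intro prod_nonneg) auto

lemma pred_prob_diff_le:
  assumes "m \<le> n"
  shows "\<bar>pred_prob n y v - pred_prob m y v\<bar> \<le> past_contraction m v * lik_upper lam0 A y"
proof -
  have "block_factor (\<lambda>i. past m v ! (b * (L + 1) + i)) = block_factor (\<lambda>i. v (int (b * Suc L + i) - int m))"
    if "b < m div Suc L" for b
  proof -
    have "past m v ! (b * (L + 1) + i) = v (int (b * Suc L + i) - int m)" if "i < L" for i
      using block_index_less[OF \<open>b < m div Suc L\<close>, of i] that by (subst nth_past) auto
    then show ?thesis by (auto simp: block_factor_def)
  qed
  then have "contraction (m div Suc L) ((!) (past m v)) = past_contraction m v"
    unfolding contraction_def past_contraction_def by (intro prod.cong) auto
  moreover have "m div Suc L * (L + 1) \<le> length (past m v)"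
    using div_times_less_eq_dividend[of m "Suc L"] by (simp add: length_past)
  ultimately show ?thesis
    using bayes_extend_past[OF test_fun_lik lik_upper lik_upper_nonneg, of "m div Suc L" "past m v" init_law
        "take (n - m) (past n v)" y] past_split[OF assms, of v] state_lawD[OF state_law_init_law]
    by (simp add: pred_prob_def)
qed

text \<open>The ratio at time 0 is the price of passing to logarithms. It involves no observation of
  the blocks, so its mean factors out.\<close>

lemma nn_integral_past_contraction:
  "(\<integral>\<^sup>+\<omega>. ennreal (lik_ratio lam0 A (snd \<omega> 0) * past_contraction n (snd \<omega>)) \<partial>stationary)
    \<le> ennreal (forget_const * forget_rate ^ n)"
  unfolding stationary_law_def
proof (rule nn_integral_poisson_observed_le)
  let ?e = "\<lambda>b i. int (b * Suc L + i) - int n"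
  note neg = block_in_past[of _ n]
  have ne: "?e b i \<noteq> ?e b' i'" if "b \<noteq> b'" "i < L" "i' < L" for b b' i i'
  proof
    assume "?e b i = ?e b' i'"
    then have "b * Suc L + i = b' * Suc L + i'" by linarith
    then have "(b * Suc L + i) div Suc L = (b' * Suc L + i') div Suc L" by (rule arg_cong)
    with that show False by (simp del: mult_Suc_right)
  qed
  show "prob_space inputs" by (rule prob_space_inputs)
  show "(\<lambda>x. rate lam0 h L (\<lambda>l. x (k - int l))) \<in> borel_measurable inputs" for k by (rule stationary_rate)
  show "0 < rate lam0 h L (\<lambda>l. x (k - int l))" if "x \<in> space inputs" for x k using that by (rule stationary_rate)
  show "ennreal (lik_ratio lam0 A (snd (x, y) 0) * past_contraction n (snd (x, y)))
      \<le> ennreal (lik_ratio lam0 A (y 0) * past_contraction n y)" for x :: "int \<Rightarrow> real" and y by simp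
  have "(\<lambda>y. lik_ratio lam0 A (y 0) * past_contraction n y) \<in> borel_measurable (observations UNIV)"
  proof (rule measurable_observations_finite[of "{- int n..0}"])
    fix y y' :: "int \<Rightarrow> nat" assume eq: "\<And>k. k \<in> {- int n..0} \<Longrightarrow> y k = y' k"
    have "past_contraction n y = past_contraction n y'"
      using eq by (intro past_contraction_cong) auto
    with eq show "lik_ratio lam0 A (y 0) * past_contraction n y = lik_ratio lam0 A (y' 0) * past_contraction n y'"
      by simp
  qed auto
  then show "(\<lambda>y. ennreal (lik_ratio lam0 A (y 0) * past_contraction n y)) \<in> borel_measurable (observations UNIV)"
    by measurable
  fix x assume x: "x \<in> space inputs"
  have "(\<integral>\<^sup>+y. ennreal ((\<Prod>s\<in>{0}. lik_ratio lam0 A (y s)) *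
      (\<Prod>b\<in>{..<n div Suc L}. block_factor (\<lambda>i. y (?e b i))))
      \<partial>poisson_product UNIV (\<lambda>k. rate lam0 h L (\<lambda>l. x (k - int l))))
    \<le> ennreal (ratio_bound ^ card {0::int} * decay ^ card {..<n div Suc L})"
    using neg ne by (intro nn_integral_ratio_block_factor stationary_rate(3)[OF x]) force+
  also have "\<dots> \<le> ennreal (forget_const * forget_rate ^ n)"
  proof (rule ennreal_leI)
    have "n < Suc L * Suc (n div Suc L)" using dividend_less_times_div[of "Suc L" n] by simp
    also have "\<dots> \<le> Suc L * (n div Suc L + 2)" by (intro mult_left_mono) auto
    finally have d: "decay ^ (n div Suc L) \<le> forget_rate ^ n / decay\<^sup>2" by (intro decay_power_le) simp
    \<comment> \<open>The constant is enlarged to \<open>forget_const\<close>, which all three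
      claims then share.\<close>
    have "1 \<le> ratio_bound ^ L" using ratio_bound_ge_1 by (rule one_le_power)
    then have "1 \<le> 4 * ratio_bound ^ L" by linarith
    then have "1 * ratio_bound \<le> (4 * ratio_bound ^ L) * ratio_bound"
      using ratio_bound_ge_1 by (intro mult_right_mono) auto
    then have "ratio_bound * decay ^ (n div Suc L) \<le> (4 * ratio_bound ^ Suc L) * (forget_rate ^ n / decay\<^sup>2)"
      using d ratio_bound_ge_1 decay_pos by (intro mult_mono) (auto simp: mult_ac)
    then show "ratio_bound ^ card {0::int} * decay ^ card {..<n div Suc L} \<le> forget_const * forget_rate ^ n"
      by (simp add: forget_const_def)
  qed
  finally show "(\<integral>\<^sup>+y. ennreal (lik_ratio lam0 A (y 0) * past_contraction n y)
      \<partial>poisson_product UNIV (\<lambda>k. rate lam0 h L (\<lambda>l. x (k - int l))))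
    \<le> ennreal (forget_const * forget_rate ^ n)"
    by (simp add: past_contraction_def)
qed

section \<open>The infinite past\<close>

definition pred_prob_inf :: "nat \<Rightarrow> (int \<Rightarrow> nat) \<Rightarrow> real" where
  "pred_prob_inf y v = lim (\<lambda>n. pred_prob n y v)"

lemma measurable_past_contraction:
  "(\<lambda>\<omega>. past_contraction n (snd \<omega>)) \<in> borel_measurable stationary"
proof -
  have "past_contraction n \<in> borel_measurable (observations UNIV)"
    by (rule measurable_observations_finite[of "{- int n..-1}"]) (auto intro: past_contraction_cong)
  from measurable_compose[OF measurable_observation this] show ?thesis by simp
qed

text \<open>The alignment of the blocks moves with \<open>n\<close>, so the sequence need not be
  monotone. The summable means make the series almost surely finite instead, and its terms tend to
  0.\<close>

lemma AE_past_contraction_tendsto_0: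
  "AE \<omega> in stationary. (\<lambda>n. past_contraction n (snd \<omega>)) \<longlonglongrightarrow> 0"
proof -
  let ?b = "\<lambda>n \<omega>. ennreal (past_contraction n (snd \<omega>))"
  have m: "?b n \<in> borel_measurable stationary" for n
    using measurable_past_contraction[of n] by measurable
  have "(\<integral>\<^sup>+\<omega>. (\<Sum>n. ?b n \<omega>) \<partial>stationary) = (\<Sum>n. \<integral>\<^sup>+\<omega>. ?b n \<omega> \<partial>stationary)"
    using m by (intro nn_integral_suminf)
  also have "\<dots> \<le> (\<Sum>n. ennreal (forget_const * forget_rate ^ n))"
  proof (intro suminf_le summableI)
    fix n
    have "?b n \<omega> \<le> ennreal (lik_ratio lam0 A (snd \<omega> 0) * past_contraction n (snd \<omega>))" for \<omega>
      using mult_right_mono[OF lik_ratio_ge_1 past_contraction_nonneg] by (intro ennreal_leI) simp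
    then have "(\<integral>\<^sup>+\<omega>. ?b n \<omega> \<partial>stationary)
        \<le> (\<integral>\<^sup>+\<omega>. ennreal (lik_ratio lam0 A (snd \<omega> 0) * past_contraction n (snd \<omega>)) \<partial>stationary)"
      by (intro nn_integral_mono)
    also have "\<dots> \<le> ennreal (forget_const * forget_rate ^ n)" by (rule nn_integral_past_contraction)
    finally show "(\<integral>\<^sup>+\<omega>. ?b n \<omega> \<partial>stationary) \<le> ennreal (forget_const * forget_rate ^ n)" .
  qed
  also have "\<dots> = ennreal (\<Sum>n. forget_const * forget_rate ^ n)"
    using forget_const_nonneg forget_rate
    by (intro suminf_ennreal2 summable_mult summable_geometric) auto
  finally have "(\<integral>\<^sup>+\<omega>. (\<Sum>n. ?b n \<omega>) \<partial>stationary) \<noteq> \<infinity>" by (auto simp: top_unique)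
  then have "AE \<omega> in stationary. (\<Sum>n. ?b n \<omega>) \<noteq> \<infinity>"
    using m by (intro nn_integral_noteq_infinite) auto
  then show ?thesis
  proof (rule AE_mp, intro AE_I2 impI)
    fix \<omega> assume "(\<Sum>n. ?b n \<omega>) \<noteq> \<infinity>"
    then have "summable (\<lambda>n. past_contraction n (snd \<omega>))"
      using past_contraction_nonneg by (intro summable_suminf_not_top) auto
    then show "(\<lambda>n. past_contraction n (snd \<omega>)) \<longlonglongrightarrow> 0" by (rule summable_LIMSEQ_zero)
  qed
qed

lemma pred_prob_tendsto:
  assumes "(\<lambda>n. past_contraction n v) \<longlonglongrightarrow> 0"
  shows "(\<lambda>n. pred_prob n y v) \<longlonglongrightarrow> pred_prob_inf y v"
proof -
  have "(\<lambda>n. past_contraction n v * lik_upper lam0 A y) \<longlonglongrightarrow> 0"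
    using tendsto_mult_right[OF assms, of "lik_upper lam0 A y"] by simp
  have "Cauchy (\<lambda>n. pred_prob n y v)"
  proof (rule metric_CauchyI)
    fix e :: real assume "0 < e"
    then have "\<forall>\<^sub>F n in sequentially. past_contraction n v * lik_upper lam0 A y < e / 2"
      using order_tendstoD(2)[OF \<open>(\<lambda>n. past_contraction n v * lik_upper lam0 A y) \<longlonglongrightarrow> 0\<close>, of "e / 2"] by simp
    \<comment> \<open>Predictions of depths \<open>i\<close> and \<open>j\<close> are both compared
      with the one of depth \<open>m\<close>, hence \<open>e / 2\<close>.\<close>
    then obtain m where m: "past_contraction m v * lik_upper lam0 A y < e / 2"
      by (auto simp: eventually_sequentially)
    have "dist (pred_prob i y v) (pred_prob j y v) < e" if "m \<le> i" "m \<le> j" for i j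
      using pred_prob_diff_le[OF that(1), of y v] pred_prob_diff_le[OF that(2), of y v] m
      by (simp add: dist_real_def abs_le_iff) linarith
    then show "\<exists>M. \<forall>i\<ge>M. \<forall>j\<ge>M. dist (pred_prob i y v) (pred_prob j y v) < e" by blast
  qed
  then show ?thesis
    unfolding pred_prob_inf_def by (simp add: Cauchy_convergent_iff convergent_LIMSEQ_iff)
qed

lemma pred_prob_inf_diff_le:
  assumes "(\<lambda>n. past_contraction n v) \<longlonglongrightarrow> 0"
  shows "\<bar>pred_prob_inf y v - pred_prob m y v\<bar> \<le> past_contraction m v * lik_upper lam0 A y"
proof (rule LIMSEQ_le_const2)
  show "(\<lambda>n. \<bar>pred_prob n y v - pred_prob m y v\<bar>) \<longlonglongrightarrow> \<bar>pred_prob_inf y v - pred_prob m y v\<bar>"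
    by (intro tendsto_intros pred_prob_tendsto assms)
  show "\<exists>N. \<forall>n\<ge>N. \<bar>pred_prob n y v - pred_prob m y v\<bar> \<le> past_contraction m v * lik_upper lam0 A y"
    using pred_prob_diff_le by blast
qed

lemma pred_prob_inf_lower:
  assumes "(\<lambda>n. past_contraction n v) \<longlonglongrightarrow> 0"
  shows "lik_lower lam0 A y \<le> pred_prob_inf y v"
  using pred_prob_tendsto[OF assms, of y] pred_prob_bounds(1) by (intro LIMSEQ_le_const) auto

lemma ln_pred_prob_diff_le:
  assumes "(\<lambda>n. past_contraction n v) \<longlonglongrightarrow> 0"
  shows "\<bar>ln (pred_prob m y v) - ln (pred_prob_inf y v)\<bar> \<le> lik_ratio lam0 A y * past_contraction m v"
proof -
  have "\<bar>ln (pred_prob m y v) - ln (pred_prob_inf y v)\<bar> \<le> past_contraction m v * lik_upper lam0 A y / lik_lower lam0 A y"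
    using pred_prob_inf_diff_le[OF assms, of y m]
    by (intro abs_ln_diff_le lik_lower_pos pred_prob_bounds pred_prob_inf_lower assms) (simp add: abs_minus_commute)
  also have "\<dots> = lik_ratio lam0 A y * past_contraction m v"
    using lik_lower_pos[of y] by (simp add: lik_upper_eq)
  finally show ?thesis .
qed

lemma infinite_past: "{..-1 :: int} = (\<Union>n\<in>UNIV. {- int n..-1})"
proof (intro equalityI subsetI)
  fix k :: int assume "k \<in> {..-1}"
  then show "k \<in> (\<Union>n\<in>UNIV. {- int n..-1})" by (intro UN_I[of "nat (- k)"]) auto
qed auto

text \<open>On a fixed cylinder the identity is exact for every sufficiently deep finite past;
  dominated convergence, with the constant \<open>lik_upper\<close> as majorant, carries it to the
  limit.\<close>

lemma AE_cond_exp_infinite_past: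
  "AE \<omega> in stationary. real_cond_exp stationary (obs_algebra {..-1}) (indicator (symbol y)) \<omega>
    = pred_prob_inf y (snd \<omega>)"
proof -
  interpret M: prob_space stationary by (rule prob_space_stationary)
  text \<open>Clipping makes the bounds hold everywhere, also where the limit does not exist.\<close>
  define Z where "Z \<omega> = max 0 (min (lik_upper lam0 A y) (pred_prob_inf y (snd \<omega>)))" for \<omega> :: "(int \<Rightarrow> real) \<times> (int \<Rightarrow> nat)"
  have Zb: "0 \<le> Z \<omega> \<and> Z \<omega> \<le> lik_upper lam0 A y" for \<omega> :: "(int \<Rightarrow> real) \<times> (int \<Rightarrow> nat)"
    using lik_upper_nonneg[of y] by (auto simp: Z_def)
  have Zm: "Z \<in> borel_measurable (obs_algebra {..-1})"
  proof -
    have "(\<lambda>\<omega>. pred_prob_inf y (snd \<omega>)) \<in> borel_measurable (obs_algebra {..-1})"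
      unfolding pred_prob_inf_def by (intro borel_measurable_lim_metric measurable_pred_prob) auto
    then show ?thesis unfolding Z_def[abs_def] by measurable
  qed
  have Zm': "Z \<in> borel_measurable stationary"
    using measurable_from_subalg[OF subalgebra_obs_algebra Zm] .
  have ZAE: "AE \<omega> in stationary. Z \<omega> = pred_prob_inf y (snd \<omega>) \<and> (\<lambda>n. pred_prob n y (snd \<omega>)) \<longlonglongrightarrow> Z \<omega>"
    using AE_past_contraction_tendsto_0
  proof (rule AE_mp, intro AE_I2 impI)
    fix \<omega> :: "(int \<Rightarrow> real) \<times> (int \<Rightarrow> nat)"
    assume "(\<lambda>n. past_contraction n (snd \<omega>)) \<longlonglongrightarrow> 0"
    then have lim: "(\<lambda>n. pred_prob n y (snd \<omega>)) \<longlonglongrightarrow> pred_prob_inf y (snd \<omega>)"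
      by (rule pred_prob_tendsto)
    moreover have "0 \<le> pred_prob_inf y (snd \<omega>)"
      using lim pred_prob_nonneg by (intro LIMSEQ_le_const) auto
    moreover have "pred_prob_inf y (snd \<omega>) \<le> lik_upper lam0 A y"
      using lim pred_prob_bounds(2) by (intro LIMSEQ_le_const2) auto
    ultimately show "Z \<omega> = pred_prob_inf y (snd \<omega>) \<and> (\<lambda>n. pred_prob n y (snd \<omega>)) \<longlonglongrightarrow> Z \<omega>"
      by (simp add: Z_def)
  qed
  have cyl: "(\<integral>\<^sup>+\<omega>. ennreal (Z \<omega>) * indicator (cylinder n v) \<omega> \<partial>stationary) = emeasure stationary (cylinder n v \<inter> symbol y)"
    for n v
  proof -
    let ?f = "\<lambda>k \<omega>. ennreal (pred_prob k y (snd \<omega>)) * indicator (cylinder n v) \<omega>"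
    have "(\<lambda>k. \<integral>\<^sup>+\<omega>. ?f k \<omega> \<partial>stationary) \<longlonglongrightarrow> (\<integral>\<^sup>+\<omega>. ennreal (Z \<omega>) * indicator (cylinder n v) \<omega> \<partial>stationary)"
    proof (rule nn_integral_dominated_convergence[where w = "\<lambda>_. ennreal (lik_upper lam0 A y)"])
      show "?f k \<in> borel_measurable stationary" for k
        using measurable_pred_prob_stationary[of k y] sets_cylinder[of n v] by measurable
      show "(\<lambda>\<omega>. ennreal (Z \<omega>) * indicator (cylinder n v) \<omega>) \<in> borel_measurable stationary"
        using Zm' sets_cylinder[of n v] by measurable
      show "(\<integral>\<^sup>+\<omega>. ennreal (lik_upper lam0 A y) \<partial>stationary) < \<infinity>" by (simp add: M.emeasure_space_1)
      show "AE \<omega> in stationary. ?f k \<omega> \<le> ennreal (lik_upper lam0 A y)" for k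
        using pred_prob_bounds(2) by (intro AE_I2) (auto split: split_indicator intro: ennreal_leI)
      show "AE \<omega> in stationary. (\<lambda>k. ?f k \<omega>) \<longlonglongrightarrow> ennreal (Z \<omega>) * indicator (cylinder n v) \<omega>"
        using ZAE
      proof (rule AE_mp, intro AE_I2 impI)
        fix \<omega> assume "Z \<omega> = pred_prob_inf y (snd \<omega>) \<and> (\<lambda>n. pred_prob n y (snd \<omega>)) \<longlonglongrightarrow> Z \<omega>"
        then have "(\<lambda>k. ennreal (pred_prob k y (snd \<omega>))) \<longlonglongrightarrow> ennreal (Z \<omega>)"
          by (intro tendsto_ennrealI) (rule conjunct2)
        then show "(\<lambda>k. ?f k \<omega>) \<longlonglongrightarrow> ennreal (Z \<omega>) * indicator (cylinder n v) \<omega>"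
          by (cases "\<omega> \<in> cylinder n v") auto
      qed
    qed simp
    \<comment> \<open>A cylinder of depth \<open>n\<close> is an event of every longer past, so the
      sequence of integrals is eventually constant.\<close>
    moreover have "(\<integral>\<^sup>+\<omega>. ?f k \<omega> \<partial>stationary) = emeasure stationary (cylinder n v \<inter> symbol y)" if "n \<le> k" for k
      using that by (intro nn_integral_pred_prob cylinder_in_obs_algebra) auto
    then have "(\<lambda>k. \<integral>\<^sup>+\<omega>. ?f k \<omega> \<partial>stationary) \<longlonglongrightarrow> emeasure stationary (cylinder n v \<inter> symbol y)"
      by (intro tendsto_eventually) (auto simp: eventually_sequentially)
    ultimately show ?thesis by (rule LIMSEQ_unique)
  qed
  have "(\<integral>\<^sup>+\<omega>. ennreal (Z \<omega>) * indicator E \<omega> \<partial>stationary) = emeasure stationary (E \<inter> symbol y)"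
    if "E \<in> sets (obs_algebra {..-1})" for E
    using Zm' by (intro nn_integral_cylinders_eq[OF infinite_past _ _ cyl that]) auto
  then have "AE \<omega> in stationary. real_cond_exp stationary (obs_algebra {..-1}) (indicator (symbol y)) \<omega> = Z \<omega>"
    using Zm Zb by (intro real_cond_exp_symbol) auto
  with ZAE show ?thesis by eventually_elim simp
qed

section \<open>The logarithmic prediction error\<close>

text \<open>The event in the conditional expectation varies with the observed symbol at time 0,
  while each version is determined only up to a null set. There are countably many symbols, so one
  null set serves them all.\<close>

lemma AE_cond_pmf_obs:
  "AE \<omega> in stationary. \<bar>ln (cond_pmf_obs lam0 h L F {- int m..-1} \<omega>) - ln (cond_pmf_obs lam0 h L F {..-1} \<omega>)\<bar>
    \<le> lik_ratio lam0 A (snd \<omega> 0) * past_contraction m (snd \<omega>)"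
proof -
  have "AE \<omega> in stationary. \<forall>y. real_cond_exp stationary (obs_algebra {- int m..-1}) (indicator (symbol y)) \<omega>
      = pred_prob m y (snd \<omega>)"
    using AE_cond_exp_finite_past by (simp add: AE_all_countable)
  moreover have "AE \<omega> in stationary. \<forall>y. real_cond_exp stationary (obs_algebra {..-1}) (indicator (symbol y)) \<omega>
      = pred_prob_inf y (snd \<omega>)"
    using AE_cond_exp_infinite_past by (simp add: AE_all_countable)
  ultimately show ?thesis
    using AE_past_contraction_tendsto_0
    by eventually_elim (simp add: cond_pmf_obs_eq ln_pred_prob_diff_le)
qed

lemma nn_integral_cond_pmf_obs:
  "(\<integral>\<^sup>+\<omega>. ennreal \<bar>ln (cond_pmf_obs lam0 h L F {- int m..-1} \<omega>) - ln (cond_pmf_obs lam0 h L F {..-1} \<omega>)\<bar> \<partial>stationary)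
    \<le> ennreal (forget_const * forget_rate ^ m)"
proof -
  have "(\<integral>\<^sup>+\<omega>. ennreal \<bar>ln (cond_pmf_obs lam0 h L F {- int m..-1} \<omega>) - ln (cond_pmf_obs lam0 h L F {..-1} \<omega>)\<bar> \<partial>stationary)
      \<le> (\<integral>\<^sup>+\<omega>. ennreal (lik_ratio lam0 A (snd \<omega> 0) * past_contraction m (snd \<omega>)) \<partial>stationary)"
    using AE_cond_pmf_obs[of m] by (intro nn_integral_mono_AE) (auto elim!: eventually_mono intro: ennreal_leI)
  also have "\<dots> \<le> ennreal (forget_const * forget_rate ^ m)" by (rule nn_integral_past_contraction)
  finally show ?thesis .
qed

end

theorem lemma1:
  fixes A lam0 :: real and L :: nat and h :: "nat \<Rightarrow> real"
  assumes "0 \<le> A" and "0 < lam0"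
    and "\<And>l. l \<le> L \<Longrightarrow> 0 \<le> h l" and "(\<Sum>l\<le>L. h l) = 1"
  shows "\<exists>C \<beta> :: real. 0 < \<beta> \<and> \<beta> < 1 \<and>
    (\<forall>Pavg::real\<ge>0.
      (\<forall>F\<in>input_laws A Pavg. \<forall>\<mu>\<in>state_laws A L. \<forall>\<nu>\<in>state_laws A L. \<forall>\<rho>\<in>state_laws A L. \<forall>t\<ge>1.
        (\<integral>\<^sup>+(\<omega>, y). ennreal (tv_dist (pred_filter lam0 h L F \<mu> t y) (pred_filter lam0 h L F \<nu> t y))
            \<partial>hmm_law lam0 h L F \<rho>)
          \<le> ennreal (C * \<beta> ^ t * tv_dist \<mu> \<nu>) \<and>
        (\<integral>\<^sup>+(\<omega>, y). ennreal \<bar>ln (predictive_pmf lam0 h L (pred_filter lam0 h L F \<mu> t y) (y t))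
                         - ln (predictive_pmf lam0 h L (pred_filter lam0 h L F \<nu> t y) (y t))\<bar>
            \<partial>hmm_law lam0 h L F \<rho>)
          \<le> ennreal (C * \<beta> ^ t * tv_dist \<mu> \<nu>)) \<and>
      (\<forall>m::nat. m \<ge> 1 \<longrightarrow>
        (SUP F\<in>input_laws A Pavg.
          \<integral>\<^sup>+\<omega>. ennreal \<bar>ln (cond_pmf_obs lam0 h L F {- int m..-1} \<omega>)
                       - ln (cond_pmf_obs lam0 h L F {..-1} \<omega>)\<bar>
            \<partial>stationary_law lam0 h L F)
        \<le> ennreal (C * \<beta> ^ m)))"
proof -
  have hmm: "poisson_hmm A lam0 h L F" if "F \<in> space (prob_algebra (restrict_space borel {0..A}))" for F
    using that assms by (simp add: poisson_hmm_def)
  \<comment> \<open>The bounds on the rate are facts of the locale and thus require some input law;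
    the point mass at 0 supplies one before any \<open>F\<close> is given.\<close>
  have "return (restrict_space borel {0..A}) 0 \<in> space (prob_algebra (restrict_space borel {0..A}))"
    using assms(1) by (auto simp: space_prob_algebra space_restrict_space intro!: prob_space_return)
  note rate = poisson_hmm.forget_rate(1,2)[OF hmm[OF this]]
  have laws: "poisson_hmm.state_law A L \<mu>" if "\<mu> \<in> state_laws A L" "poisson_hmm A lam0 h L F" for \<mu> F
    using that by (simp add: poisson_hmm.state_law_def state_laws_def space_prob_algebra)
  show ?thesis
  proof (rule exI[of _ "poisson_hmm.forget_const A lam0 L"], rule exI[of _ "poisson_hmm.forget_rate A lam0 L"],
      intro conjI allI impI ballI SUP_least, goal_cases)
    case 1
    show ?case by (rule rate(1))
  next
    case 2
    show ?case by (rule rate(2))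
  next
    case (3 Pavg F \<mu> \<nu> \<rho> t)
    then interpret poisson_hmm A lam0 h L F by (intro hmm) (simp add: input_laws_def)
    have sl: "state_law \<mu>" "state_law \<nu>" "state_law \<rho>"
      using 3 by (auto intro: laws poisson_hmm_axioms)
    have "1 \<le> t" using 3 by simp
    with sl show ?case
      using tv_dist_pred_filter_le[OF sl(1,2)] by (intro nn_integral_hmm_law_le) (auto intro: ennreal_leI)
  next
    case (4 Pavg F \<mu> \<nu> \<rho> t)
    then interpret poisson_hmm A lam0 h L F by (intro hmm) (simp add: input_laws_def)
    have sl: "state_law \<mu>" "state_law \<nu>" "state_law \<rho>"
      using 4 by (auto intro: laws poisson_hmm_axioms)
    have "1 \<le> t" using 4 by simp
    with sl show ?case
      using ln_predictive_pmf_le[OF sl(1,2)] by (intro nn_integral_hmm_law_le) (auto intro: ennreal_leI)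
  next
    case (5 Pavg m F)
    then interpret poisson_hmm A lam0 h L F by (intro hmm) (simp add: input_laws_def)
    show ?case by (rule nn_integral_cond_pmf_obs)
  qed
qed

end
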